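(* In the setting described in the context, choose a dimer covering of $G$ uniformly at random. For a diagonal edge $e=\{v,w\}$ of $G$ with $v\in V(H^\perp)$, the probability that $e$ is the impurity of the random dimer covering is $$\frac{p_v}{4\sum_{u\in V(H^\perp)}p_u+d^*-3}.$$
   Context: Let $\Gamma$ be the graph with vertex set $\mathbb Z^2$, divided into white vertices $W=\{(x,y): x+y \text{ even}\}$ and black vertices $B=\mathbb Z^2\setminus W$; $v,v'$ are adjacent iff $v-v'\in\{\pm(1,0),\pm(0,1)\}$, or $v,v'\in W$ and $v-v'\in\{\pm(1,1),\pm(1,-1)\}$ (the latter are diagonal edges). A subgraph of $\Gamma$ is normal if it is induced by a finite vertex set and both it and the subgraph induced by the complementary vertex set are connected. A dimer covering of a graph is a set of its edges covering every vertex exactly once; its impurities are the diagonal edges it contains (in the setting below every dimer covering of $G$ has exactly one impurity). Let $W_0=2\mathbb Z\times 2\mathbb Z$, $W_1=W_0+(1,1)$; $\Lambda$ is the graph on $W_0$ with edges $\{v,v'\}$, $v-v'\in\{\pm(2,0),\pm(0,2)\}$, and $\Lambda^\perp$ the analogous graph on $W_1$. Setting: $H$ is a finite subgraph of $\Lambda$ formed by the boundaries of a finite set $\mathcal F$ of faces of $\Lambda$ (squares of side $2$ with corners in $W_0$), with simply connected union; the centres of these faces lie in $W_1$. $f^*\in W_1$ is a point which is not a centre of a face in $\mathcal F$, chosen so that the subgraph of $\Lambda^\perp$ induced by the face-centres together with $f^*$ is simply connected. $H^\perp$ is the planar dual of $H$ whose outer-face vertex is $f^*$: $V(H^\perp)$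 consists of the face centres and $f^*$, and for every edge $e$ of $H$ there is one edge $e^\perp$ of $H^\perp$ joining the vertices representing the two faces on either side of $e$. $d^*$ is the number of edges of $\Lambda^\perp$ joining $f^*$ to face centres. $v^*$ is a vertex of $H$ on the boundary of the outer face with $v^*-f^*\in\{\pm(1,1),\pm(1,-1)\}$. $G$ is the subgraph of $\Gamma$ induced by $V(H)\cup V(H^\perp)\cup\{\text{midpoints of edges of }H\}$, assumed normal. $A$ is the square matrix indexed by the face centres with entries $a_{u,u}=4$, $a_{u,u'}=-1$ if the faces with centres $u\neq u'$ share an edge of $H$, and $a_{u,u'}=0$ otherwise. $\mathbf b=(b_u)$ is indexed by the face centres with $b_u=1$ if $u$ is adjacent to $f^*$ in $\Lambda^\perp$ and $b_u=0$ otherwise. $(p_u)_{u\ne f^*}=A^{-1}\mathbf b$ and $p_{f^*}=1$. (Equivalently, $p_u$ is the probability that simple random walk on $H^\perp$ started at $u$ first reaches $f^*$ through one of the edges of $\Lambda^\perp$ joining $f^*$ to a face centre.) *)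

theory Defs
  imports "HOL-Analysis.Analysis"
begin

type_synonym pt = "int \<times> int"

definition pdiff :: "pt \<Rightarrow> pt \<Rightarrow> pt" where
  "pdiff v w = (fst v - fst w, snd v - snd w)"

definition padd :: "pt \<Rightarrow> pt \<Rightarrow> pt" where
  "padd v s = (fst v + fst s, snd v + snd s)"

definition white :: "pt \<Rightarrow> bool" where
  "white v \<longleftrightarrow> even (fst v + snd v)"

definition axis_steps :: "pt set" where
  "axis_steps = {(1,0), (-1,0), (0,1), (0,-1)}"

definition diag_steps :: "pt set" where
  "diag_steps = {(1,1), (-1,-1), (1,-1), (-1,1)}"

definition lattice2_steps :: "pt set" where
  "lattice2_steps = {(2,0), (-2,0), (0,2), (0,-2)}"

text \<open>Adjacency in the graph Gamma on Z^2.\<close>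
definition Gamma_adj :: "pt \<Rightarrow> pt \<Rightarrow> bool" where
  "Gamma_adj v w \<longleftrightarrow> pdiff v w \<in> axis_steps \<or> (white v \<and> white w \<and> pdiff v w \<in> diag_steps)"

text \<open>Connectedness of the subgraph of Gamma induced by a vertex set S.\<close>
definition induced_connected :: "pt set \<Rightarrow> bool" where
  "induced_connected S \<longleftrightarrow>
     (\<forall>x\<in>S. \<forall>y\<in>S. (x, y) \<in> {(a, b). a \<in> S \<and> b \<in> S \<and> Gamma_adj a b}\<^sup>*)"

text \<open>Normal subgraph (given by its finite inducing vertex set).\<close>
definition normal :: "pt set \<Rightarrow> bool" where
  "normal S \<longleftrightarrow> finite S \<and> induced_connected S \<and> induced_connected (- S)"

text \<open>Edges of the subgraph of Gamma induced by S.\<close>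
definition induced_edges :: "pt set \<Rightarrow> pt set set" where
  "induced_edges S = {{v, w} | v w. v \<in> S \<and> w \<in> S \<and> Gamma_adj v w}"

definition dimer_covering :: "pt set \<Rightarrow> pt set set \<Rightarrow> bool" where
  "dimer_covering S M \<longleftrightarrow> M \<subseteq> induced_edges S \<and> (\<forall>v\<in>S. \<exists>!e. e \<in> M \<and> v \<in> e)"

definition diagonal_edge :: "pt set \<Rightarrow> bool" where
  "diagonal_edge e \<longleftrightarrow> (\<exists>v w. e = {v, w} \<and> white v \<and> white w \<and> pdiff v w \<in> diag_steps)"

text \<open>W0 = 2Z x 2Z, W1 = W0 + (1,1).\<close>
definition W0 :: "pt set" where "W0 = {v. even (fst v) \<and> even (snd v)}"
definition W1 :: "pt set" where "W1 = {v. odd (fst v) \<and> odd (snd v)}"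

text \<open>Faces of Lambda are indexed by their centres c in W1; corners are c + (+-1,+-1).\<close>
definition face_corners :: "pt \<Rightarrow> pt set" where
  "face_corners c = padd c ` diag_steps"

text \<open>Vertices of H, midpoints of edges of H (each edge of the boundary of the face with
  centre c has midpoint c + (+-1,0) or c + (0,+-1)).\<close>
definition VH :: "pt set \<Rightarrow> pt set" where
  "VH C = (\<Union>c\<in>C. face_corners c)"

definition mids_H :: "pt set \<Rightarrow> pt set" where
  "mids_H C = (\<Union>c\<in>C. padd c ` axis_steps)"

text \<open>Vertex set of G = V(H) + V(H^perp) + midpoints of edges of H.\<close>
definition VG :: "pt set \<Rightarrow> pt \<Rightarrow> pt set" where
  "VG C f = VH C \<union> (C \<union> {f}) \<union> mids_H C"

definition rpt :: "pt \<Rightarrow> real \<times> real" where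
  "rpt v = (real_of_int (fst v), real_of_int (snd v))"

text \<open>Closed square face of Lambda with centre c, as a subset of the plane.\<close>
definition face_square :: "pt \<Rightarrow> (real \<times> real) set" where
  "face_square c = cbox (rpt c - (1,1)) (rpt c + (1,1))"

text \<open>Geometric realisation (vertices, edges and 4-cycle faces) of the subgraph of
  Lambda^perp induced by a vertex set S.\<close>
definition perp_complex :: "pt set \<Rightarrow> (real \<times> real) set" where
  "perp_complex S =
     rpt ` S
     \<union> (\<Union>{closed_segment (rpt u) (rpt u') | u u'. u \<in> S \<and> u' \<in> S \<and> pdiff u' u \<in> lattice2_steps})
     \<union> (\<Union>{cbox (rpt u) (rpt u + (2,2)) | u. u \<in> S \<and> padd u (2,0) \<in> S \<and> padd u (0,2) \<in> S
                                          \<and> padd u (2,2) \<in> S})"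

text \<open>Entries of A (faces sharing an edge of H iff centres differ by (+-2,0),(0,+-2)) and of b.\<close>
definition A_entry :: "pt \<Rightarrow> pt \<Rightarrow> real" where
  "A_entry u u' = (if u = u' then 4 else if pdiff u' u \<in> lattice2_steps then -1 else 0)"

definition b_entry :: "pt \<Rightarrow> pt \<Rightarrow> real" where
  "b_entry f u = (if pdiff f u \<in> lattice2_steps then 1 else 0)"

definition d_star :: "pt set \<Rightarrow> pt \<Rightarrow> nat" where
  "d_star C f = card {u \<in> C. pdiff f u \<in> lattice2_steps}"

text \<open>A vertex of H on the boundary of the outer face: some incident face of Lambda is not in F
  (by simple connectivity of the union of the faces, all such faces lie in the outer face).\<close>
definition on_outer_boundary :: "pt set \<Rightarrow> pt \<Rightarrow> bool" where
  "on_outer_boundary C v \<longleftrightarrow> v \<in> VH C \<and> (\<exists>s\<in>diag_steps. padd v s \<notin> C)"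

end

theory Submission
  imports Defs
begin

text \<open>
  Remove the two ends \<open>v\<close>, \<open>w\<close> of an impurity and let every other white vertex point to its
  partner and on to the next white vertex. This is a flow on the vertices of \<open>H\<close> and one on those
  of \<open>H\<^sup>\<bottom>\<close>. Neither has a cycle: the vertices flowing to \<open>w\<close> and those flowing to \<open>v\<close> span two
  trees, the cut of each is an even set of edges of the other graph used by the other flow, and a
  tree contains no nonempty even set; as \<open>v\<close> and \<open>w\<close> are incident, the two trees therefore spread
  over everything (Temperley's bijection). By planar duality the primal tree is the complement of the
  dual one, so the number \<open>D v\<close> of coverings with impurity \<open>{v, w}\<close> counts spanning trees of
  \<open>H\<^sup>\<bottom>\<close> rooted at \<open>v\<close> which leave \<open>f\<close> through an edge of \<open>\<Lambda>\<^sup>\<bottom>\<close>. The balance equation of the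
  Markov chain tree theorem says that \<open>D\<close> solves \<open>A D = D f \<cdot> b\<close>, whence \<open>D v = p v \<cdot> D f\<close>. Finally every
  face centre has four corners in \<open>H\<close>, whereas \<open>f\<close> has \<open>d\<^sup>* + 1\<close> of them, because the corners and sides
  of \<open>f\<close> lying in \<open>G\<close> form a single arc.
\<close>

text \<open>The outer vertex \<open>f\<close> plays two roles. As the outer face of \<open>H\<close>
  it can be entered across every outer side of \<open>C\<close>; as a lattice point it is matched to
  a neighbouring midpoint, so it can be left only across the at most four sides of its own square.
  This asymmetry is why \<open>b_entry\<close> has its ones just at the lattice neighbours of
  \<open>f\<close>. Planarity is used through parity. Around a lattice point the membership of the
  four surrounding squares changes an even number of times, which makes a cut of one graph an even
  edge set of the other. Conversely, counting crossings with a horizontal ray turns an even edge set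
  into the boundary of a set of squares. The topology of the faces enters as two discrete facts: the
  faces of \<open>C\<close> are chained by common corners, the squares outside \<open>C\<close> by
  common sides. Normality of \<open>G\<close> chains the squares outside \<open>insert f C\<close>,
  and this makes the corners of \<open>f\<close> an arc. The constant -3 is
  \<open>d_star C f + 1\<close> minus 4: the sum in the denominator counts four corners for
  \<open>f\<close> as well, with weight \<open>p f = 1\<close>.\<close>

section \<open>Connectedness of the faces and of their complement\<close>

text \<open>A compact plane set that is simply connected and locally path connected is Borsukian and
  hence does not separate the plane. The criterion speaks of complex numbers, which explains the
  linear homeomorphism \<open>?h\<close>; a finite union of closed convex sets is an ANR, and this
  gives local path connectedness.\<close>

lemma compl_face_union_connected:
  assumes finC: "finite C" and sc: "simply_connected (\<Union>c\<in>C. face_square c)"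
  shows "connected (- (\<Union>c\<in>C. face_square c))"
proof -
  let ?U = "\<Union>c\<in>C. face_square c"
  let ?h = "\<lambda>(x, y). Complex x y"
  have lin: "linear ?h"
    by (rule linearI) (auto simp: complex_eq_iff split: prod.splits)
  have bij: "bij ?h"
    by (rule o_bij[where g = "\<lambda>z. (Re z, Im z)"]) (auto simp: fun_eq_iff)
  have lpc: "locally path_connected ?U"
  proof (rule ANR_imp_locally_path_connected, rule ANR_finite_Union_convex_closed)
    show "finite (face_square ` C)" using finC by simp
  qed (auto simp: face_square_def)
  have comp: "compact ?U"
    using finC by (auto intro!: compact_UN simp: face_square_def)
  have hom: "?U homeomorphic ?h ` ?U"
    using lin bij by (simp add: linear_homeomorphic_image bij_is_inj)
  have "Borsukian (?h ` ?U)"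
    using sc lpc hom
    by (metis simply_connected_imp_Borsukian homeomorphic_Borsukian)
  moreover have "compact (?h ` ?U)"
    using comp lin linear_continuous_on linear_conv_bounded_linear compact_continuous_image
    by blast
  ultimately have "connected (- ?h ` ?U)"
    using Borsukian_separation_compact by blast
  moreover have "- ?h ` ?U = ?h ` (- ?U)"
    using bij by (rule bij_image_Compl_eq[symmetric])
  ultimately have "connected (?h ` (- ?U))" by simp
  moreover have "- ?U homeomorphic ?h ` (- ?U)"
    using lin bij by (simp add: linear_homeomorphic_image bij_is_inj)
  ultimately show ?thesis using homeomorphic_connectedness by blast
qed

definition edge_closed :: "pt set \<Rightarrow> pt set \<Rightarrow> bool" where
  "edge_closed S D \<longleftrightarrow> D \<subseteq> S \<and> (\<forall>u\<in>D. \<forall>s\<in>lattice2_steps. u + s \<in> S \<longrightarrow> u + s \<in> D)"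

text \<open>Since the steps are symmetric, the closed subsets are the unions of components. Testing
  closed sets instead of paths suits arguments by locally constant membership.\<close>

definition edge_connected :: "pt set \<Rightarrow> bool" where
  "edge_connected S \<longleftrightarrow> (\<forall>D. edge_closed S D \<longrightarrow> D \<noteq> {} \<longrightarrow> S \<subseteq> D)"

lemma eventually_floor_left:
  fixes x :: real
  shows "\<forall>\<^sub>F x' in nhds x. \<lfloor>x'\<rfloor> = \<lfloor>x\<rfloor> \<or> (x = of_int \<lfloor>x\<rfloor> \<and> \<lfloor>x'\<rfloor> = \<lfloor>x\<rfloor> - 1)"
proof (cases "x = of_int \<lfloor>x\<rfloor>")
  case True
  have "\<forall>\<^sub>F x' in nhds x. x' \<in> {x - 1<..<x + 1}"
    by (intro eventually_nhds_in_open) auto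
  then show ?thesis
  proof eventually_elim
    case (elim x')
    with True have "\<lfloor>x'\<rfloor> = \<lfloor>x\<rfloor> \<or> \<lfloor>x'\<rfloor> = \<lfloor>x\<rfloor> - 1"
      by (simp add: floor_eq_iff) linarith
    with True show ?case by simp
  qed
next
  case False
  have "of_int \<lfloor>x\<rfloor> < x" "x < of_int \<lfloor>x\<rfloor> + 1" using False by linarith+
  then have "x \<in> {of_int \<lfloor>x\<rfloor> <..< of_int \<lfloor>x\<rfloor> + 1}" by simp
  then have "\<forall>\<^sub>F x' in nhds x. x' \<in> {of_int \<lfloor>x\<rfloor> <..< of_int \<lfloor>x\<rfloor> + 1}"
    by (intro eventually_nhds_in_open) auto
  then show ?thesis
    by eventually_elim (auto simp: floor_eq_iff)
qed

text \<open>Membership in \<open>D\<close> of the square containing a point is locally constant off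
  the faces: all squares near such a point lie outside \<open>C\<close> and are linked across
  sides.\<close>

lemma complement_faces_edge_connected:
  assumes conn: "connected (- (\<Union>c\<in>C. face_square c))"
    and CW1: "C \<subseteq> W1"
  shows "edge_connected (W1 - C)"
  unfolding edge_connected_def
proof (intro allI impI subsetI)
  fix D b assume D: "edge_closed (W1 - C) D" and "D \<noteq> {}" and b: "b \<in> W1 - C"
  then obtain a where a: "a \<in> D" by blast
  let ?U = "\<Union>c\<in>C. face_square c"
  define F :: "real \<times> real \<Rightarrow> pt"
    where "F z = (2 * \<lfloor>fst z / 2\<rfloor> + 1, 2 * \<lfloor>snd z / 2\<rfloor> + 1)" for z
  have Fr: "F (rpt u) = u" if "u \<in> W1" for u
  proof -
    from that obtain i j where u: "u = (2 * i + 1, 2 * j + 1)"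
      unfolding W1_def by (metis (mono_tags, lifting) mem_Collect_eq oddE prod.collapse)
    have "\<lfloor>(2 * real_of_int k + 1) / 2\<rfloor> = k" for k by (simp add: floor_eq_iff field_simps)
    then show ?thesis by (simp add: F_def rpt_def u)
  qed
  have rU: "rpt u \<in> - ?U" if u: "u \<in> W1 - C" for u
  proof (rule ccontr)
    assume "\<not> rpt u \<in> - ?U"
    then obtain c where c: "c \<in> C" "rpt u \<in> face_square c" by auto
    with CW1 have c1: "c \<in> W1" by auto
    have "\<bar>fst u - fst c\<bar> \<le> 1" "\<bar>snd u - snd c\<bar> \<le> 1"
      using c(2) by (auto simp: face_square_def rpt_def cbox_Pair_eq)
    moreover have "odd (fst u)" "odd (fst c)" "odd (snd u)" "odd (snd c)"
      using u c1 by (auto simp: W1_def)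
    ultimately have "fst u = fst c" "snd u = snd c" by presburger+
    then have "u = c" by (simp add: prod_eq_iff)
    with c(1) u show False by simp
  qed
  \<comment> \<open>\<open>Q z i j\<close> describes the squares whose half-open cells come
    arbitrarily close to \<open>z\<close>: the floor may drop by one to the left of an
    integer.\<close>
  define Q where "Q z i j \<longleftrightarrow> (i = \<lfloor>fst z / 2\<rfloor> \<or> (fst z / 2 = of_int \<lfloor>fst z / 2\<rfloor> \<and> i = \<lfloor>fst z / 2\<rfloor> - 1))
      \<and> (j = \<lfloor>snd z / 2\<rfloor> \<or> (snd z / 2 = of_int \<lfloor>snd z / 2\<rfloor> \<and> j = \<lfloor>snd z / 2\<rfloor> - 1))"
    for z :: "real \<times> real" and i j
  have Qout: "(2 * i + 1, 2 * j + 1) \<in> W1 - C" if z: "z \<in> - ?U" and "Q z i j" for z i j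
  proof -
    have "z \<in> face_square (2 * i + 1, 2 * j + 1)"
    proof -
      have "2 * of_int i \<le> fst z \<and> fst z \<le> 2 * of_int i + 2"
        using \<open>Q z i j\<close> unfolding Q_def by linarith
      moreover have "2 * of_int j \<le> snd z \<and> snd z \<le> 2 * of_int j + 2"
        using \<open>Q z i j\<close> unfolding Q_def by linarith
      ultimately show ?thesis
        by (cases z) (auto simp: face_square_def rpt_def cbox_Pair_eq)
    qed
    with z show ?thesis by (auto simp: W1_def)
  qed
  have Dstep: "p + s \<in> D" if "p \<in> D" "s \<in> lattice2_steps" "p + s \<in> W1 - C" for p s
    using D that by (auto simp: edge_closed_def)
  \<comment> \<open>Horizontal and vertical moves are separated because squares meeting only in a
    corner are not neighbours; the intermediate square satisfies \<open>Q\<close> too.\<close>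
  have Qx: "(2 * i + 1, 2 * j + 1) \<in> D \<longleftrightarrow> (2 * i' + 1, 2 * j + 1) \<in> D"
    if z: "z \<in> - ?U" "Q z i j" "Q z i' j" for z i i' j
  proof -
    have "i' = i \<or> i' = i + 1 \<or> i' = i - 1" using z(2,3) by (auto simp: Q_def)
    then show ?thesis
      using Dstep[of "(2 * i + 1, 2 * j + 1)" "(2,0)"] Dstep[of "(2 * i + 1, 2 * j + 1)" "(-2,0)"]
        Dstep[of "(2 * i' + 1, 2 * j + 1)" "(2,0)"] Dstep[of "(2 * i' + 1, 2 * j + 1)" "(-2,0)"]
        Qout[OF z(1,2)] Qout[OF z(1,3)]
      by (auto simp: lattice2_steps_def algebra_simps)
  qed
  have Qy: "(2 * i + 1, 2 * j + 1) \<in> D \<longleftrightarrow> (2 * i + 1, 2 * j' + 1) \<in> D"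
    if z: "z \<in> - ?U" "Q z i j" "Q z i j'" for z i j j'
  proof -
    have "j' = j \<or> j' = j + 1 \<or> j' = j - 1" using z(2,3) by (auto simp: Q_def)
    then show ?thesis
      using Dstep[of "(2 * i + 1, 2 * j + 1)" "(0,2)"] Dstep[of "(2 * i + 1, 2 * j + 1)" "(0,-2)"]
        Dstep[of "(2 * i + 1, 2 * j' + 1)" "(0,2)"] Dstep[of "(2 * i + 1, 2 * j' + 1)" "(0,-2)"]
        Qout[OF z(1,2)] Qout[OF z(1,3)]
      by (auto simp: lattice2_steps_def algebra_simps)
  qed
  have aW: "a \<in> W1 - C" using a D by (auto simp: edge_closed_def)
  have "(F (rpt a) \<in> D) = (F (rpt b) \<in> D)"
  proof (rule connected_local_const[OF conn])
    show "rpt a \<in> - ?U" "rpt b \<in> - ?U"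
      by (rule rU[OF aW], rule rU[OF b])
    show "\<forall>z\<in>- ?U. \<forall>\<^sub>F z' in at z within - ?U. (F z \<in> D) = (F z' \<in> D)"
    proof
      fix z assume z: "z \<in> - ?U"
      have "filterlim (\<lambda>z'. fst z' / 2) (nhds (fst z / 2)) (nhds z)"
        by (intro tendsto_intros filterlim_ident) auto
      from eventually_compose_filterlim[OF eventually_floor_left this]
      have e1: "\<forall>\<^sub>F z' in nhds z. \<lfloor>fst z' / 2\<rfloor> = \<lfloor>fst z / 2\<rfloor> \<or> (fst z / 2 = of_int \<lfloor>fst z / 2\<rfloor> \<and> \<lfloor>fst z' / 2\<rfloor> = \<lfloor>fst z / 2\<rfloor> - 1)" .
      have "filterlim (\<lambda>z'. snd z' / 2) (nhds (snd z / 2)) (nhds z)"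
        by (intro tendsto_intros filterlim_ident) auto
      from eventually_compose_filterlim[OF eventually_floor_left this]
      have e2: "\<forall>\<^sub>F z' in nhds z. \<lfloor>snd z' / 2\<rfloor> = \<lfloor>snd z / 2\<rfloor> \<or> (snd z / 2 = of_int \<lfloor>snd z / 2\<rfloor> \<and> \<lfloor>snd z' / 2\<rfloor> = \<lfloor>snd z / 2\<rfloor> - 1)" .
      have "\<forall>\<^sub>F z' in nhds z. (F z \<in> D) = (F z' \<in> D)"
        using e1 e2
      proof eventually_elim
        case (elim z')
        let ?i = "\<lfloor>fst z / 2\<rfloor>" and ?j = "\<lfloor>snd z / 2\<rfloor>" and ?i' = "\<lfloor>fst z' / 2\<rfloor>" and ?j' = "\<lfloor>snd z' / 2\<rfloor>"
        have "Q z ?i ?j" "Q z ?i' ?j" "Q z ?i' ?j'" using elim by (auto simp: Q_def)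
        then show ?case using Qx[OF z, of ?i ?j ?i'] Qy[OF z, of ?i' ?j ?j'] by (simp add: F_def)
      qed
      then show "\<forall>\<^sub>F z' in at z within - ?U. (F z \<in> D) = (F z' \<in> D)"
        by (rule filter_leD[rotated]) (simp add: at_within_le_nhds)
    qed
  qed
  then show "b \<in> D" using a b aW by (simp add: Fr)
qed

text \<open>Closed squares that touch share a corner, so \<open>D\<close> and \<open>C - D\<close>
  would split the union of the faces into two disjoint closed sets.\<close>

lemma corner_connected:
  assumes finC: "finite C" and CW1: "C \<subseteq> W1"
    and conn: "connected (\<Union>c\<in>C. face_square c)"
    and D: "D \<subseteq> C" "\<And>c c'. c \<in> D \<Longrightarrow> c' \<in> C \<Longrightarrow> face_corners c \<inter> face_corners c' \<noteq> {} \<Longrightarrow> c' \<in> D"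
    and a: "a \<in> D"
  shows "D = C"
proof (rule ccontr)
  assume "D \<noteq> C"
  then obtain b where b: "b \<in> C - D" using D(1) by auto
  let ?S = "\<lambda>X. \<Union>c\<in>X. face_square c"
  have fin: "finite D" "finite (C - D)" using finC D(1) by (auto intro: finite_subset)
  have cl: "closed (?S X)" if "finite X" for X
    using that by (intro closed_UN) (auto simp: face_square_def)
  have disj: "?S D \<inter> ?S (C - D) = {}"
  proof (rule ccontr)
    assume "?S D \<inter> ?S (C - D) \<noteq> {}"
    then obtain z c c' where z: "c \<in> D" "c' \<in> C - D" "z \<in> face_square c" "z \<in> face_square c'" by blast
    have bd: "\<bar>fst c - fst c'\<bar> \<le> 2" "\<bar>snd c - snd c'\<bar> \<le> 2"
      using z(3,4) by (cases z; auto simp: face_square_def rpt_def cbox_Pair_eq; linarith)+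
    have odd: "odd (fst c)" "odd (fst c')" "odd (snd c)" "odd (snd c')"
      using z(1,2) D(1) CW1 by (auto simp: W1_def)
    \<comment> \<open>The common corner: in each coordinate the side of \<open>c\<close> facing
      \<open>c'\<close>; if the coordinates agree, either side serves.\<close>
    define x where "x = (if fst c' > fst c then fst c + 1 else fst c - 1)"
    define y where "y = (if snd c' > snd c then snd c + 1 else snd c - 1)"
    have x: "x - fst c \<in> {1, -1}" "x - fst c' \<in> {1, -1}"
      using bd odd unfolding x_def by (auto split: if_splits) presburger+
    have y: "y - snd c \<in> {1, -1}" "y - snd c' \<in> {1, -1}"
      using bd odd unfolding y_def by (auto split: if_splits) presburger+
    have corner: "(x, y) \<in> face_corners d" if "x - fst d \<in> {1, -1}" "y - snd d \<in> {1, -1}" for d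
      unfolding face_corners_def
      by (rule image_eqI[where x = "(x - fst d, y - snd d)"]) (use that in \<open>auto simp: padd_def diag_steps_def\<close>)
    have "face_corners c \<inter> face_corners c' \<noteq> {}" using corner x y by blast
    with D(2) z show False by blast
  qed
  have "?S C = ?S D \<union> ?S (C - D)" using D(1) by blast
  then have "?S D \<inter> ?S C = {} \<or> ?S (C - D) \<inter> ?S C = {}"
    using disj by (intro connected_closedD[OF conn]) (auto intro!: cl fin)
  moreover have in_sq: "rpt c \<in> face_square c" for c by (auto simp: face_square_def cbox_Pair_eq rpt_def)
  have in_S: "rpt c \<in> ?S X" if "c \<in> X" for c X using that in_sq by (rule UN_I)
  have "rpt a \<in> ?S D" "rpt a \<in> ?S C" by (rule in_S, use a D(1) in blast)+
  moreover have "rpt b \<in> ?S (C - D)" "rpt b \<in> ?S C" by (rule in_S, use b in blast)+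
  ultimately show False by (metis IntI empty_iff)
qed

section \<open>Lattice steps, flows and cuts\<close>

definition rot :: "pt \<Rightarrow> pt" where
  "rot s = (- snd s, fst s)"

lemma padd_eq_plus: "padd v s = v + s"
  by (simp add: padd_def plus_prod_def)

lemma pdiff_eq_minus: "pdiff v w = v - w"
  by (simp add: pdiff_def minus_prod_def)

lemma finite_axis_steps [simp]: "finite axis_steps"
  by (simp add: axis_steps_def)

lemma finite_diag_steps [simp]: "finite diag_steps"
  by (simp add: diag_steps_def)

lemma uminus_axis [simp]: "- s \<in> axis_steps \<longleftrightarrow> s \<in> axis_steps"
  by (cases s) (auto simp: axis_steps_def)

lemma axis_two_ne: "s \<in> axis_steps \<Longrightarrow> x + s + s \<noteq> x"
  by (cases x) (auto simp: axis_steps_def prod_eq_iff)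

lemma axis_uminus_ne: "s \<in> axis_steps \<Longrightarrow> - s \<noteq> s"
  by (auto simp: axis_steps_def)

lemma W0_axis_two: "t \<in> axis_steps \<Longrightarrow> x + t + t \<in> W0 \<longleftrightarrow> x \<in> W0"
  by (cases x) (auto simp: axis_steps_def W0_def)

lemma W1_axis_two: "t \<in> axis_steps \<Longrightarrow> x + t + t \<in> W1 \<longleftrightarrow> x \<in> W1"
  by (cases x) (auto simp: axis_steps_def W1_def)

lemma W0_diag: "t \<in> diag_steps \<Longrightarrow> x + t \<in> W0 \<longleftrightarrow> x \<in> W1"
  by (cases x) (auto simp: diag_steps_def W0_def W1_def)

lemma W0_W1_disjoint: "x \<in> W0 \<Longrightarrow> x \<in> W1 \<Longrightarrow> False"
  by (auto simp: W0_def W1_def)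

lemma W0_axis_one: "x \<in> W0 \<union> W1 \<Longrightarrow> t \<in> axis_steps \<Longrightarrow> x + t \<notin> W0 \<and> x + t \<notin> W1"
  by (cases x) (auto simp: axis_steps_def W0_def W1_def)

lemma card_axis_eq:
  "card {t \<in> axis_steps. P t} = of_bool (P (1,0)) + of_bool (P (-1,0)) + of_bool (P (0,1)) + of_bool (P (0,-1))"
proof -
  have "card {t \<in> axis_steps. P t} = (\<Sum>t\<in>axis_steps. of_bool (P t))"
    by (subst sum_of_bool_eq) (auto simp: Collect_conj_eq)
  also have "\<dots> = of_bool (P (1,0)) + of_bool (P (-1,0)) + of_bool (P (0,1)) + of_bool (P (0,-1))"
    by (simp add: axis_steps_def)
  finally show ?thesis .
qed

lemma even_card_other:
  assumes "even (card {t \<in> A. P t})" "t \<in> A" "P t"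
  obtains t' where "t' \<in> A" "P t'" "t' \<noteq> t"
proof -
  have "{t \<in> A. P t} \<noteq> {t}"
  proof
    assume "{t \<in> A. P t} = {t}"
    with assms(1) show False by simp
  qed
  moreover have "t \<in> {t \<in> A. P t}" using assms(2,3) by simp
  ultimately have "\<exists>t'\<in>{t \<in> A. P t}. t' \<noteq> t" by blast
  then show ?thesis using that by blast
qed

text \<open>The points \<open>x + t + rot t\<close> surround \<open>x\<close>, and each
  \<open>x + t\<close> lies between two consecutive ones; a cyclic sequence changes its value an
  even number of times.\<close>

lemma even_sign_changes:
  assumes "\<And>t. t \<in> axis_steps \<Longrightarrow> P t \<longleftrightarrow> (x + t + rot t \<in> K) \<noteq> (x + t - rot t \<in> K)"
  shows "even (card {t \<in> axis_steps. P t})"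
proof -
  obtain a b where x: "x = (a, b)" by force
  have "P (1,0) \<longleftrightarrow> ((a+1,b+1) \<in> K) \<noteq> ((a+1,b-1) \<in> K)"
    "P (-1,0) \<longleftrightarrow> ((a-1,b-1) \<in> K) \<noteq> ((a-1,b+1) \<in> K)"
    "P (0,1) \<longleftrightarrow> ((a-1,b+1) \<in> K) \<noteq> ((a+1,b+1) \<in> K)"
    "P (0,-1) \<longleftrightarrow> ((a+1,b-1) \<in> K) \<noteq> ((a-1,b-1) \<in> K)"
    using assms[of "(1,0)"] assms[of "(-1,0)"] assms[of "(0,1)"] assms[of "(0,-1)"]
    by (auto simp: axis_steps_def rot_def x)
  then show ?thesis unfolding card_axis_eq by auto
qed

section \<open>Iteration of a map towards a root\<close>

definition reaches :: "('a \<Rightarrow> 'a) \<Rightarrow> 'a \<Rightarrow> 'a \<Rightarrow> bool" where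
  "reaches g r x \<longleftrightarrow> (\<exists>n. (g ^^ n) x = r)"

definition hit_time :: "('a \<Rightarrow> 'a) \<Rightarrow> 'a \<Rightarrow> 'a \<Rightarrow> nat" where
  "hit_time g r x = (LEAST n. (g ^^ n) x = r)"

lemma reaches_refl [simp]: "reaches g r r"
  unfolding reaches_def by (rule exI[of _ 0]) simp

lemma reaches_step: "x \<noteq> r \<Longrightarrow> reaches g r x \<longleftrightarrow> reaches g r (g x)"
proof
  assume "reaches g r (g x)"
  then obtain n where "(g ^^ n) (g x) = r" by (auto simp: reaches_def)
  then have "(g ^^ Suc n) x = r" by (simp add: funpow_swap1)
  then show "reaches g r x" unfolding reaches_def by blast
next
  assume "x \<noteq> r" "reaches g r x"
  then obtain n where n: "(g ^^ n) x = r" by (auto simp: reaches_def)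
  with \<open>x \<noteq> r\<close> obtain m where "n = Suc m" by (cases n) auto
  with n have "(g ^^ m) (g x) = r" by (simp add: funpow_swap1)
  then show "reaches g r (g x)" unfolding reaches_def by blast
qed

lemma hit_time_step:
  assumes "x \<noteq> r" "reaches g r x"
  shows "hit_time g r x = Suc (hit_time g r (g x))"
proof -
  from assms(2) obtain n where n: "(g ^^ n) x = r" by (auto simp: reaches_def)
  have "(LEAST n. (g ^^ n) x = r) = Suc (LEAST m. (g ^^ Suc m) x = r)"
    using n assms(1) by (intro Least_Suc) auto
  then show ?thesis unfolding hit_time_def by (simp add: funpow_swap1)
qed

lemma reaches_induct [consumes 1, case_names root step]:
  assumes "reaches g r x" "P r" "\<And>x. x \<noteq> r \<Longrightarrow> reaches g r x \<Longrightarrow> P (g x) \<Longrightarrow> P x"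
  shows "P x"
  using assms(1)
proof (induction "hit_time g r x" arbitrary: x)
  case 0
  then have "x = r" using hit_time_step by fastforce
  then show ?case using assms(2) by simp
next
  case (Suc n)
  show ?case
  proof (cases "x = r")
    case False
    then have "hit_time g r x = Suc (hit_time g r (g x))" "reaches g r (g x)"
      using Suc.prems hit_time_step reaches_step by metis+
    then show ?thesis using Suc False assms(3) by auto
  qed (use assms(2) in simp)
qed

text \<open>Mostly used to trap a flow: a set that the flow cannot leave before meeting the root,
  yet misses the root, contains no vertex flowing to it.\<close>

lemma reaches_closed:
  assumes "reaches g r x" "x \<in> X" "\<And>y. y \<in> X \<Longrightarrow> y \<noteq> r \<Longrightarrow> g y \<in> X"
  shows "r \<in> X"
  using assms(1,2)
proof (induction rule: reaches_induct)
  case (step x) then show ?case using assms(3) by blast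
qed

lemma no_two_cycle:
  assumes "reaches g r x" "x \<noteq> r" "y \<noteq> r" "g x = y" "g y = x"
  shows False
  using reaches_closed[OF assms(1), of "{x, y}"] assms by auto

lemma finite_max_nat:
  fixes h :: "'a \<Rightarrow> nat"
  assumes "finite A" "x \<in> A"
  obtains y where "y \<in> A" "\<And>z. z \<in> A \<Longrightarrow> h z \<le> h y"
proof -
  have "finite (h ` A)" "h ` A \<noteq> {}" using assms by auto
  then obtain y where "y \<in> A" "h y = Max (h ` A)" using Max_in by (metis imageE)
  then show ?thesis using that Max_ge[OF \<open>finite (h ` A)\<close>] by auto
qed

section \<open>The discrete setting and its cuts\<close>

locale temperley =
  fixes C :: "pt set" and f :: pt
  assumes finC: "finite C" and CW1: "C \<subseteq> W1" and fW1: "f \<in> W1" and fC: "f \<notin> C"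
    and conn_faces: "connected (\<Union>c\<in>C. face_square c)"
    and conn_compl: "connected (- (\<Union>c\<in>C. face_square c))"
    and corner_f: "\<exists>w\<in>VH C. f - w \<in> diag_steps"
begin

abbreviation "V0 \<equiv> VH C"
abbreviation "V1 \<equiv> insert f C"
abbreviation "E \<equiv> mids_H C"

lemma E_iff: "e \<in> E \<longleftrightarrow> (\<exists>t\<in>axis_steps. e + t \<in> C)"
proof
  assume "e \<in> E"
  then obtain c t where ct: "c \<in> C" "t \<in> axis_steps" "e = c + t" by (auto simp: mids_H_def padd_eq_plus)
  then have "e + (- t) \<in> C" "- t \<in> axis_steps" by auto
  then show "\<exists>t\<in>axis_steps. e + t \<in> C" by blast
next
  assume "\<exists>t\<in>axis_steps. e + t \<in> C"
  then obtain t where t: "t \<in> axis_steps" "e + t \<in> C" by blast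
  then show "e \<in> E" unfolding mids_H_def padd_eq_plus
    by (intro UN_I[of "e + t"] image_eqI[of _ _ "- t"]) auto
qed

lemma V0_iff: "x \<in> V0 \<longleftrightarrow> (\<exists>t\<in>diag_steps. x + t \<in> C)"
proof
  assume "x \<in> V0"
  then obtain c t where ct: "c \<in> C" "t \<in> diag_steps" "x = c + t" by (auto simp: VH_def face_corners_def padd_eq_plus)
  then have "x + (- t) \<in> C" "- t \<in> diag_steps" by (auto simp: diag_steps_def)
  then show "\<exists>t\<in>diag_steps. x + t \<in> C" by blast
next
  assume "\<exists>t\<in>diag_steps. x + t \<in> C"
  then obtain t where t: "t \<in> diag_steps" "x + t \<in> C" by blast
  then show "x \<in> V0" unfolding VH_def face_corners_def padd_eq_plus
    by (intro UN_I[of "x + t"] image_eqI[of _ _ "- t"]) (auto simp: diag_steps_def)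
qed

lemma V0_W0: "x \<in> V0 \<Longrightarrow> x \<in> W0"
proof -
  assume "x \<in> V0"
  then obtain t where t: "t \<in> diag_steps" "x + t \<in> W1" using V0_iff CW1 by blast
  then show "x \<in> W0" by (cases x) (auto simp: diag_steps_def W0_def W1_def)
qed

lemma V1_W1: "x \<in> V1 \<Longrightarrow> x \<in> W1"
  using CW1 fW1 by auto

lemma V01_disj: "V0 \<inter> V1 = {}"
  using V0_W0 V1_W1 W0_W1_disjoint by blast

lemma finite_V0 [simp]: "finite V0"
  using finC by (simp add: VH_def face_corners_def diag_steps_def)

lemma finite_V1 [simp]: "finite V1"
  using finC by simp

lemma finite_E [simp]: "finite E"
  using finC by (simp add: mids_H_def)

lemma E_parity: "e \<in> E \<Longrightarrow> odd (fst e + snd e)"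
proof -
  assume "e \<in> E"
  then obtain t where t: "t \<in> axis_steps" "e + t \<in> W1" using E_iff CW1 by blast
  then show ?thesis by (cases e) (auto simp: axis_steps_def W1_def)
qed

lemma E_not: "e \<in> E \<Longrightarrow> e \<notin> W0 \<and> e \<notin> W1"
  using E_parity by (cases e) (auto simp: W0_def W1_def)

lemma E_at_W0:
  assumes "x \<in> W0" "t \<in> axis_steps"
  shows "x + t \<in> E \<longleftrightarrow> x + t + rot t \<in> C \<or> x + t - rot t \<in> C"
proof -
  obtain a b where x: "x = (a, b)" by force
  have ev: "even a" "even b" using assms(1) by (auto simp: W0_def x)
  have C_odd: "even p \<Longrightarrow> (p, q) \<notin> C" "even q \<Longrightarrow> (p, q) \<notin> C" for p q using CW1 by (auto simp: W1_def)
  show ?thesis unfolding E_iff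
    using assms(2) ev by (auto simp: axis_steps_def rot_def x C_odd)
qed

lemma E_at_W1:
  assumes "u \<in> W1" "t \<in> axis_steps"
  shows "u + t \<in> E \<longleftrightarrow> u \<in> C \<or> u + t + t \<in> C"
proof -
  obtain a b where x: "u = (a, b)" by force
  have ev: "odd a" "odd b" using assms(1) by (auto simp: W1_def x)
  have C_odd: "even p \<Longrightarrow> (p, q) \<notin> C" "even q \<Longrightarrow> (p, q) \<notin> C" for p q using CW1 by (auto simp: W1_def)
  show ?thesis unfolding E_iff
    using assms(2) ev by (auto simp: axis_steps_def x C_odd)
qed

lemma E_ends:
  assumes "e \<in> E" "t \<in> axis_steps" "e + t \<in> W0"
  shows "e + t \<in> V0"
proof -
  obtain a b where x: "e = (a, b)" by force
  have C_odd: "even p \<Longrightarrow> (p, q) \<notin> C" "even q \<Longrightarrow> (p, q) \<notin> C" for p q using CW1 by (auto simp: W1_def)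
  show ?thesis
    using assms unfolding E_iff V0_iff
    by (auto simp: axis_steps_def diag_steps_def W0_def x C_odd)
qed

lemma E_next: "x \<in> V0 \<Longrightarrow> t \<in> axis_steps \<Longrightarrow> x + t \<in> E \<Longrightarrow> x + t + t \<in> V0"
  using E_ends W0_axis_two V0_W0 by blast

text \<open>One formula serves both graphs: the neighbours of a midpoint along one axis lie in
  \<open>W0\<close>, those along the other in \<open>W1\<close>. For \<open>K\<close> inside
  \<open>W0\<close> this is a cut of \<open>H\<close>, for \<open>K\<close> inside \<open>W1\<close>
  a cut of the dual.\<close>

definition cut :: "pt set \<Rightarrow> pt set" where
  "cut K = {e \<in> E. \<exists>t\<in>axis_steps. e + t \<in> K \<and> e - t \<notin> K}"

lemma cut_gen:
  assumes "t \<in> axis_steps"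
  shows "e \<in> cut K \<longleftrightarrow> e \<in> E \<and> ((e + t \<in> K) \<noteq> (e - t \<in> K) \<or> (e + rot t \<in> K) \<noteq> (e - rot t \<in> K))"
  using assms by (cases e) (auto simp: cut_def axis_steps_def rot_def)

lemma rot_axis [simp]: "t \<in> axis_steps \<Longrightarrow> rot t \<in> axis_steps"
  by (auto simp: axis_steps_def rot_def)

lemma cut_W0_at_W0:
  assumes "K \<subseteq> W0" "x \<in> W0" "t \<in> axis_steps"
  shows "x + t \<in> cut K \<longleftrightarrow> x + t \<in> E \<and> (x \<in> K) \<noteq> (x + t + t \<in> K)"
proof -
  have "x + t + rot t \<notin> W0" "x + t - rot t \<notin> W0"
    using assms by (cases x; auto simp: axis_steps_def W0_def rot_def)+
  then show ?thesis using assms(1) by (auto simp: cut_gen[OF assms(3)])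
qed

lemma cut_W1_at_W1:
  assumes "K \<subseteq> W1" "x \<in> W1" "t \<in> axis_steps"
  shows "x + t \<in> cut K \<longleftrightarrow> x + t \<in> E \<and> (x \<in> K) \<noteq> (x + t + t \<in> K)"
proof -
  have "x + t + rot t \<notin> W1" "x + t - rot t \<notin> W1"
    using assms by (cases x; auto simp: axis_steps_def W1_def rot_def)+
  then show ?thesis using assms(1) by (auto simp: cut_gen[OF assms(3)])
qed

lemma cut_W1_at_W0:
  assumes "K \<subseteq> W1" "x \<in> W0" "t \<in> axis_steps"
  shows "x + t \<in> cut K \<longleftrightarrow> x + t \<in> E \<and> (x + t + rot t \<in> K) \<noteq> (x + t - rot t \<in> K)"
proof -
  have "x \<notin> W1" "x + t + t \<notin> W1"
    using assms W0_axis_two W0_W1_disjoint by blast+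
  then show ?thesis using assms(1) by (auto simp: cut_gen[OF assms(3)])
qed

lemma cut_W0_at_W1:
  assumes "K \<subseteq> W0" "x \<in> W1" "t \<in> axis_steps"
  shows "x + t \<in> cut K \<longleftrightarrow> x + t \<in> E \<and> (x + t + rot t \<in> K) \<noteq> (x + t - rot t \<in> K)"
proof -
  have "x \<notin> W0" "x + t + t \<notin> W0"
    using assms W1_axis_two W0_W1_disjoint by blast+
  then show ?thesis using assms(1) by (auto simp: cut_gen[OF assms(3)])
qed

text \<open>If \<open>x + t\<close> is not in \<open>E\<close>, both squares beside it lie outside
  \<open>C\<close>, where \<open>K\<close> is constant. So the sign changes around \<open>x\<close>
  are exactly the cut edges at \<open>x\<close>.\<close>

lemma even_cut_at_W0:
  assumes "K \<subseteq> W1" "\<And>u u'. u \<in> W1 - C \<Longrightarrow> u' \<in> W1 - C \<Longrightarrow> u \<in> K \<longleftrightarrow> u' \<in> K" "x \<in> W0"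
  shows "even (card {t \<in> axis_steps. x + t \<in> cut K})"
proof (rule even_sign_changes)
  fix t assume t: "t \<in> axis_steps"
  have "x + t + rot t \<in> W1" "x + t - rot t \<in> W1"
    using assms(3) t by (cases x; auto simp: axis_steps_def W0_def W1_def rot_def)+
  then have "x + t \<in> E \<or> (x + t + rot t \<in> K \<longleftrightarrow> x + t - rot t \<in> K)"
    using assms(2)[of "x + t + rot t" "x + t - rot t"] E_at_W0[OF assms(3) t] by auto
  then show "x + t \<in> cut K \<longleftrightarrow> (x + t + rot t \<in> K) \<noteq> (x + t - rot t \<in> K)"
    using cut_W1_at_W0[OF assms(1,3) t] by auto
qed

lemma even_cut_at_face:
  assumes "K \<subseteq> W0" "u \<in> C"
  shows "even (card {t \<in> axis_steps. u + t \<in> cut K})"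
proof (rule even_sign_changes)
  fix t assume t: "t \<in> axis_steps"
  have "u \<in> W1" using assms CW1 by auto
  then show "u + t \<in> cut K \<longleftrightarrow> (u + t + rot t \<in> K) \<noteq> (u + t - rot t \<in> K)"
    using cut_W0_at_W1[OF assms(1) _ t, of u] E_at_W1[of u t] t assms(2) by auto
qed

text \<open>The handshake lemma for the outer face: since every face in \<open>C\<close> meets a cut in an even
  number of edges, so does the outer boundary.\<close>
lemma even_cut_boundary:
  assumes "K \<subseteq> W0"
  shows "even (card {(u, t). u \<in> C \<and> t \<in> axis_steps \<and> u + t \<in> cut K \<and> u + t + t \<notin> C})"
proof -
  let ?I = "\<lambda>S. {(u, t). u \<in> C \<and> t \<in> S \<and> u + t \<in> cut K \<and> u + t + t \<in> C}"
  let ?B = "{(u, t). u \<in> C \<and> t \<in> axis_steps \<and> u + t \<in> cut K \<and> u + t + t \<notin> C}"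
  have finax: "finite (C \<times> axis_steps)" using finC by simp
  have fin: "finite (?I S)" if "S \<subseteq> axis_steps" for S
    by (rule finite_subset[OF _ finax]) (use that in auto)
  have finB: "finite ?B" by (rule finite_subset[OF _ finax]) auto
  have "even (\<Sum>u\<in>C. card {t \<in> axis_steps. u + t \<in> cut K})"
    using even_cut_at_face[OF assms] by (intro dvd_sum) auto
  also have "(\<Sum>u\<in>C. card {t \<in> axis_steps. u + t \<in> cut K}) = card (SIGMA u:C. {t \<in> axis_steps. u + t \<in> cut K})"
    using finC by (subst card_SigmaI) auto
  also have "(SIGMA u:C. {t \<in> axis_steps. u + t \<in> cut K}) = ?I axis_steps \<union> ?B" by auto
  also have "card \<dots> = card (?I axis_steps) + card ?B"
    using fin[of axis_steps] finB by (subst card_Un_disjoint) auto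
  \<comment> \<open>An interior side is counted from both of its faces; reversing the step pairs
    positive with negative directions.\<close>
  also have "?I axis_steps = ?I {(1,0),(0,1)} \<union> ?I {(-1,0),(0,-1)}"
    by (auto simp: axis_steps_def)
  also have "card \<dots> = card (?I {(1,0),(0,1)}) + card (?I {(-1,0),(0,-1)})"
  proof (rule card_Un_disjoint)
    show "finite (?I {(1,0),(0,1)})" "finite (?I {(-1,0),(0,-1)})"
      by (rule fin; auto simp: axis_steps_def)+
  qed auto
  also have "card (?I {(-1,0),(0,-1)}) = card (?I {(1,0),(0,1)})"
  proof (rule bij_betw_same_card[where f = "\<lambda>(u, t). (u + t + t, - t)"])
    show "bij_betw (\<lambda>(u, t). (u + t + t, - t)) (?I {(-1,0),(0,-1)}) (?I {(1,0),(0,1)})"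
      by (rule bij_betw_byWitness[where f' = "\<lambda>(u, t). (u + t + t, - t)"]) (auto simp: add.commute)
  qed
  finally show ?thesis by simp
qed

section \<open>Flows on both graphs and cuts inside forests\<close>

definition ct :: "pt \<Rightarrow> pt" where
  "ct y = (if y \<in> C then y else f)"

text \<open>A choice of directions induces a flow on \<open>\<Lambda>\<close> and one on the dual of \<open>H\<close>; in the latter, leaving
  \<open>C\<close> in any way means arriving in the outer face, represented by \<open>f\<close>.\<close>
definition nx0 :: "(pt \<Rightarrow> pt) \<Rightarrow> pt \<Rightarrow> pt" where
  "nx0 s x = x + s x + s x"

definition nx1 :: "(pt \<Rightarrow> pt) \<Rightarrow> pt \<Rightarrow> pt" where
  "nx1 s u = ct (u + s u + s u)"

lemma ct_V1: "ct y \<in> V1"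
  by (simp add: ct_def)

lemma ct_id [simp]: "y \<in> V1 \<Longrightarrow> ct y = y"
  by (auto simp: ct_def)

lemma nx1_V1: "nx1 s u \<in> V1"
  unfolding nx1_def by (rule ct_V1)

text \<open>An edge of a forest at a vertex of maximal distance from the root is a leaf edge, so a forest
  contains no nonempty even set of edges.\<close>
lemma no_cut_in_primal_forest:
  assumes K: "K \<subseteq> W1" "\<And>u u'. u \<in> W1 - C \<Longrightarrow> u' \<in> W1 - C \<Longrightarrow> u \<in> K \<longleftrightarrow> u' \<in> K"
    and s: "\<And>e. e \<in> cut K \<Longrightarrow> \<exists>x\<in>V0 - {w}. s x \<in> axis_steps \<and> e = x + s x"
    and x: "x \<in> V0" "reaches (nx0 s) w x" and t: "t \<in> axis_steps"
  shows "x + t \<notin> cut K"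
proof
  assume xt: "x + t \<in> cut K"
  define A where "A = {x \<in> V0. reaches (nx0 s) w x \<and> (\<exists>t\<in>axis_steps. x + t \<in> cut K)}"
  have "finite A" "x \<in> A" using x t xt by (auto simp: A_def)
  then obtain z where z: "z \<in> A" "\<And>y. y \<in> A \<Longrightarrow> hit_time (nx0 s) w y \<le> hit_time (nx0 s) w z"
    using finite_max_nat by metis
  \<comment> \<open>A cut edge at \<open>z\<close> not chosen by \<open>z\<close> would be chosen by
    its other end \<open>y\<close>, which is one step further from the root, against the maximality
    of \<open>z\<close>.\<close>
  have out: "s z = t'" if t': "t' \<in> axis_steps" "z + t' \<in> cut K" for t'
  proof -
    obtain y where y: "y \<in> V0 - {w}" "s y \<in> axis_steps" "z + t' = y + s y" using s[OF t'(2)] by blast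
    have "z \<in> W0" "y \<in> W0" using z(1) y(1) V0_W0 by (auto simp: A_def)
    then have "y = z \<or> y = z + t' + t'"
      using y(2,3) t'(1) by (cases y; cases z; cases "s y") (auto simp: axis_steps_def W0_def)
    then show ?thesis
    proof
      assume "y = z + t' + t'"
      then have "s y = - t'" using y(3) by (simp add: algebra_simps add_eq_0_iff)
      then have "nx0 s y = z" using \<open>y = z + t' + t'\<close> by (simp add: nx0_def)
      then have "reaches (nx0 s) w y" "hit_time (nx0 s) w y = Suc (hit_time (nx0 s) w z)"
        using y(1) z(1) reaches_step[of y w "nx0 s"] hit_time_step[of y w "nx0 s"]
        by (auto simp: A_def)
      moreover have "y + s y \<in> cut K" using y(3) t'(2) by simp
      ultimately show ?thesis using z(2)[of y] y by (auto simp: A_def)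
    qed (use y in simp)
  qed
  obtain t1 where t1: "t1 \<in> axis_steps" "z + t1 \<in> cut K" using z(1) by (auto simp: A_def)
  have "even (card {t \<in> axis_steps. z + t \<in> cut K})"
    using z(1) V0_W0 by (intro even_cut_at_W0 K) (auto simp: A_def)
  then obtain t2 where "t2 \<in> axis_steps" "z + t2 \<in> cut K" "t2 \<noteq> t1"
    using t1 by (rule even_card_other)
  with out t1 show False by metis
qed

text \<open>The argument for \<open>H\<close> carries over except at \<open>f\<close>, which stands
  for all outer squares; there \<open>even_cut_boundary\<close> supplies the parity. Accordingly
  \<open>y\<close> ranges over all of \<open>W1\<close>, and \<open>ct y\<close> is what flows to
  \<open>v\<close>.\<close>

lemma no_cut_in_dual_forest:
  assumes K: "K \<subseteq> W0"
    and s: "\<And>e. e \<in> cut K \<Longrightarrow> \<exists>u\<in>V1 - {v}. s u \<in> axis_steps \<and> e = u + s u"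
    and y: "y \<in> W1" "reaches (nx1 s) v (ct y)" and t: "t \<in> axis_steps"
  shows "y + t \<notin> cut K"
proof
  assume yt: "y + t \<in> cut K"
  define A where "A = {u \<in> V1. reaches (nx1 s) v u \<and> (\<exists>t\<in>axis_steps. \<exists>y\<in>W1. ct y = u \<and> y + t \<in> cut K)}"
  have "finite A" unfolding A_def by (rule finite_subset[OF _ finite_V1]) auto
  moreover have "ct y \<in> A" using y t yt ct_V1 by (auto simp: A_def)
  ultimately obtain z where z: "z \<in> A" "\<And>y. y \<in> A \<Longrightarrow> hit_time (nx1 s) v y \<le> hit_time (nx1 s) v z"
    using finite_max_nat by metis
  have later: False if "u \<in> V1 - {v}" "nx1 s u = z" "s u \<in> axis_steps" "u + s u \<in> cut K" for u
  proof -
    have "reaches (nx1 s) v u" "hit_time (nx1 s) v u = Suc (hit_time (nx1 s) v z)"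
      using that z(1) reaches_step[of u v "nx1 s"] hit_time_step[of u v "nx1 s"]
      by (auto simp: A_def)
    moreover have "u \<in> W1" "ct u = u" using that(1) V1_W1 by auto
    ultimately have "u \<in> A" using that unfolding A_def by blast
    with \<open>hit_time (nx1 s) v u = _\<close> show False using z(2)[of u] by simp
  qed
  have out: "y = u \<and> t' = s u \<or> (u = y + t' + t' \<and> s u = - t')"
    if "y + t' = u + s u" "s u \<in> axis_steps" "t' \<in> axis_steps" "y \<in> W1" "u \<in> W1" for y t' u
    using that by (cases y; cases u; cases "s u") (auto simp: axis_steps_def W1_def)
  show False
  proof (cases "z \<in> C")
    case True
    have zW: "z \<in> W1" using True CW1 by auto
    have "s z = t'" if t': "t' \<in> axis_steps" "z + t' \<in> cut K" for t'
    proof -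
      obtain u where u: "u \<in> V1 - {v}" "s u \<in> axis_steps" "z + t' = u + s u" using s[OF t'(2)] by blast
      have "u \<in> W1" using u(1) V1_W1 by auto
      from out[OF u(3,2) t'(1) zW this] show ?thesis
      proof
        assume a: "u = z + t' + t' \<and> s u = - t'"
        have "u + s u + s u = z" unfolding conjunct2[OF a] using conjunct1[OF a] by simp
        then have "nx1 s u = z" using True by (simp add: nx1_def)
        moreover have "u + s u \<in> cut K" using u(3) t'(2) by simp
        ultimately show ?thesis using later[OF u(1) _ u(2)] by blast
      qed auto
    qed
    moreover obtain t1 where t1: "t1 \<in> axis_steps" "z + t1 \<in> cut K"
      using z(1) True fC by (auto simp: A_def ct_def split: if_splits)
    ultimately show False
      using even_card_other[OF even_cut_at_face[OF K True] t1] by metis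
  next
    case False
    then have zf: "z = f" using z(1) by (auto simp: A_def)
    \<comment> \<open>A boundary cut edge chosen from inside \<open>C\<close> would belong to a
      vertex further from the root than \<open>f\<close>. It is therefore the single edge by which
      \<open>f\<close> leaves, and \<open>?B\<close> has exactly one element, contradicting
      evenness.\<close>
    have key: "u + t' = f + s f \<and> f \<noteq> v \<and> u + t' + t' = f \<and> s f \<in> axis_steps"
      if u: "u \<in> C" "t' \<in> axis_steps" "u + t' \<in> cut K" "u + t' + t' \<notin> C" for u t'
    proof -
      obtain u' where u': "u' \<in> V1 - {v}" "s u' \<in> axis_steps" "u + t' = u' + s u'" using s[OF u(3)] by blast
      have W: "u \<in> W1" "u' \<in> W1" using u'(1) u(1) V1_W1 by auto
      from out[OF u'(3,2) u(2) W] show ?thesis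
      proof
        assume a: "u = u' \<and> t' = s u'"
        then have "nx1 s u' = z" using u(4) zf by (simp add: nx1_def ct_def)
        moreover have "u' + s u' \<in> cut K" using u'(3) u(3) by simp
        ultimately show ?thesis using later[OF u'(1) _ u'(2)] by blast
      next
        assume a: "u' = u + t' + t' \<and> s u' = - t'"
        then have *: "u' = f" using u(4) u'(1) by auto
        show ?thesis using conjunct1[OF a] u' unfolding * by simp
      qed
    qed
    let ?B = "{(u, t). u \<in> C \<and> t \<in> axis_steps \<and> u + t \<in> cut K \<and> u + t + t \<notin> C}"
    obtain t1 y1 where t1: "t1 \<in> axis_steps" "y1 \<in> W1" "ct y1 = f" "y1 + t1 \<in> cut K"
      using z(1) zf by (auto simp: A_def)
    have y1: "y1 \<notin> C" using t1(3) fC by (auto simp: ct_def split: if_splits)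
    have "y1 + t1 \<in> E" using t1(4) by (simp add: cut_def)
    then have "y1 + t1 + t1 \<in> C" using E_at_W1[OF t1(2,1)] y1 by auto
    then have mem: "(y1 + t1 + t1, - t1) \<in> ?B" using t1 y1 by auto
    have "p = q" if "p \<in> ?B" "q \<in> ?B" for p q
    proof -
      obtain u1 s1 where p: "p = (u1, s1)" by (rule prod.exhaust)
      obtain u2 s2 where q: "q = (u2, s2)" by (rule prod.exhaust)
      have m: "u1 \<in> C \<and> s1 \<in> axis_steps \<and> u1 + s1 \<in> cut K \<and> u1 + s1 + s1 \<notin> C"
        "u2 \<in> C \<and> s2 \<in> axis_steps \<and> u2 + s2 \<in> cut K \<and> u2 + s2 + s2 \<notin> C"
        using that unfolding p q by blast+
      have e: "u1 + s1 = f + s f" "u1 + s1 + s1 = f" "u2 + s2 = f + s f" "u2 + s2 + s2 = f"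
        using key[of u1 s1] key[of u2 s2] m by blast+
      have "f + s f + s1 = f" "f + s f + s2 = f" using e(2,4) unfolding e(1,3) .
      then have "f + s f + s1 = f + s f + s2" by (rule trans[OF _ sym])
      then have "s1 = s2" by (rule add_left_imp_eq)
      then have "u1 = u2" using e(1,3) by (metis add_right_imp_eq)
      with \<open>s1 = s2\<close> show ?thesis using p q by simp
    qed
    then have "?B = {(y1 + t1 + t1, - t1)}" using mem by blast
    then show False using even_cut_boundary[OF K] by simp
  qed
qed

section \<open>Flows of a dimer covering\<close>

text \<open>The sides of a face link its four corners, and the faces are linked by common
  corners.\<close>

lemma H_connected:
  assumes X: "X \<subseteq> V0" "x0 \<in> X" and step: "\<And>x t. x \<in> X \<Longrightarrow> t \<in> axis_steps \<Longrightarrow> x + t \<in> E \<Longrightarrow> x + t + t \<in> X"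
  shows "X = V0"
proof -
  define D where "D = {c \<in> C. \<exists>t\<in>diag_steps. c + t \<in> X}"
  have all: "c + t' \<in> X" if c: "c \<in> C" "t \<in> diag_steps" "c + t \<in> X" "t' \<in> diag_steps" for c t t'
  proof -
    obtain a b where ab: "c = (a, b)" by force
    have W: "(a, b) \<in> W1" using c(1) CW1 ab by auto
    have E: "(a + 1, b) \<in> E" "(a - 1, b) \<in> E" "(a, b + 1) \<in> E" "(a, b - 1) \<in> E"
      using E_at_W1[OF W, of "(1,0)"] E_at_W1[OF W, of "(-1,0)"] E_at_W1[OF W, of "(0,1)"]
        E_at_W1[OF W, of "(0,-1)"] c(1) ab by (auto simp: axis_steps_def)
    have "(a + 1, b + 1) \<in> X \<longleftrightarrow> (a - 1, b + 1) \<in> X"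
      using E step[of "(a + 1, b + 1)" "(-1,0)"] step[of "(a - 1, b + 1)" "(1,0)"] by (auto simp: axis_steps_def)
    moreover have "(a + 1, b - 1) \<in> X \<longleftrightarrow> (a - 1, b - 1) \<in> X"
      using E step[of "(a + 1, b - 1)" "(-1,0)"] step[of "(a - 1, b - 1)" "(1,0)"] by (auto simp: axis_steps_def)
    moreover have "(a + 1, b + 1) \<in> X \<longleftrightarrow> (a + 1, b - 1) \<in> X"
      using E step[of "(a + 1, b + 1)" "(0,-1)"] step[of "(a + 1, b - 1)" "(0,1)"] by (auto simp: axis_steps_def)
    ultimately show ?thesis using c by (auto simp: diag_steps_def ab)
  qed
  obtain t0 where t0: "t0 \<in> diag_steps" "x0 + t0 \<in> C" using X V0_iff by blast
  have "(x0 + t0) + (- t0) \<in> X" "- t0 \<in> diag_steps" using t0 X by (auto simp: diag_steps_def)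
  then have a: "x0 + t0 \<in> D" using t0 unfolding D_def by blast
  have "D = C"
  proof (rule corner_connected[OF finC CW1 conn_faces _ _ a])
    show "D \<subseteq> C" by (auto simp: D_def)
    fix c c' assume c: "c \<in> D" "c' \<in> C" "face_corners c \<inter> face_corners c' \<noteq> {}"
    then obtain t t' where t: "t \<in> diag_steps" "t' \<in> diag_steps" "c + t = c' + t'"
      unfolding face_corners_def padd_eq_plus by (metis (no_types, lifting) disjoint_iff imageE)
    have "c + t \<in> X" using c(1) t(1) all unfolding D_def by blast
    then have "c' + t' \<in> X" using t(3) by simp
    then show "c' \<in> D" using t(2) c(2) unfolding D_def by blast
  qed
  have "V0 \<subseteq> X"
  proof
    fix x assume "x \<in> V0"
    then obtain c t where "c \<in> C" "t \<in> diag_steps" "x = c + t"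
      unfolding VH_def face_corners_def padd_eq_plus by blast
    then show "x \<in> X" using all \<open>D = C\<close> unfolding D_def by blast
  qed
  then show ?thesis using X(1) by blast
qed

text \<open>\<open>Cov v w\<close> encodes the perfect matchings of \<open>G - {v, w}\<close> by the direction in which every white
  vertex is matched; \<open>trees v\<close> encodes the spanning trees of \<open>H\<^sup>\<bottom>\<close> oriented towards \<open>v\<close>
  in which \<open>f\<close> is left, if at all, through an edge of \<open>\<Lambda>\<^sup>\<bottom>\<close>.\<close>

definition Cov :: "pt \<Rightarrow> pt \<Rightarrow> (pt \<Rightarrow> pt) set" where
  "Cov v w = {s \<in> Pi\<^sub>E (V0 \<union> V1 - {v, w}) (\<lambda>_. axis_steps).
      bij_betw (\<lambda>x. x + s x) (V0 \<union> V1 - {v, w}) E}"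

definition trees :: "pt \<Rightarrow> (pt \<Rightarrow> pt) set" where
  "trees v = {d \<in> Pi\<^sub>E (V1 - {v}) (\<lambda>_. axis_steps). \<forall>u\<in>V1. reaches (nx1 d) v u}"

lemma Cov_D:
  assumes "s \<in> Cov v w" "x \<in> V0 \<union> V1" "x \<noteq> v" "x \<noteq> w"
  shows "s x \<in> axis_steps" "x + s x \<in> E"
proof -
  have "x \<in> V0 \<union> V1 - {v, w}" using assms by auto
  then show "s x \<in> axis_steps" "x + s x \<in> E" using assms(1)
    unfolding Cov_def bij_betw_def by blast+
qed

lemma Cov_surj:
  assumes "s \<in> Cov v w" "e \<in> E"
  obtains x where "x \<in> V0 \<union> V1" "x \<noteq> v" "x \<noteq> w" "e = x + s x" "s x \<in> axis_steps"
proof -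
  have "e \<in> (\<lambda>x. x + s x) ` (V0 \<union> V1 - {v, w})" using assms by (auto simp: Cov_def bij_betw_def)
  then obtain x where "x \<in> V0 \<union> V1 - {v, w}" "e = x + s x" by blast
  then show ?thesis using that Cov_D(1)[OF assms(1)] by blast
qed

lemma Cov_inj:
  assumes "s \<in> Cov v w" "x \<in> V0 \<union> V1 - {v, w}" "y \<in> V0 \<union> V1 - {v, w}" "x + s x = y + s y"
  shows "x = y"
  using assms by (auto simp: Cov_def bij_betw_def dest: inj_onD)

lemma Cov_flows:
  assumes s: "s \<in> Cov v w" and v: "v \<in> V1" and w: "w \<in> V0" and vw: "v - w \<in> diag_steps"
  shows "(\<forall>x\<in>V0. reaches (nx0 s) w x) \<and> (\<forall>u\<in>V1. reaches (nx1 s) v u)"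
proof -
  define K0 where "K0 = {x \<in> V0. reaches (nx0 s) w x}"
  define K1 where "K1 = {u \<in> W1. reaches (nx1 s) v (ct u)}"
  have K0W: "K0 \<subseteq> W0" using V0_W0 by (auto simp: K0_def)
  have K1W: "K1 \<subseteq> W1" by (auto simp: K1_def)
  have K1out: "u \<in> K1 \<longleftrightarrow> u' \<in> K1" if "u \<in> W1 - C" "u' \<in> W1 - C" for u u'
    using that by (auto simp: K1_def ct_def)
  \<comment> \<open>An edge matched to a vertex \<open>x\<close> of \<open>H\<close> is not cut by
    \<open>K0\<close>, as \<open>x\<close> and its successor flow to \<open>w\<close> together or
    not at all. So a cut edge is matched to a dual vertex; \<open>cut1\<close> exchanges the
    roles.\<close>
  have cut0: "\<exists>u\<in>V1 - {v}. s u \<in> axis_steps \<and> e = u + s u" if e: "e \<in> cut K0" for e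
  proof -
    have "e \<in> E" using e by (simp add: cut_def)
    from Cov_surj[OF s this] obtain x where x: "x \<in> V0 \<union> V1" "x \<noteq> v" "x \<noteq> w" "e = x + s x" "s x \<in> axis_steps" .
    have "x \<notin> V0"
    proof
      assume x0: "x \<in> V0"
      have "x + s x + s x \<in> V0" using E_next[OF x0 x(5)] x(4) \<open>e \<in> E\<close> by simp
      then have "x \<in> K0 \<longleftrightarrow> x + s x + s x \<in> K0"
        using x0 x(3) reaches_step[of x w "nx0 s"] by (auto simp: K0_def nx0_def)
      then show False using e cut_W0_at_W0[OF K0W V0_W0[OF x0] x(5)] x(4) by simp
    qed
    then show ?thesis using x by auto
  qed
  have cut1: "\<exists>x\<in>V0 - {w}. s x \<in> axis_steps \<and> e = x + s x" if e: "e \<in> cut K1" for e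
  proof -
    have "e \<in> E" using e by (simp add: cut_def)
    from Cov_surj[OF s this] obtain x where x: "x \<in> V0 \<union> V1" "x \<noteq> v" "x \<noteq> w" "e = x + s x" "s x \<in> axis_steps" .
    have "x \<notin> V1"
    proof
      assume x1: "x \<in> V1"
      have xW: "x \<in> W1" using x1 V1_W1 by auto
      have "x \<in> K1 \<longleftrightarrow> x + s x + s x \<in> K1"
        using x1 x(2) xW W1_axis_two[OF x(5), of x] reaches_step[of x v "nx1 s"] by (auto simp: K1_def nx1_def)
      then show False using e cut_W1_at_W1[OF K1W xW x(5)] x(4) by simp
    qed
    then show ?thesis using x by auto
  qed
  have no0: "y + t \<notin> cut K0" if "y \<in> K1" "t \<in> axis_steps" for y t
    using no_cut_in_dual_forest[OF K0W cut0, of y t] that by (auto simp: K1_def)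
  have no1: "x + t \<notin> cut K1" if "x \<in> K0" "t \<in> axis_steps" for x t
    using no_cut_in_primal_forest[OF K1W K1out cut1, of x t] that by (auto simp: K0_def)
  text \<open>Hence an incident pair in \<open>K0 \<times> K1\<close> propagates to all its incident neighbours.\<close>
  have turn: "x + t + rot t \<in> K1 \<longleftrightarrow> x + t - rot t \<in> K1" if x: "x \<in> K0" and t: "t \<in> axis_steps" for x t
  proof -
    have xW: "x \<in> W0" using x K0W by auto
    have "x + t + rot t \<in> W1" "x + t - rot t \<in> W1"
      using xW t by (cases x; auto simp: axis_steps_def W0_def W1_def rot_def)+
    then have "x + t \<in> E \<or> (x + t + rot t \<in> K1 \<longleftrightarrow> x + t - rot t \<in> K1)"
      using K1out[of "x + t + rot t" "x + t - rot t"] E_at_W0[OF xW t] by auto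
    then show ?thesis using no1[OF x t] cut_W1_at_W0[OF K1W xW t] by auto
  qed
  \<comment> \<open>Asking for all four squares around a vertex lets a step along \<open>H\<close>
    keep a square common to both ends. One incident pair suffices to enter \<open>X\<close>; the
    first is the impurity.\<close>
  define X where "X = {x \<in> K0. \<forall>t\<in>diag_steps. x + t \<in> K1}"
  have all: "x \<in> X" if x: "x \<in> K0" and t: "t \<in> diag_steps" "x + t \<in> K1" for x t
  proof -
    obtain a b where ab: "x = (a, b)" by force
    have "(a + 1, b + 1) \<in> K1 \<longleftrightarrow> (a + 1, b - 1) \<in> K1" "(a - 1, b + 1) \<in> K1 \<longleftrightarrow> (a - 1, b - 1) \<in> K1"
      "(a + 1, b + 1) \<in> K1 \<longleftrightarrow> (a - 1, b + 1) \<in> K1"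
      using turn[OF x, of "(1,0)"] turn[OF x, of "(-1,0)"] turn[OF x, of "(0,1)"]
      by (auto simp: axis_steps_def rot_def ab)
    then show ?thesis using t x by (auto simp: X_def diag_steps_def ab)
  qed
  have "w \<in> K0" "v \<in> K1" using v w V1_W1 by (auto simp: K0_def K1_def)
  moreover have "v = w + (v - w)" by simp
  ultimately have wX: "w \<in> X" using all[of w "v - w"] vw by simp
  have "X = V0"
  proof (rule H_connected[OF _ wX])
    show "X \<subseteq> V0" by (auto simp: X_def K0_def)
    fix x t assume x: "x \<in> X" and t: "t \<in> axis_steps" and xt: "x + t \<in> E"
    have x0: "x \<in> K0" "x \<in> W0" "x \<in> V0" using x K0W by (auto simp: X_def K0_def)
    obtain t1 where t1: "t1 \<in> diag_steps" "t1 = t + rot t"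
      using t by (auto simp: axis_steps_def diag_steps_def rot_def)
    have y: "x + t + rot t \<in> K1" using x t1 unfolding X_def
      by (metis (no_types, lifting) add.assoc mem_Collect_eq)
    have "(x + t + rot t) + (- rot t) \<notin> cut K0"
      using no0[OF y, of "- rot t"] t by simp
    then have "x + t \<notin> cut K0" by simp
    then have "x + t + t \<in> K0"
      using cut_W0_at_W0[OF K0W x0(2) t] xt x0(1) by auto
    moreover have "- t + rot t \<in> diag_steps" using t by (auto simp: axis_steps_def diag_steps_def rot_def)
    moreover have "x + t + t + (- t + rot t) = x + t + rot t" by simp
    ultimately show "x + t + t \<in> X" using all y by metis
  qed
  moreover have "V1 \<subseteq> K1"
  proof
    fix u assume "u \<in> V1"
    then obtain x t where xt: "x \<in> V0" "t \<in> diag_steps" "u = x + t"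
    proof
      assume "u = f"
      then show ?thesis using corner_f that by (metis add.commute diff_add_cancel)
    next
      assume "u \<in> C"
      then have "u + (1,1) \<in> V0" unfolding V0_iff
        by (cases u, intro bexI[of _ "(-1,-1)"]) (auto simp: diag_steps_def)
      then show ?thesis using that[of "u + (1,1)" "(-1,-1)"] by (cases u) (auto simp: diag_steps_def)
    qed
    then show "u \<in> K1" using \<open>X = V0\<close> by (auto simp: X_def)
  qed
  ultimately show ?thesis by (auto simp: X_def K0_def K1_def)
qed

end

section \<open>Spanning trees of the dual\<close>

lemma reaches_cong_on:
  assumes "reaches g r x" "x \<in> X" "\<And>y. y \<in> X \<Longrightarrow> y \<noteq> r \<Longrightarrow> g y \<in> X \<and> g y = h y"
  shows "reaches h r x"
  using assms(1,2)
proof (induction rule: reaches_induct)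
  case (step x) then show ?case using assms(3) reaches_step by metis
qed simp

text \<open>If \<open>s\<close> and \<open>t\<close> were neither equal nor opposite,
  \<open>x\<close> and \<open>y\<close> would differ by a diagonal step, which exchanges the two
  sublattices.\<close>

lemma same_edge:
  assumes "x + s = y + (t :: pt)" "s \<in> axis_steps" "t \<in> axis_steps" "x \<in> W0 \<and> y \<in> W0 \<or> x \<in> W1 \<and> y \<in> W1"
  shows "x = y \<and> s = t \<or> y = x + s + s \<and> t = - s \<and> x = y + t + t"
proof -
  have y: "y = x + (s - t)" using assms(1) by (metis add_diff_cancel_right' add_diff_eq)
  have "s - t \<notin> diag_steps" using W0_diag[of "s - t" x] assms(4) W0_W1_disjoint unfolding y by blast
  then have "s = t \<or> t = - s" using assms(2,3) by (auto simp: axis_steps_def diag_steps_def)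
  then show ?thesis
  proof
    assume "t = - s"
    then show ?thesis using y by simp
  qed (use y in simp)
qed

lemma odd_card_sym_diff:
  assumes "finite A" "finite B"
  shows "odd (card (sym_diff A B)) \<longleftrightarrow> odd (card A) \<noteq> odd (card B)"
proof -
  have "card A = card (A - B) + card (A \<inter> B)" "card B = card (B - A) + card (A \<inter> B)"
    using assms by (metis Int_commute card_Diff_subset_Int card_mono finite_Int inf_le1 le_add_diff_inverse2)+
  moreover have "card (sym_diff A B) = card (A - B) + card (B - A)"
    using assms by (intro card_Un_disjoint) auto
  ultimately show ?thesis by auto
qed

lemma card_Collect_Suc:
  assumes "finite {k::nat. P k}"
  shows "card {k. P k} = of_bool (P 0) + card {k. P (Suc k)}"
proof -
  have eq: "{k. P k} = (if P 0 then {0} else {}) \<union> Suc ` {k. P (Suc k)}"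
  proof (rule set_eqI)
    show "n \<in> {k. P k} \<longleftrightarrow> n \<in> (if P 0 then {0} else {}) \<union> Suc ` {k. P (Suc k)}" for n
      by (cases n) auto
  qed
  have "finite (Suc ` {k. P (Suc k)})" by (rule finite_subset[OF _ assms]) auto
  then have "card {k. P k} = card (if P 0 then {0::nat} else {}) + card (Suc ` {k. P (Suc k)})"
    by (subst eq, subst card_Un_disjoint) auto
  then show ?thesis by (simp add: card_image)
qed

lemma far_face:
  assumes "finite S"
  shows "\<exists>u\<in>W1. \<forall>e\<in>S. fst e < fst u"
proof -
  have "finite (fst ` S)" using assms by simp
  then obtain M where M: "\<And>a. a \<in> fst ` S \<Longrightarrow> a \<le> M" by (meson bdd_above_finite bdd_above.E)
  have lt: "fst e < fst (2 * \<bar>M\<bar> + 1, 1 :: int)" if "e \<in> S" for e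
  proof -
    have "fst e \<le> M" using M that by blast
    then show ?thesis by simp
  qed
  moreover have "(2 * \<bar>M\<bar> + 1, 1) \<in> W1" by (simp add: W1_def)
  ultimately show ?thesis by blast
qed

text \<open>A set of edges with even degrees bounds a set of faces: those from which the
  horizontal ray to the right crosses it an odd number of times. No face outside \<open>C\<close> is enclosed,
  because these faces are connected to one another without crossing the given edges.\<close>
lemma even_edges_bound:
  assumes finC: "finite C" and conn: "edge_connected (W1 - C)" and fin\<Gamma>: "finite \<Gamma>"
    and \<Gamma>: "\<And>u t. u \<in> W1 - C \<Longrightarrow> t \<in> axis_steps \<Longrightarrow> u + t + t \<in> W1 - C \<Longrightarrow> u + t \<notin> \<Gamma>"
    and ev: "\<And>z. z \<in> W0 \<Longrightarrow> even (card {t \<in> axis_steps. z + t \<in> \<Gamma>})"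
  shows "\<exists>X\<subseteq>C. \<forall>u\<in>W1. \<forall>t\<in>axis_steps. u + t \<in> \<Gamma> \<longleftrightarrow> (u \<in> X) \<noteq> (u + t + t \<in> X)"
proof -
  define ray where "ray u = {k::nat. u + (2 * int k + 1, 0) \<in> \<Gamma>}" for u :: pt
  define X where "X = {u \<in> W1. odd (card (ray u))}"
  have finray: "finite (ray u)" for u
  proof (rule finite_imageD)
    show "finite ((\<lambda>k. u + (2 * int k + 1, 0)) ` ray u)"
      by (rule finite_subset[OF _ fin\<Gamma>]) (auto simp: ray_def)
    show "inj_on (\<lambda>k. u + (2 * int k + 1, 0)) (ray u)" by (auto simp: inj_on_def)
  qed
  obtain p where p: "p \<in> W1" "\<And>e. e \<in> \<Gamma> \<union> C \<Longrightarrow> fst e < fst p"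
    using far_face[of "\<Gamma> \<union> C"] finC fin\<Gamma> by blast
  have pC: "p \<in> W1 - C" using p(1) p(2)[of p] by blast
  have far: "ray u = {}" if "fst p \<le> fst u" for u
  proof -
    have "u + (2 * int k + 1, 0) \<notin> \<Gamma>" for k
      using p(2)[of "u + (2 * int k + 1, 0)"] that by (cases u) auto
    then show ?thesis by (simp add: ray_def)
  qed
  have hor: "u + (1,0) \<in> \<Gamma> \<longleftrightarrow> (odd (card (ray u))) \<noteq> (odd (card (ray (u + (2,0)))))" for u
  proof -
    have "card (ray u) = of_bool (u + (2 * int 0 + 1, 0) \<in> \<Gamma>) + card {k. u + (2 * int (Suc k) + 1, 0) \<in> \<Gamma>}"
      unfolding ray_def by (rule card_Collect_Suc) (use finray[of u] in \<open>simp add: ray_def\<close>)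
    moreover have "{k. u + (2 * int (Suc k) + 1, 0) \<in> \<Gamma>} = ray (u + (2,0))"
      by (cases u) (simp add: ray_def algebra_simps)
    ultimately show ?thesis by auto
  qed
  \<comment> \<open>Induction starts at the far right, where all rays are empty. Even degree at
    \<open>(a + 1, b + 1)\<close> passes the claim from \<open>u + (2,0)\<close> to
    \<open>u\<close>, the two horizontal edges being accounted for by \<open>hor\<close>.\<close>
  have ver: "u + (0,1) \<in> \<Gamma> \<longleftrightarrow> (odd (card (ray u))) \<noteq> (odd (card (ray (u + (0,2)))))" if "u \<in> W1" for u
    using that
  proof (induction "nat (fst p - fst u)" arbitrary: u rule: less_induct)
    case less
    show ?case
    proof (cases "fst p \<le> fst u")
      case True
      then have "u + (0,1) \<notin> \<Gamma>" using p(2)[of "u + (0,1)"] by (cases u) auto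
      then show ?thesis using True far[of u] far[of "u + (0,2)"] by (cases u) simp
    next
      case False
      obtain a b where u: "u = (a, b)" by force
      have odd: "odd a" "odd b" using less.prems u by (auto simp: W1_def)
      have IH: "(a + 2, b + 1) \<in> \<Gamma> \<longleftrightarrow> (odd (card (ray (a + 2, b)))) \<noteq> (odd (card (ray (a + 2, b + 2))))"
        using less.hyps[of "(a + 2, b)"] False odd by (simp add: u W1_def)
      have h1: "(a + 1, b) \<in> \<Gamma> \<longleftrightarrow> (odd (card (ray (a, b)))) \<noteq> (odd (card (ray (a + 2, b))))"
        using hor[of "(a, b)"] by simp
      have h2: "(a + 1, b + 2) \<in> \<Gamma> \<longleftrightarrow> (odd (card (ray (a, b + 2)))) \<noteq> (odd (card (ray (a + 2, b + 2))))"
        using hor[of "(a, b + 2)"] by simp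
      have "(a + 1, b + 1) \<in> W0" using odd by (simp add: W0_def)
      from ev[OF this] have "even (of_bool ((a + 2, b + 1) \<in> \<Gamma>) + of_bool ((a, b + 1) \<in> \<Gamma>)
          + of_bool ((a + 1, b + 2) \<in> \<Gamma>) + of_bool ((a + 1, b) \<in> \<Gamma>) :: nat)"
        unfolding card_axis_eq by (simp add: algebra_simps)
      then have "(a, b + 1) \<in> \<Gamma> \<longleftrightarrow> (((a + 2, b + 1) \<in> \<Gamma>) \<noteq> ((a + 1, b + 2) \<in> \<Gamma>)) \<noteq> ((a + 1, b) \<in> \<Gamma>)"
        by (auto split: if_splits simp: of_bool_def)
      then have "(a, b + 1) \<in> \<Gamma> \<longleftrightarrow> odd (card (ray (a, b))) \<noteq> odd (card (ray (a, b + 2)))"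
        unfolding IH h1 h2 by blast
      then show ?thesis unfolding u by simp
    qed
  qed
  have bd: "u + t \<in> \<Gamma> \<longleftrightarrow> (u \<in> X) \<noteq> (u + t + t \<in> X)" if "u \<in> W1" "t \<in> axis_steps" for u t
  proof -
    obtain a b where u: "u = (a, b)" by force
    have odd: "odd a" "odd b" using that u by (auto simp: W1_def)
    have "(a + 1, b) \<in> \<Gamma> \<longleftrightarrow> (u \<in> X) \<noteq> ((a + 2, b) \<in> X)"
      using hor[of "(a, b)"] odd by (simp add: X_def W1_def u)
    moreover have "(a - 1, b) \<in> \<Gamma> \<longleftrightarrow> (u \<in> X) \<noteq> ((a - 2, b) \<in> X)"
      using hor[of "(a - 2, b)"] odd by (auto simp: X_def W1_def u)
    moreover have "(a, b + 1) \<in> \<Gamma> \<longleftrightarrow> (u \<in> X) \<noteq> ((a, b + 2) \<in> X)"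
      using ver[of "(a, b)"] odd by (simp add: X_def W1_def u)
    moreover have "(a, b - 1) \<in> \<Gamma> \<longleftrightarrow> (u \<in> X) \<noteq> ((a, b - 2) \<in> X)"
      using ver[of "(a, b - 2)"] odd by (auto simp: X_def W1_def u)
    moreover have "t = (1,0) \<or> t = (-1,0) \<or> t = (0,1) \<or> t = (0,-1)" using that(2) by (auto simp: axis_steps_def)
    ultimately show ?thesis unfolding u by (elim disjE) (simp_all add: add.commute)
  qed
  \<comment> \<open>No side between two squares outside \<open>C\<close> is in
    \<open>\<Gamma>\<close>, so \<open>X - C\<close> is closed under side steps; if nonempty it
    would contain the far square \<open>p\<close>, whose ray is empty.\<close>
  have "X \<subseteq> C"
  proof (rule ccontr)
    assume "\<not> X \<subseteq> C"
    then obtain a where a: "a \<in> X - C" by blast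
    have "edge_closed (W1 - C) (X - C)"
      unfolding edge_closed_def
    proof (intro conjI ballI impI)
      fix u s assume u: "u \<in> X - C" and s: "s \<in> lattice2_steps" and us: "u + s \<in> W1 - C"
      obtain t where t: "t \<in> axis_steps" "u + s = u + t + t"
      proof -
        have "\<exists>t\<in>axis_steps. s = t + t" using s by (auto simp: lattice2_steps_def axis_steps_def)
        then show ?thesis using that by (metis add.assoc)
      qed
      have uW: "u \<in> W1" using u by (auto simp: X_def)
      have "u + t \<notin> \<Gamma>" using \<Gamma>[of u t] uW u us t by auto
      then have "u + t + t \<in> X" using bd[OF uW t(1)] u by blast
      then show "u + s \<in> X - C" using us unfolding t(2) by blast
    qed (auto simp: X_def)
    then have "p \<in> X - C" using conn a pC unfolding edge_connected_def by blast
    then show False using far[of p] by (simp add: X_def)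
  qed
  then show ?thesis using bd by blast
qed

section \<open>Coverings with a given impurity correspond to dual trees\<close>

context temperley
begin

text \<open>Induction goes from \<open>w\<close> outwards along the primal flow of
  \<open>s1\<close>. If \<open>s2\<close> differed at \<open>x\<close>, it would match the edge
  chosen by \<open>s1\<close> to the other end, where both agree already; then \<open>s1\<close>
  would use that edge twice.\<close>

lemma Cov_unique:
  assumes s1: "s1 \<in> Cov v w" and s2: "s2 \<in> Cov v w"
    and v: "v \<in> V1" and w: "w \<in> V0" and vw: "v - w \<in> diag_steps"
    and eq: "\<And>u. u \<in> V1 - {v} \<Longrightarrow> s1 u = s2 u"
  shows "s1 = s2"
proof -
  have vV0: "v \<notin> V0" and wV1: "w \<notin> V1" using v w V01_disj by auto
  have "s1 x = s2 x" if "x \<in> V0" "x \<noteq> w" for x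
  proof -
    have "reaches (nx0 s1) w x" using Cov_flows[OF s1 v w vw] that by blast
    then show ?thesis using that
    proof (induction rule: reaches_induct)
      case (step x)
      show ?case
      proof (rule ccontr)
        assume ne: "s1 x \<noteq> s2 x"
        have x: "x \<in> V0 \<union> V1 - {v, w}" using step.prems vV0 by auto
        have ax: "s1 x \<in> axis_steps" "x + s1 x \<in> E" using Cov_D[OF s1, of x] x by auto
        from Cov_surj[OF s2 ax(2)] obtain z
          where z: "z \<in> V0 \<union> V1" "z \<noteq> v" "z \<noteq> w" "x + s1 x = z + s2 z" "s2 z \<in> axis_steps" .
        have "z \<in> V0"
        proof (rule ccontr)
          assume "z \<notin> V0"
          then have "s1 z = s2 z" "z \<in> V1" using eq z by auto
          then have "z = x" using Cov_inj[OF s1, of z x] z x by auto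
          then show False using \<open>z \<notin> V0\<close> step.prems by auto
        qed
        then have "x \<in> W0 \<and> z \<in> W0 \<or> x \<in> W1 \<and> z \<in> W1" using V0_W0 step.prems(1) by blast
        from same_edge[OF z(4) ax(1) z(5) this] have "z = x \<or> z = nx0 s1 x" unfolding nx0_def by blast
        moreover have "z \<noteq> x" using ne z(4) by auto
        ultimately have zn: "z = nx0 s1 x" by blast
        then have "s1 z = s2 z" using step.IH \<open>z \<in> V0\<close> z(3) by auto
        then have "z = x" using Cov_inj[OF s1, of z x] z x by auto
        then show False using \<open>z \<noteq> x\<close> by blast
      qed
    qed simp
  qed
  then have "s1 x = s2 x" if "x \<in> V0 \<union> V1 - {v, w}" for x
    using that eq by blast
  moreover have "s1 \<in> extensional (V0 \<union> V1 - {v, w})" "s2 \<in> extensional (V0 \<union> V1 - {v, w})"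
    using s1 s2 by (auto simp: Cov_def PiE_def)
  ultimately show ?thesis by (intro extensionalityI) auto
qed

lemma Cov_restrict:
  assumes s: "s \<in> Cov v w" and v: "v \<in> V1" and w: "w \<in> V0" and vw: "v - w \<in> diag_steps"
  shows "restrict s (V1 - {v}) \<in> trees v"
proof -
  have wV1: "w \<notin> V1" using w V01_disj by auto
  have "reaches (nx1 (restrict s (V1 - {v}))) v u" if u: "u \<in> V1" for u
  proof (rule reaches_cong_on)
    show "reaches (nx1 s) v u" using Cov_flows[OF s v w vw] u by blast
    show "nx1 s y \<in> V1 \<and> nx1 s y = nx1 (restrict s (V1 - {v})) y" if "y \<in> V1" "y \<noteq> v" for y
      using that nx1_V1[of s y] by (simp add: nx1_def)
  qed (rule u)
  moreover have "restrict s (V1 - {v}) \<in> Pi\<^sub>E (V1 - {v}) (\<lambda>_. axis_steps)"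
    using Cov_D(1)[OF s] wV1 by (intro restrict_PiE_iff[THEN iffD2]) auto
  ultimately show ?thesis by (simp add: trees_def)
qed

text \<open>A step from \<open>f\<close> to a square outside \<open>C\<close> is contracted to a
  loop at \<open>f\<close>, from which \<open>v\<close> is never reached.\<close>

lemma trees_step:
  assumes d: "d \<in> trees v" and v: "v \<in> V1" and u: "u \<in> V1 - {v}"
  shows "d u \<in> axis_steps" "u + d u \<in> E"
proof -
  show ax: "d u \<in> axis_steps" using d u by (auto simp: trees_def)
  have uW: "u \<in> W1" using u V1_W1 by auto
  show "u + d u \<in> E"
  proof (cases "u \<in> C")
    case False
    then have uf: "u = f" using u by auto
    have "u + d u + d u \<in> C"
    proof (rule ccontr)
      assume "u + d u + d u \<notin> C"
      then have "nx1 d u = u" by (simp add: nx1_def ct_def uf)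
      moreover have "reaches (nx1 d) v u" using d u by (auto simp: trees_def)
      ultimately have "v \<in> {u}" by (intro reaches_closed[of "nx1 d" v u]) auto
      then show False using u by auto
    qed
    then show ?thesis using E_at_W1[OF uW ax] by auto
  qed (use E_at_W1[OF uW ax] in auto)
qed

text \<open>\<open>P\<close> is the path from \<open>x\<close> to \<open>w\<close> as a chain modulo
  2. Under symmetric differences degrees add modulo 2, so it need not be checked that the path
  repeats no edge.\<close>

lemma primal_path_parity:
  assumes x: "x \<in> V0" "reaches (nx0 s) w x"
    and s: "\<And>y. y \<in> V0 - {w} \<Longrightarrow> s y \<in> axis_steps \<and> y + s y \<in> T" and T: "T \<subseteq> E"
  shows "\<exists>P \<subseteq> (\<lambda>y. y + s y) ` (V0 - {w}).
    \<forall>z\<in>W0. odd (card {t \<in> axis_steps. z + t \<in> P}) \<longleftrightarrow> (z = x) \<noteq> (z = w)"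
proof -
  let ?deg = "\<lambda>P z. card {t \<in> axis_steps. z + t \<in> P}"
  let ?F = "(\<lambda>y. y + s y) ` (V0 - {w})"
  have "\<exists>P \<subseteq> ?F. \<forall>z\<in>W0. odd (?deg P z) \<longleftrightarrow> (z = x) \<noteq> (z = w)"
    using x(2,1)
  proof (induction rule: reaches_induct)
    case root
    show ?case by (intro exI[of _ "{}"]) auto
  next
    case (step x)
    have xs: "s x \<in> axis_steps" "x + s x \<in> E" using s[of x] T step by auto
    have xW: "x \<in> W0" using step.prems V0_W0 by blast
    have n: "nx0 s x \<in> V0" using E_next[OF step.prems xs] by (simp add: nx0_def)
    then obtain P where P: "P \<subseteq> ?F" "\<And>z. z \<in> W0 \<Longrightarrow> odd (?deg P z) \<longleftrightarrow> (z = nx0 s x) \<noteq> (z = w)"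
      using step.IH by blast
    have one: "odd (?deg {x + s x} z) \<longleftrightarrow> (z = x) \<noteq> (z = nx0 s x)" if z: "z \<in> W0" for z
    proof -
      have ne: "nx0 s x \<noteq> x" using axis_two_ne[OF xs(1)] by (simp add: nx0_def)
      have "{t \<in> axis_steps. z + t \<in> {x + s x}} = (if z = x then {s x} else if z = nx0 s x then {- s x} else {})"
        (is "?L = ?R")
      proof
        show "?L \<subseteq> ?R"
        proof
          fix t assume "t \<in> ?L"
          then have t: "t \<in> axis_steps" "x + s x = z + t" by auto
          from same_edge[OF t(2) xs(1) t(1)] xW z
          have "x = z \<and> s x = t \<or> z = x + s x + s x \<and> t = - s x" by blast
          then show "t \<in> ?R" using ne by (auto simp: nx0_def)
        qed
        show "?R \<subseteq> ?L" using xs(1) by (auto simp: nx0_def split: if_splits)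
      qed
      then show ?thesis using ne by auto
    qed
    let ?P = "sym_diff P {x + s x}"
    have "odd (?deg ?P z) \<longleftrightarrow> (z = x) \<noteq> (z = w)" if z: "z \<in> W0" for z
    proof -
      have "{t \<in> axis_steps. z + t \<in> ?P} =
          sym_diff {t \<in> axis_steps. z + t \<in> P} {t \<in> axis_steps. z + t \<in> {x + s x}}"
        by blast
      then have "odd (?deg ?P z) \<longleftrightarrow> odd (?deg P z) \<noteq> odd (?deg {x + s x} z)"
        using odd_card_sym_diff[of "{t \<in> axis_steps. z + t \<in> P}" "{t \<in> axis_steps. z + t \<in> {x + s x}}"] by simp
      then show ?thesis using P(2)[OF z] one[OF z] by blast
    qed
    moreover have "?P \<subseteq> ?F" using P(1) step.prems step.hyps by blast
    ultimately show ?case by blast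
  qed
  then show ?thesis .
qed

text \<open>The edges not crossed by a spanning tree of the dual form a spanning tree of \<open>H\<close>.\<close>
lemma Cov_extend:
  assumes d: "d \<in> trees v" and v: "v \<in> V1" and w: "w \<in> V0"
  shows "\<exists>s\<in>Cov v w. restrict s (V1 - {v}) = d"
proof -
  define T' where "T' = (\<lambda>u. u + d u) ` (V1 - {v})"
  define T where "T = E - T'"
  have dT: "d u \<in> axis_steps" "u + d u \<in> E" if "u \<in> V1 - {v}" for u
    using trees_step[OF d v that] .
  have flow: "reaches (nx1 d) v u" if "u \<in> V1" for u using d that by (auto simp: trees_def)
  define R where "R = {(x, x + t + t) | x t. x \<in> V0 \<and> t \<in> axis_steps \<and> x + t \<in> T}"
  \<comment> \<open>The vertices joined to \<open>w\<close> by uncrossed edges. A cut of this set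
    would consist of edges of the dual tree, which \<open>no_cut_in_dual_forest\<close> forbids;
    hence all of \<open>H\<close> is joined to \<open>w\<close>.\<close>
  define X where "X = {x \<in> V0. (x, w) \<in> R\<^sup>*}"
  have XW: "X \<subseteq> W0" using V0_W0 by (auto simp: X_def)
  have Rback: "x \<in> X" if x: "x \<in> V0" "t \<in> axis_steps" "x + t \<in> T" "x + t + t \<in> X" for x t
  proof -
    have "(x, x + t + t) \<in> R" using x(1-3) unfolding R_def by blast
    then show ?thesis using x(1,4) by (auto simp: X_def intro: converse_rtrancl_into_rtrancl)
  qed
  have Rfwd: "x + t + t \<in> X" if x: "x \<in> X" "t \<in> axis_steps" "x + t \<in> T" for x t
  proof (rule Rback[where t = "- t"])
    show "x + t + t \<in> V0" using E_next[of x t] x by (auto simp: X_def T_def)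
  qed (use x in \<open>simp_all\<close>)
  have cutX: "\<exists>u\<in>V1 - {v}. d u \<in> axis_steps \<and> e = u + d u" if e: "e \<in> cut X" for e
  proof -
    from e obtain t where t: "t \<in> axis_steps" "e + t \<in> X" "e - t \<notin> X" "e \<in> E" by (auto simp: cut_def)
    have "e \<notin> T" using Rfwd[OF t(2), of "- t"] t by auto
    then have "e \<in> T'" using t by (auto simp: T_def)
    then show ?thesis using dT by (auto simp: T'_def)
  qed
  have "X = V0"
  proof (rule H_connected)
    show "X \<subseteq> V0" "w \<in> X" using w by (auto simp: X_def)
    fix x t assume x: "x \<in> X" and t: "t \<in> axis_steps" and xt: "x + t \<in> E"
    have xW: "x \<in> W0" using x XW by blast
    have "x + t + rot t \<in> W1" using xW t by (cases x) (auto simp: axis_steps_def W0_def W1_def rot_def)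
    then have "x + t + rot t + (- rot t) \<notin> cut X"
      using no_cut_in_dual_forest[OF XW cutX, of "x + t + rot t" "- rot t"] flow[OF ct_V1] t by simp
    then show "x + t + t \<in> X" using cut_W0_at_W0[OF XW xW t] xt x by simp
  qed
  \<comment> \<open>Distance to \<open>w\<close> along uncrossed edges. Its strict decrease under
    \<open>\<sigma>\<close> yields the flow and, later, that no edge is chosen from both
    ends.\<close>
  define rk where "rk x = (LEAST n. (x, w) \<in> R ^^ n)" for x
  have parent: "\<exists>t. t \<in> axis_steps \<and> x + t \<in> T \<and> rk (x + t + t) < rk x" if x: "x \<in> V0 - {w}" for x
  proof -
    have "(x, w) \<in> R\<^sup>*" using x \<open>X = V0\<close> by (auto simp: X_def)
    then obtain n where "(x, w) \<in> R ^^ n" using rtrancl_power by blast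
    then have rk: "(x, w) \<in> R ^^ rk x" unfolding rk_def by (rule LeastI)
    have "rk x \<noteq> 0"
    proof
      assume "rk x = 0"
      then show False using rk x by simp
    qed
    then obtain m where m: "rk x = Suc m" using not0_implies_Suc by blast
    then obtain y where y: "(x, y) \<in> R" "(y, w) \<in> R ^^ m" using rk by (metis relpow_Suc_D2)
    have "rk y \<le> m" unfolding rk_def by (rule Least_le) (rule y(2))
    moreover obtain t where "t \<in> axis_steps" "x + t \<in> T" "y = x + t + t" using y(1) unfolding R_def by blast
    ultimately show ?thesis using m by (metis less_Suc_eq_le)
  qed
  then obtain \<sigma> where \<sigma>: "\<And>x. x \<in> V0 - {w} \<Longrightarrow> \<sigma> x \<in> axis_steps \<and> x + \<sigma> x \<in> T \<and> rk (x + \<sigma> x + \<sigma> x) < rk x"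
    by metis
  have \<sigma>flow: "reaches (nx0 \<sigma>) w x" if "x \<in> V0" for x
    using that
  proof (induction "rk x" arbitrary: x rule: less_induct)
    case less
    show ?case
    proof (cases "x = w")
      case False
      then have x: "x \<in> V0 - {w}" using less by blast
      have "nx0 \<sigma> x \<in> V0" using E_next[of x "\<sigma> x"] \<sigma>[OF x] x by (auto simp: nx0_def T_def)
      then have "reaches (nx0 \<sigma>) w (nx0 \<sigma> x)" using less.hyps \<sigma>[OF x] by (auto simp: nx0_def)
      then show ?thesis using reaches_step[OF False] by blast
    qed simp
  qed
  define T0 where "T0 = (\<lambda>x. x + \<sigma> x) ` (V0 - {w})"
  have T0T: "T0 \<subseteq> T" using \<sigma> unfolding T0_def by blast
  \<comment> \<open>A further uncrossed edge would close a cycle with the paths from its ends to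
    \<open>w\<close>. The cycle bounds a nonempty set of faces, and the dual flow, which never
    crosses it, cannot lead both these faces and \<open>f\<close> to \<open>v\<close>.\<close>
  have "T \<subseteq> T0"
  proof (rule ccontr)
    assume "\<not> T \<subseteq> T0"
    then obtain e where e: "e \<in> T" "e \<notin> T0" by blast
    then have eE: "e \<in> E" by (simp add: T_def)
    obtain x t where xt: "x \<in> V0" "t \<in> axis_steps" "e = x + t"
    proof -
      have "\<exists>t\<in>axis_steps. e + t \<in> W0"
        using E_parity[OF eE] by (cases e) (auto simp: axis_steps_def W0_def)
      then obtain t where t: "t \<in> axis_steps" "e + t \<in> W0" by blast
      show ?thesis using that[of "e + t" "- t"] E_ends[OF eE t] t by simp
    qed
    define y where "y = x + t + t"
    have y: "y \<in> V0" using E_next[OF xt(1,2)] xt(3) eE by (simp add: y_def)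
    have xyW: "x \<in> W0" "y \<in> W0" using xt(1) y V0_W0 by auto
    have ne: "x \<noteq> y" using axis_two_ne[OF xt(2)] by (metis y_def)
    have \<sigma>': "\<sigma> x \<in> axis_steps \<and> x + \<sigma> x \<in> T" if "x \<in> V0 - {w}" for x using \<sigma>[OF that] by blast
    have TE: "T \<subseteq> E" by (auto simp: T_def)
    obtain P where P: "P \<subseteq> T0" "\<And>z. z \<in> W0 \<Longrightarrow> odd (card {t \<in> axis_steps. z + t \<in> P}) \<longleftrightarrow> (z = x) \<noteq> (z = w)"
      using primal_path_parity[OF xt(1) \<sigma>flow[OF xt(1)] \<sigma>' TE, folded T0_def] by blast
    obtain Q where Q: "Q \<subseteq> T0" "\<And>z. z \<in> W0 \<Longrightarrow> odd (card {t \<in> axis_steps. z + t \<in> Q}) \<longleftrightarrow> (z = y) \<noteq> (z = w)"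
      using primal_path_parity[OF y \<sigma>flow[OF y] \<sigma>' TE, folded T0_def] by blast
    define \<Gamma> where "\<Gamma> = insert e (sym_diff P Q)"
    have deg_e: "odd (card {t' \<in> axis_steps. z + t' = e}) \<longleftrightarrow> z = x \<or> z = y" if z: "z \<in> W0" for z
    proof -
      have "{t' \<in> axis_steps. z + t' = e} = (if z = x then {t} else if z = y then {- t} else {})" (is "?L = ?R")
      proof
        show "?L \<subseteq> ?R"
        proof
          fix t' assume "t' \<in> ?L"
          then have t': "t' \<in> axis_steps" "x + t = z + t'" using xt(3) by auto
          from same_edge[OF t'(2) xt(2) t'(1)] xyW z
          have "x = z \<and> t = t' \<or> z = x + t + t \<and> t' = - t" by blast
          then show "t' \<in> ?R" using ne by (auto simp: y_def)
        qed
        show "?R \<subseteq> ?L" using xt by (auto simp: y_def split: if_splits)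
      qed
      then show ?thesis by auto
    qed
    have ev: "even (card {t \<in> axis_steps. z + t \<in> \<Gamma>})" if z: "z \<in> W0" for z
    proof -
      let ?p = "{t \<in> axis_steps. z + t \<in> P}" and ?q = "{t \<in> axis_steps. z + t \<in> Q}" and ?e = "{t \<in> axis_steps. z + t = e}"
      have "{t \<in> axis_steps. z + t \<in> \<Gamma>} = sym_diff ?e (sym_diff ?p ?q)"
        using e(2) P(1) Q(1) by (auto simp: \<Gamma>_def)
      then have "odd (card {t \<in> axis_steps. z + t \<in> \<Gamma>}) \<longleftrightarrow> odd (card ?e) \<noteq> (odd (card ?p) \<noteq> odd (card ?q))"
        using odd_card_sym_diff[of ?e "sym_diff ?p ?q"] odd_card_sym_diff[of ?p ?q] by simp
      then show ?thesis using deg_e[OF z] P(2)[OF z] Q(2)[OF z] ne by auto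
    qed
    have \<Gamma>T: "\<Gamma> \<subseteq> T" using e(1) P(1) Q(1) T0T by (auto simp: \<Gamma>_def)
    obtain Y where Y: "Y \<subseteq> C"
      "\<And>u t. u \<in> W1 \<Longrightarrow> t \<in> axis_steps \<Longrightarrow> u + t \<in> \<Gamma> \<longleftrightarrow> (u \<in> Y) \<noteq> (u + t + t \<in> Y)"
    proof -
      have "edge_connected (W1 - C)" using complement_faces_edge_connected[OF conn_compl CW1] .
      moreover have "finite \<Gamma>" using finite_subset[OF subset_trans[OF \<Gamma>T TE] finite_E] .
      moreover have "u + t \<notin> \<Gamma>" if "u \<in> W1 - C" "t \<in> axis_steps" "u + t + t \<in> W1 - C" for u t
        using that E_at_W1[of u t] \<Gamma>T TE by blast
      ultimately show ?thesis using even_edges_bound[OF finC, of \<Gamma>] ev that by blast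
    qed
    have inv: "u \<in> Y \<longleftrightarrow> nx1 d u \<in> Y" if u: "u \<in> V1 - {v}" for u
    proof -
      have "u + d u \<notin> \<Gamma>" using \<Gamma>T u by (auto simp: T_def T'_def)
      then have "u \<in> Y \<longleftrightarrow> u + d u + d u \<in> Y" using Y(2)[of u "d u"] dT[OF u] u V1_W1 by auto
      then show ?thesis using Y(1) fC by (auto simp: nx1_def ct_def)
    qed
    have "v \<in> V1 - Y"
    proof (rule reaches_closed[OF flow])
      show "f \<in> V1" "f \<in> V1 - Y" using Y(1) fC by auto
      show "nx1 d y \<in> V1 - Y" if "y \<in> V1 - Y" "y \<noteq> v" for y using inv[of y] that nx1_V1[of d y] by blast
    qed
    obtain u t' where u: "u \<in> W1" "t' \<in> axis_steps" "e = u + t'"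
      using that xt(2) xyW(1)
    proof -
      have "x + t + rot t \<in> W1" using xyW(1) xt(2) by (cases x) (auto simp: axis_steps_def W0_def W1_def rot_def)
      moreover have "e = x + t + rot t + (- rot t)" using xt(3) by simp
      ultimately show ?thesis using that[of "x + t + rot t" "- rot t"] xt(2) by simp
    qed
    have "e \<in> \<Gamma>" by (simp add: \<Gamma>_def)
    then obtain u' where u': "u' \<in> Y" using Y(2)[OF u(1,2)] u(3) by blast
    have "v \<in> V1 \<inter> Y"
    proof (rule reaches_closed[OF flow])
      show "u' \<in> V1" "u' \<in> V1 \<inter> Y" using Y(1) u' by auto
      show "nx1 d y \<in> V1 \<inter> Y" if "y \<in> V1 \<inter> Y" "y \<noteq> v" for y using inv[of y] that nx1_V1[of d y] by blast
    qed
    then show False using \<open>v \<in> V1 - Y\<close> by blast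
  qed
  then have T0: "T0 = T" using T0T by blast
  \<comment> \<open>Off \<open>V0 - {w}\<close> the value is that of \<open>d\<close>, so that
    \<open>s\<close> is \<open>undefined\<close> wherever \<open>Pi\<^sub>E\<close> demands
    it.\<close>
  define s where "s x = (if x \<in> V0 - {w} then \<sigma> x else d x)" for x
  have vV0: "v \<notin> V0" and wV1: "w \<notin> V1" using v w V01_disj by auto
  have split: "V0 \<union> V1 - {v, w} = (V0 - {w}) \<union> (V1 - {v})" using vV0 wV1 by auto
  have s0: "s x = \<sigma> x" if "x \<in> V0 - {w}" for x using that by (simp add: s_def)
  have s1: "s x = d x" if "x \<in> V1 - {v}" for x using that V01_disj by (auto simp: s_def)
  have img0: "(\<lambda>x. x + s x) ` (V0 - {w}) = T" unfolding T0[symmetric] T0_def using s0 by (intro image_cong) auto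
  have img1: "(\<lambda>x. x + s x) ` (V1 - {v}) = T'" unfolding T'_def using s1 by (intro image_cong) auto
  have inj0: "inj_on (\<lambda>x. x + s x) (V0 - {w})"
  proof (rule inj_onI)
    fix x y assume x: "x \<in> V0 - {w}" and y: "y \<in> V0 - {w}" and "x + s x = y + s y"
    then have eq: "x + \<sigma> x = y + \<sigma> y" using s0 by simp
    from same_edge[OF eq] \<sigma>[OF x] \<sigma>[OF y] V0_W0 x y
    have "x = y \<or> y = x + \<sigma> x + \<sigma> x \<and> x = y + \<sigma> y + \<sigma> y" by blast
    then show "x = y" using \<sigma>[OF x] \<sigma>[OF y] less_asym by metis
  qed
  have inj1: "inj_on (\<lambda>x. x + s x) (V1 - {v})"
  proof (rule inj_onI)
    fix x y assume x: "x \<in> V1 - {v}" and y: "y \<in> V1 - {v}" and "x + s x = y + s y"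
    then have eq: "x + d x = y + d y" using s1 by simp
    from same_edge[OF eq] dT[OF x] dT[OF y] V1_W1 x y
    have "x = y \<or> y = x + d x + d x \<and> x = y + d y + d y" by blast
    then show "x = y"
    proof
      assume a: "y = x + d x + d x \<and> x = y + d y + d y"
      then have "ct (x + d x + d x) = y" "ct (y + d y + d y) = x"
        using ct_id x y by (metis Diff_iff)+
      then have "nx1 d x = y" "nx1 d y = x" by (simp_all add: nx1_def)
      then show ?thesis using no_two_cycle[OF flow, of x y] x y by blast
    qed
  qed
  have "bij_betw (\<lambda>x. x + s x) (V0 \<union> V1 - {v, w}) E"
    unfolding bij_betw_def split inj_on_Un image_Un img0 img1
  proof (intro conjI)
    show "(\<lambda>x. x + s x) ` (V0 - {w} - (V1 - {v})) \<inter> (\<lambda>x. x + s x) ` (V1 - {v} - (V0 - {w})) = {}"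
      using img0 img1 by (auto simp: T_def)
    show "T \<union> T' = E" unfolding T_def T'_def using dT(2) by blast
  qed (use inj0 inj1 in auto)
  moreover have "s \<in> Pi\<^sub>E (V0 \<union> V1 - {v, w}) (\<lambda>_. axis_steps)"
  proof (rule PiE_I)
    fix x assume "x \<in> V0 \<union> V1 - {v, w}"
    then consider "x \<in> V0 - {w}" | "x \<in> V1 - {v}" using split by blast
    then show "s x \<in> axis_steps" using \<sigma> dT s0 s1 by cases auto
  next
    fix x assume "x \<notin> V0 \<union> V1 - {v, w}"
    then have "x \<notin> V0 - {w}" "x \<notin> V1 - {v}" using split by blast+
    then have "s x = d x" by (simp only: s_def if_False)
    moreover have "d \<in> Pi\<^sub>E (V1 - {v}) (\<lambda>_. axis_steps)" using d by (simp add: trees_def)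
    ultimately show "s x = undefined" using PiE_arb \<open>x \<notin> V1 - {v}\<close> by metis
  qed
  ultimately have "s \<in> Cov v w" by (simp add: Cov_def)
  moreover have "restrict s (V1 - {v}) = d"
  proof
    fix u
    have "d \<in> Pi\<^sub>E (V1 - {v}) (\<lambda>_. axis_steps)" using d by (simp add: trees_def)
    then have "u \<notin> V1 - {v} \<Longrightarrow> d u = undefined" by (rule PiE_arb)
    then show "restrict s (V1 - {v}) u = d u" using s1[of u] unfolding restrict_def by presburger
  qed
  ultimately show ?thesis by blast
qed

text \<open>The count is independent of the corner \<open>w\<close>: moving \<open>w\<close> only
  reorients the primal tree, whose edges are those the dual tree does not cross.\<close>

lemma card_Cov:
  assumes v: "v \<in> V1" and w: "w \<in> V0" and vw: "v - w \<in> diag_steps"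
  shows "card (Cov v w) = card (trees v)"
proof (rule bij_betw_same_card[of "\<lambda>s. restrict s (V1 - {v})"], unfold bij_betw_def, intro conjI)
  show "inj_on (\<lambda>s. restrict s (V1 - {v})) (Cov v w)"
  proof (rule inj_onI)
    fix s s' assume s: "s \<in> Cov v w" "s' \<in> Cov v w" and eq: "restrict s (V1 - {v}) = restrict s' (V1 - {v})"
    show "s = s'"
    proof (rule Cov_unique[OF s v w vw])
      fix u assume "u \<in> V1 - {v}"
      then show "s u = s' u" using fun_cong[OF eq, of u] by simp
    qed
  qed
  show "(\<lambda>s. restrict s (V1 - {v})) ` Cov v w = trees v"
  proof
    show "(\<lambda>s. restrict s (V1 - {v})) ` Cov v w \<subseteq> trees v"
      using Cov_restrict[OF _ v w vw] by blast
    show "trees v \<subseteq> (\<lambda>s. restrict s (V1 - {v})) ` Cov v w"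
      using Cov_extend[OF _ v w] by blast
  qed
qed

end

section \<open>Harmonicity of the tree counts\<close>

text \<open>\<open>u\<close> lies on a cycle, where it has only one predecessor. If one hitting time
  were larger, removing a turn through \<open>u\<close> would shorten it.\<close>

lemma unique_last_before:
  assumes "reaches g a u" "reaches g b u" "g a = u" "g b = u"
  shows "a = b"
proof -
  have le: "hit_time g b u \<le> hit_time g a u" if "reaches g a u" "reaches g b u" "g a = u" for a b
  proof (rule ccontr)
    let ?m = "hit_time g a u" and ?n = "hit_time g b u"
    assume "\<not> ?n \<le> ?m"
    then have n: "?n = (?n - Suc ?m) + Suc ?m" by simp
    have a: "(g ^^ ?m) u = a" and b: "(g ^^ ?n) u = b"
      using that(1,2) unfolding hit_time_def reaches_def by (meson LeastI_ex)+
    have "(g ^^ Suc ?m) u = u" using a that(3) by simp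
    then have "(g ^^ (?n - Suc ?m)) u = b" using b by (subst (asm) n) (simp only: funpow_add o_apply)
    then have "?n \<le> ?n - Suc ?m" unfolding hit_time_def by (rule Least_le)
    then show False using n by simp
  qed
  have "hit_time g a u = hit_time g b u" using le assms by (simp add: le_antisym)
  moreover have "(g ^^ hit_time g a u) u = a" "(g ^^ hit_time g b u) u = b"
    using assms(1,2) unfolding hit_time_def reaches_def by (meson LeastI_ex)+
  ultimately show ?thesis by metis
qed

lemma reaches_trans: "reaches g b a \<Longrightarrow> reaches g c b \<Longrightarrow> reaches g c a"
  unfolding reaches_def by (metis comp_apply funpow_add)

context temperley
begin

text \<open>Trees closed by one further step at the root: functional graphs with a single cycle,
  which passes through \<open>v\<close>.\<close>

definition rooted :: "pt \<Rightarrow> (pt \<Rightarrow> pt) set" where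
  "rooted v = {d \<in> Pi\<^sub>E V1 (\<lambda>_. axis_steps). \<forall>u\<in>V1. reaches (nx1 d) v u}"

lemma finite_trees [simp]: "finite (trees v)"
  unfolding trees_def using finC by (intro finite_subset[OF _ finite_PiE[of "V1 - {v}" "\<lambda>_. axis_steps"]]) auto

lemma finite_rooted [simp]: "finite (rooted v)"
  unfolding rooted_def using finC by (intro finite_subset[OF _ finite_PiE[of V1 "\<lambda>_. axis_steps"]]) auto

lemma reaches_root_irrelevant:
  assumes "\<And>y. y \<in> V1 \<Longrightarrow> y \<noteq> v \<Longrightarrow> d y = d' y" "u \<in> V1" "reaches (nx1 d) v u"
  shows "reaches (nx1 d') v u"
proof (rule reaches_cong_on[OF assms(3,2)])
  fix y assume "y \<in> V1" "y \<noteq> v"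
  then show "nx1 d y \<in> V1 \<and> nx1 d y = nx1 d' y" using assms(1)[of y] nx1_V1[of d y] by (simp add: nx1_def)
qed

text \<open>Reaching \<open>v\<close> does not depend on the step taken at \<open>v\<close>, so this
  step and the tree are chosen independently.\<close>

lemma card_rooted:
  assumes v: "v \<in> V1" and S: "S \<subseteq> axis_steps"
  shows "card {d \<in> rooted v. d v \<in> S} = card S * card (trees v)"
proof -
  have "bij_betw (\<lambda>(t, d). d(v := t)) (S \<times> trees v) {d \<in> rooted v. d v \<in> S}"
  proof (rule bij_betw_byWitness[where f' = "\<lambda>d. (d v, restrict d (V1 - {v}))"])
    show "\<forall>a\<in>S \<times> trees v. (\<lambda>d. (d v, restrict d (V1 - {v}))) ((\<lambda>(t, d). d(v := t)) a) = a"
    proof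
      fix a assume "a \<in> S \<times> trees v"
      then obtain t d where a: "a = (t, d)" "d \<in> trees v" by blast
      have "d \<in> extensional (V1 - {v})" using a(2) by (simp add: trees_def PiE_def)
      then have "restrict (d(v := t)) (V1 - {v}) = d" by (auto simp: fun_eq_iff extensional_def)
      then show "(\<lambda>d. (d v, restrict d (V1 - {v}))) ((\<lambda>(t, d). d(v := t)) a) = a" by (simp add: a)
    qed
    show "\<forall>d\<in>{d \<in> rooted v. d v \<in> S}. (\<lambda>(t, d). d(v := t)) ((d v, restrict d (V1 - {v}))) = d"
    proof
      fix d assume "d \<in> {d \<in> rooted v. d v \<in> S}"
      then have "d \<in> extensional V1" by (simp add: rooted_def PiE_def)
      then show "(\<lambda>(t, d). d(v := t)) ((d v, restrict d (V1 - {v}))) = d"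
        by (auto simp: fun_eq_iff extensional_def)
    qed
    show "(\<lambda>(t, d). d(v := t)) ` (S \<times> trees v) \<subseteq> {d \<in> rooted v. d v \<in> S}"
    proof
      fix h assume "h \<in> (\<lambda>(t, d). d(v := t)) ` (S \<times> trees v)"
      then obtain t d where h: "h = d(v := t)" "t \<in> S" "d \<in> trees v" by auto
      have "h \<in> Pi\<^sub>E V1 (\<lambda>_. axis_steps)"
        using h S v unfolding trees_def by (auto simp: PiE_iff extensional_def)
      moreover have "\<forall>u\<in>V1. reaches (nx1 h) v u"
        using h(3) reaches_root_irrelevant[of v d h] unfolding h(1) trees_def by simp
      ultimately show "h \<in> {d \<in> rooted v. d v \<in> S}" using h(1,2) by (simp add: rooted_def)
    qed
    show "(\<lambda>d. (d v, restrict d (V1 - {v}))) ` {d \<in> rooted v. d v \<in> S} \<subseteq> S \<times> trees v"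
    proof
      fix a assume "a \<in> (\<lambda>d. (d v, restrict d (V1 - {v}))) ` {d \<in> rooted v. d v \<in> S}"
      then obtain d where d: "a = (d v, restrict d (V1 - {v}))" "d \<in> rooted v" "d v \<in> S" by blast
      have "restrict d (V1 - {v}) \<in> Pi\<^sub>E (V1 - {v}) (\<lambda>_. axis_steps)"
        using d(2) unfolding rooted_def by (auto simp: PiE_iff)
      moreover have "\<forall>u\<in>V1. reaches (nx1 (restrict d (V1 - {v}))) v u"
        using d(2) reaches_root_irrelevant[of v d "restrict d (V1 - {v})"] unfolding rooted_def by simp
      ultimately show "a \<in> S \<times> trees v" using d by (simp add: trees_def)
    qed
  qed
  then have "card (S \<times> trees v) = card {d \<in> rooted v. d v \<in> S}" by (rule bij_betw_same_card)
  then show ?thesis by (simp add: card_cartesian_product)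
qed

lemma card_steps_between:
  "card {t \<in> axis_steps. x + t + t = y} = of_bool (y - x \<in> lattice2_steps)"
proof (cases "y - x \<in> lattice2_steps")
  case True
  then obtain t where t: "t \<in> axis_steps" "y - x = t + t"
    by (auto simp: lattice2_steps_def axis_steps_def)
  have "{t \<in> axis_steps. x + t + t = y} = {t}"
  proof -
    have "t' = t" if "x + t' + t' = y" for t'
    proof -
      have "t' + t' = t + t" using that t(2) by (metis add.assoc add_diff_cancel_left')
      then show ?thesis by (cases t; cases t') auto
    qed
    moreover have "x + t + t = y" using t(2) by (metis add.assoc add.commute diff_add_cancel)
    ultimately show ?thesis using t(1) by blast
  qed
  then show ?thesis using True by simp
next
  case False
  have "{t \<in> axis_steps. x + t + t = y} = {}"
  proof -
    have "x + t + t - x \<in> lattice2_steps" if "t \<in> axis_steps" for t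
      using that by (cases x) (auto simp: axis_steps_def lattice2_steps_def)
    then show ?thesis using False by blast
  qed
  then show ?thesis using False by simp
qed

text \<open>The Markov chain tree theorem: closing a tree at its root creates exactly one cycle, which may
  be reopened either behind \<open>u\<close> or in front of \<open>u\<close>.\<close>
lemma trees_balance:
  assumes u: "u \<in> C"
  shows "4 * card (trees u) = (\<Sum>u'\<in>V1. of_bool (u - u' \<in> lattice2_steps) * card (trees u'))"
proof -
  let ?R = "\<lambda>u'. {d \<in> rooted u'. nx1 d u' = u}"
  have un: "rooted u = (\<Union>u'\<in>V1. ?R u')"
  proof
    show "rooted u \<subseteq> (\<Union>u'\<in>V1. ?R u')"
    proof
      fix d assume d: "d \<in> rooted u"
      let ?g = "nx1 d"
      have "reaches ?g u (?g u)" using d nx1_V1[of d u] unfolding rooted_def by blast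
      then obtain n where n: "(?g ^^ n) (?g u) = u" by (auto simp: reaches_def)
      define u' where "u' = (?g ^^ n) u"
      have "?g u' = u" using n by (simp add: u'_def funpow_swap1)
      moreover have "u' \<in> V1"
      proof (cases n)
        case (Suc m)
        then have "u' = ?g ((?g ^^ m) u)" by (simp add: u'_def)
        then show ?thesis using nx1_V1 by metis
      qed (use u in \<open>simp add: u'_def\<close>)
      moreover have "reaches ?g u' u" unfolding reaches_def u'_def by blast
      then have "reaches ?g u' x" if "x \<in> V1" for x
        using d that by (intro reaches_trans[of ?g u x u']) (auto simp: rooted_def)
      ultimately have "d \<in> ?R u'" using d by (simp add: rooted_def)
      then show "d \<in> (\<Union>u'\<in>V1. ?R u')" using \<open>u' \<in> V1\<close> by (rule UN_I[rotated])
    qed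
    show "(\<Union>u'\<in>V1. ?R u') \<subseteq> rooted u"
    proof
      fix d assume "d \<in> (\<Union>u'\<in>V1. ?R u')"
      then obtain u' where u': "u' \<in> V1" "d \<in> rooted u'" "nx1 d u' = u" by blast
      have "reaches (nx1 d) u u'" unfolding reaches_def using u'(3) by (intro exI[of _ 1]) simp
      then have "reaches (nx1 d) u x" if "x \<in> V1" for x
        using u'(2) that by (intro reaches_trans[of "nx1 d" u' x u]) (auto simp: rooted_def)
      then show "d \<in> rooted u" using u'(2) by (simp add: rooted_def)
    qed
  qed
  have "4 * card (trees u) = card (rooted u)"
  proof -
    have "{d \<in> rooted u. d u \<in> axis_steps} = rooted u" using u by (auto simp: rooted_def)
    then show ?thesis using card_rooted[of u axis_steps] u by (simp add: axis_steps_def)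
  qed
  also have "\<dots> = (\<Sum>u'\<in>V1. card (?R u'))"
    unfolding un
  proof (rule card_UN_disjoint)
    show "finite V1" "\<forall>i\<in>V1. finite (?R i)" using finC by simp_all
    show "\<forall>i\<in>V1. \<forall>j\<in>V1. i \<noteq> j \<longrightarrow> ?R i \<inter> ?R j = {}"
    proof (intro ballI impI, rule ccontr)
      fix i j assume ij: "i \<in> V1" "j \<in> V1" "i \<noteq> j" "?R i \<inter> ?R j \<noteq> {}"
      then obtain d where "d \<in> rooted i" "d \<in> rooted j" "nx1 d i = u" "nx1 d j = u" by blast
      moreover have "u \<in> V1" using u by blast
      ultimately show False using unique_last_before[of "nx1 d" i u j] ij(3) unfolding rooted_def by blast
    qed
  qed
  also have "\<dots> = (\<Sum>u'\<in>V1. of_bool (u - u' \<in> lattice2_steps) * card (trees u'))"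
  proof (rule sum.cong[OF refl])
    fix u' assume u': "u' \<in> V1"
    \<comment> \<open>Contraction never lands in \<open>C\<close>, so \<open>u'\<close> precedes
      \<open>u\<close> by a genuine lattice step. For \<open>u' = f\<close> this produces the vector
      \<open>b\<close>.\<close>
    have "nx1 d u' = u \<longleftrightarrow> u' + d u' + d u' = u" for d
      using u fC by (auto simp: nx1_def ct_def)
    then have "?R u' = {d \<in> rooted u'. d u' \<in> {t \<in> axis_steps. u' + t + t = u}}"
      using u' by (auto simp: rooted_def)
    then show "card (?R u') = of_bool (u - u' \<in> lattice2_steps) * card (trees u')"
      using card_rooted[OF u', of "{t \<in> axis_steps. u' + t + t = u}"] card_steps_between[of u' u] by simp
  qed
  finally show ?thesis .
qed

text \<open>Stepping to the right everywhere eventually leaves the finite set \<open>C\<close>, and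
  thus arrives at \<open>f\<close>.\<close>

lemma trees_f_nonempty: "trees f \<noteq> {}"
proof -
  define d where "d = restrict (\<lambda>_. (1, 0) :: pt) C"
  obtain p :: pt where p: "\<forall>e\<in>C. fst e < fst p" using far_face[OF finC] by blast
  have "reaches (nx1 d) f u" if "u \<in> V1" for u
    using that
  proof (induction "nat (fst p - fst u)" arbitrary: u rule: less_induct)
    case less
    show ?case
    proof (cases "u = f")
      case False
      then have uC: "u \<in> C" using less.prems by blast
      have n: "nx1 d u = ct (u + (1,0) + (1,0))" using uC by (simp add: nx1_def d_def)
      have "reaches (nx1 d) f (nx1 d u)"
      proof (cases "nx1 d u = f")
        case False
        then have eq: "nx1 d u = u + (1,0) + (1,0)" unfolding n ct_def by presburger
        have "fst u < fst p" using p uC by blast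
        then show ?thesis using less.hyps[of "nx1 d u"] nx1_V1[of d u] eq by (cases u) simp
      qed simp
      then show ?thesis using reaches_step[OF False] by blast
    qed simp
  qed
  moreover have "V1 - {f} = C" using fC by auto
  ultimately have "d \<in> trees f" by (auto simp: trees_def d_def axis_steps_def)
  then show ?thesis by blast
qed

lemma card_trees_f_pos: "card (trees f) > 0"
  using trees_f_nonempty by (simp add: card_gt_0_iff)

section \<open>The linear system for the tree counts\<close>

lemma sum_A_entry:
  fixes q :: "pt \<Rightarrow> real"
  assumes u: "u \<in> C"
  shows "(\<Sum>u'\<in>C. A_entry u u' * q u') = 4 * q u - (\<Sum>u'\<in>C. of_bool (u' - u \<in> lattice2_steps) * q u')"
proof -
  have "A_entry u u' * q u' = (if u' = u then 4 * q u else 0) - of_bool (u' - u \<in> lattice2_steps) * q u'" for u'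
    by (auto simp: A_entry_def pdiff_eq_minus lattice2_steps_def zero_prod_def)
  then have "(\<Sum>u'\<in>C. A_entry u u' * q u') =
      (\<Sum>u'\<in>C. (if u' = u then 4 * q u else 0)) - (\<Sum>u'\<in>C. of_bool (u' - u \<in> lattice2_steps) * q u')"
    by (simp only: sum_subtractf)
  then show ?thesis using u finC by (simp add: sum.delta)
qed

text \<open>The maximum principle, at a rightmost point of maximal modulus.\<close>
lemma A_injective:
  fixes r :: "pt \<Rightarrow> real"
  assumes r: "\<And>u. u \<in> C \<Longrightarrow> (\<Sum>u'\<in>C. A_entry u u' * r u') = 0" and u: "u \<in> C"
  shows "r u = 0"
proof (rule ccontr)
  assume ru: "r u \<noteq> 0"
  define M where "M = Max ((\<lambda>u. \<bar>r u\<bar>) ` C)"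
  have M: "\<bar>r x\<bar> \<le> M" if "x \<in> C" for x unfolding M_def using that finC by (intro Max_ge) auto
  have "M \<in> (\<lambda>u. \<bar>r u\<bar>) ` C" unfolding M_def using finC u by (intro Max_in) auto
  then have ne: "{x \<in> C. \<bar>r x\<bar> = M} \<noteq> {}" by auto
  define m where "m = Max (fst ` {x \<in> C. \<bar>r x\<bar> = M})"
  have fin: "finite (fst ` {x \<in> C. \<bar>r x\<bar> = M})" using finC by simp
  have "m \<in> fst ` {x \<in> C. \<bar>r x\<bar> = M}" unfolding m_def using ne fin by (intro Max_in) auto
  then obtain z where z: "z \<in> C" "\<bar>r z\<bar> = M" "fst z = m" by auto
  have M0: "M > 0" using M[OF u] ru by linarith
  \<comment> \<open>Extension by 0 makes the sum run over all four neighbours, and absent neighbours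
    obey the same bound \<open>M\<close>.\<close>
  define q where "q x = (if x \<in> C then r x else 0)" for x
  have qM: "\<bar>q x\<bar> \<le> M" for x using M[of x] M0 by (auto simp: q_def)
  have "\<bar>q (z + (2,0))\<bar> < M"
  proof (rule ccontr)
    assume "\<not> \<bar>q (z + (2,0))\<bar> < M"
    then have "\<bar>q (z + (2,0))\<bar> = M" using qM[of "z + (2,0)"] by simp
    then have "z + (2,0) \<in> {x \<in> C. \<bar>r x\<bar> = M}" using M0 by (auto simp: q_def split: if_splits)
    then have "fst (z + (2,0)) \<le> m" unfolding m_def by (intro Max_ge[OF fin] imageI)
    then show False using z(3) by simp
  qed
  moreover have "4 * r z = q (z + (2,0)) + q (z + (-2,0)) + q (z + (0,2)) + q (z + (0,-2))"
  proof -
    have "4 * r z = (\<Sum>u'\<in>C. of_bool (u' - z \<in> lattice2_steps) * r u')"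
      using r[OF z(1)] sum_A_entry[OF z(1), of r] by simp
    also have "\<dots> = (\<Sum>u'\<in>C \<inter> (\<lambda>s. z + s) ` lattice2_steps. q u')"
    proof -
      have "u' - z \<in> lattice2_steps \<longleftrightarrow> u' \<in> (\<lambda>s. z + s) ` lattice2_steps" for u'
        by (auto simp: image_iff intro!: bexI[of _ "u' - z"])
      then show ?thesis
        unfolding sum.inter_restrict[OF finC] by (intro sum.cong) (simp_all add: q_def)
    qed
    also have "\<dots> = (\<Sum>u'\<in>(\<lambda>s. z + s) ` lattice2_steps. q u')"
      by (rule sum.mono_neutral_left) (auto simp: lattice2_steps_def q_def)
    also have "\<dots> = (\<Sum>s\<in>lattice2_steps. q (z + s))" by (subst sum.reindex) auto
    also have "\<dots> = q (z + (2,0)) + q (z + (-2,0)) + q (z + (0,2)) + q (z + (0,-2))"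
      by (simp add: lattice2_steps_def)
    finally show ?thesis .
  qed
  ultimately show False using z(2) qM[of "z + (-2,0)"] qM[of "z + (0,2)"] qM[of "z + (0,-2)"] by linarith
qed

lemma p_eq_trees:
  fixes p :: "pt \<Rightarrow> real"
  assumes p: "\<forall>u\<in>C. (\<Sum>u'\<in>C. A_entry u u' * p u') = b_entry f u" and pf: "p f = 1" and u: "u \<in> V1"
  shows "real (card (trees u)) = p u * real (card (trees f))"
proof (cases "u = f")
  case False
  then have uC: "u \<in> C" using u by blast
  define D where "D u = real (card (trees u))" for u
  define r where "r u = D u - p u * D f" for u
  have "(\<Sum>u'\<in>C. A_entry u u' * r u') = 0" if uC: "u \<in> C" for u
  proof -
    have "real (4 * card (trees u)) = (\<Sum>u'\<in>V1. of_bool (u - u' \<in> lattice2_steps) * D u')"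
      unfolding trees_balance[OF uC] D_def by simp
    also have "\<dots> = of_bool (u - f \<in> lattice2_steps) * D f + (\<Sum>u'\<in>C. of_bool (u - u' \<in> lattice2_steps) * D u')"
      using finC fC by (simp add: sum.insert)
    also have "(\<Sum>u'\<in>C. of_bool (u - u' \<in> lattice2_steps) * D u') = (\<Sum>u'\<in>C. of_bool (u' - u \<in> lattice2_steps) * D u')"
    proof (rule sum.cong[OF refl])
      show "of_bool (u - u' \<in> lattice2_steps) * D u' = of_bool (u' - u \<in> lattice2_steps) * D u'" for u'
        by (cases u; cases u') (auto simp: lattice2_steps_def)
    qed
    finally have "4 * D u = of_bool (u - f \<in> lattice2_steps) * D f + (\<Sum>u'\<in>C. of_bool (u' - u \<in> lattice2_steps) * D u')"
      by (simp add: D_def)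
    moreover have "of_bool (u - f \<in> lattice2_steps) = b_entry f u"
      unfolding b_entry_def pdiff_eq_minus by (cases u; cases f) (auto simp: lattice2_steps_def)
    ultimately have "(\<Sum>u'\<in>C. A_entry u u' * D u') = b_entry f u * D f"
      using sum_A_entry[OF uC, of D] by simp
    moreover have "(\<Sum>u'\<in>C. A_entry u u' * r u') = (\<Sum>u'\<in>C. A_entry u u' * D u') - (\<Sum>u'\<in>C. A_entry u u' * p u') * D f"
      unfolding r_def sum_distrib_right sum_subtractf[symmetric]
      by (intro sum.cong) (simp_all add: right_diff_distrib)
    ultimately show ?thesis using p uC by simp
  qed
  from A_injective[OF this uC] show ?thesis by (simp add: r_def D_def)
qed (use pf in simp)

end

section \<open>Dimer coverings of the graph\<close>

lemma uminus_diag [simp]: "- s \<in> diag_steps \<longleftrightarrow> s \<in> diag_steps"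
  by (cases s) (auto simp: diag_steps_def)

lemma Gamma_adj_sym: "Gamma_adj v w \<longleftrightarrow> Gamma_adj w v"
  using uminus_axis[of "v - w"] uminus_diag[of "v - w"] by (auto simp: Gamma_adj_def pdiff_eq_minus)

lemma W01_white: "x \<in> W0 \<or> x \<in> W1 \<longleftrightarrow> white x \<and> (even (fst x) \<longleftrightarrow> even (snd x))"
  by (auto simp: W0_def W1_def white_def)

text \<open>A covering is handled as the involution \<open>m\<close> that exchanges the two ends of
  each dimer.\<close>

lemma dimer_partner:
  assumes M: "dimer_covering S M"
  shows "\<exists>m. (\<forall>z\<in>S. {z, m z} \<in> M \<and> m z \<in> S \<and> Gamma_adj z (m z) \<and> m (m z) = z) \<and>
             (\<forall>e\<in>M. \<exists>z\<in>S. e = {z, m z})"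
proof -
  have ex: "\<exists>y. {z, y} \<in> M \<and> y \<in> S \<and> Gamma_adj z y" if z: "z \<in> S" for z
  proof -
    obtain e where e: "e \<in> M" "z \<in> e" using M z unfolding dimer_covering_def by blast
    then obtain a b where ab: "e = {a, b}" "a \<in> S" "b \<in> S" "Gamma_adj a b"
      using M unfolding dimer_covering_def induced_edges_def by blast
    then show ?thesis using e Gamma_adj_sym by (metis doubleton_eq_iff insertE singletonD)
  qed
  then obtain m where m: "\<And>z. z \<in> S \<Longrightarrow> {z, m z} \<in> M \<and> m z \<in> S \<and> Gamma_adj z (m z)" by metis
  have uniq: "y = y'" if "z \<in> S" "{z, y} \<in> M" "{z, y'} \<in> M" for z y y'
  proof -
    have "{z, y} = {z, y'}" using M that unfolding dimer_covering_def by blast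
    then show ?thesis by (metis doubleton_eq_iff)
  qed
  have "m (m z) = z" if z: "z \<in> S" for z
    using uniq[of "m z" "m (m z)" z] m[OF z] m[of "m z"] by (simp add: insert_commute)
  moreover have "\<exists>z\<in>S. e = {z, m z}" if e: "e \<in> M" for e
  proof -
    obtain a b where ab: "e = {a, b}" "a \<in> S" "b \<in> S" "Gamma_adj a b"
      using M e unfolding dimer_covering_def induced_edges_def by blast
    then have "b = m a" using uniq[of a b "m a"] e m by blast
    then show ?thesis using ab by blast
  qed
  ultimately show ?thesis using m by blast
qed

context temperley
begin

abbreviation "G \<equiv> VG C f"
abbreviation "Wh \<equiv> V0 \<union> V1"

lemma G_split: "G = Wh \<union> E"
  by (auto simp: VG_def)

lemma Wh_W: "x \<in> Wh \<Longrightarrow> x \<in> W0 \<union> W1"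
  using V0_W0 V1_W1 by blast

lemma Wh_E_disj: "Wh \<inter> E = {}"
  using Wh_W E_not by blast

lemma finite_G [simp]: "finite G"
  unfolding G_split using finC by simp

lemma adj_black:
  assumes "b \<in> E" "z \<in> G" "Gamma_adj z b"
  shows "z \<in> Wh \<and> b - z \<in> axis_steps"
proof -
  have "\<not> white b" using E_parity[OF assms(1)] by (auto simp: white_def)
  then have ax: "z - b \<in> axis_steps" using assms(3) by (auto simp: Gamma_adj_def pdiff_eq_minus)
  have "z \<notin> E"
  proof
    assume "z \<in> E"
    then have "odd (fst z + snd z)" "odd (fst b + snd b)" using E_parity assms(1) by blast+
    moreover define s where "s = z - b"
    have "odd (fst s + snd s)" using ax unfolding s_def[symmetric] by (auto simp: axis_steps_def)
    moreover have "fst z = fst b + fst s" "snd z = snd b + snd s" by (simp_all add: s_def)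
    ultimately show False by presburger
  qed
  moreover have "b - z \<in> axis_steps" using uminus_axis[of "z - b"] ax by simp
  ultimately show ?thesis using assms(2) G_split by blast
qed

lemma adj_white:
  assumes "x \<in> Wh" "y \<in> Wh" "Gamma_adj x y"
  shows "x \<in> V1 \<and> y \<in> V0 \<and> x - y \<in> diag_steps \<or> y \<in> V1 \<and> x \<in> V0 \<and> y - x \<in> diag_steps"
proof -
  have W: "x \<in> W0 \<union> W1" "y \<in> W0 \<union> W1" using assms Wh_W by blast+
  have "x - y \<notin> axis_steps"
  proof
    assume "x - y \<in> axis_steps"
    from W0_axis_one[OF W(2) this] show False using W(1) by auto
  qed
  then have d: "x - y \<in> diag_steps" using assms(3) by (auto simp: Gamma_adj_def pdiff_eq_minus)
  then have d': "y - x \<in> diag_steps" by (cases x; cases y) (auto simp: diag_steps_def)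
  have "x \<in> W0 \<longleftrightarrow> y \<in> W1" "y \<in> W0 \<longleftrightarrow> x \<in> W1" using W0_diag[OF d, of y] W0_diag[OF d', of x] by simp_all
  then show ?thesis using assms(1,2) d d' V0_W0 V1_W1 W0_W1_disjoint by blast
qed

lemma impurity_pair_exists: "\<exists>w\<in>V0. f - w \<in> diag_steps \<and> Cov f w \<noteq> {}"
proof -
  obtain w where w: "w \<in> V0" "f - w \<in> diag_steps" using corner_f by blast
  then have "card (Cov f w) > 0" using card_Cov[of f w] card_trees_f_pos by simp
  then show ?thesis using w by (auto simp: card_gt_0_iff)
qed

text \<open>A single covering does the counting: one with its impurity at \<open>f\<close> exists
  because \<open>trees f\<close> is nonempty, and it matches all white vertices but two with the
  midpoints.\<close>

lemma euler: "card Wh = card E + 2"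
proof -
  obtain w s where w: "w \<in> V0" "s \<in> Cov f w" using impurity_pair_exists by blast
  then have "card (Wh - {f, w}) = card E" unfolding Cov_def by (auto dest: bij_betw_same_card)
  moreover have "card (Wh - {f, w}) = card Wh - card {f, w}"
    using w finC by (intro card_Diff_subset) auto
  moreover have "card {f, w} \<le> card Wh"
    using w finC by (intro card_mono) auto
  moreover have "f \<noteq> w" using w V01_disj by blast
  then have "card {f, w} = 2" by simp
  ultimately show ?thesis by linarith
qed

text \<open>Every midpoint has a white partner, so by \<open>euler\<close> just two white vertices
  remain for each other. This is why a covering has exactly one impurity.\<close>

lemma unpaired_whites:
  assumes m: "\<And>z. z \<in> G \<Longrightarrow> m z \<in> G \<and> Gamma_adj z (m z) \<and> m (m z) = z"
  shows "card {x \<in> Wh. m x \<in> Wh} = 2" "bij_betw m (Wh - {x \<in> Wh. m x \<in> Wh}) E"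
proof -
  let ?Q = "{x \<in> Wh. m x \<in> Wh}"
  show bij: "bij_betw m (Wh - ?Q) E"
  proof (rule bij_betw_byWitness[where f' = m])
    show "m ` (Wh - ?Q) \<subseteq> E"
    proof
      fix b assume "b \<in> m ` (Wh - ?Q)"
      then obtain x where "x \<in> Wh" "m x \<notin> Wh" "b = m x" by blast
      then show "b \<in> E" using m[of x] G_split by blast
    qed
    show "m ` E \<subseteq> Wh - ?Q"
    proof
      fix x assume "x \<in> m ` E"
      then obtain b where b: "b \<in> E" "x = m b" by blast
      have bG: "b \<in> G" using b G_split by blast
      have "Gamma_adj x b" using m[OF bG] b(2) Gamma_adj_sym by blast
      then have "x \<in> Wh" using adj_black[OF b(1)] m[OF bG] b(2) by blast
      moreover have "m x = b" using m[OF bG] b(2) by simp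
      ultimately show "x \<in> Wh - ?Q" using b(1) Wh_E_disj by blast
    qed
  qed (use m G_split in auto)
  have fin: "finite Wh" using finC by simp
  have "card (Wh - ?Q) = card E" using bij by (rule bij_betw_same_card)
  moreover have "card (Wh - ?Q) = card Wh - card ?Q"
    by (intro card_Diff_subset finite_subset[OF _ fin]) auto
  moreover have "card ?Q \<le> card Wh" by (intro card_mono fin) auto
  ultimately show "card ?Q = 2" using euler by linarith
qed

definition dimers :: "pt set set set" where
  "dimers = {M. dimer_covering G M}"

definition impurities :: "(pt \<times> pt) set" where
  "impurities = {(v, w). v \<in> V1 \<and> w \<in> V0 \<and> v - w \<in> diag_steps}"

lemma finite_dimers [simp]: "finite dimers"
proof -
  have "dimers \<subseteq> Pow (Pow G)" unfolding dimers_def dimer_covering_def induced_edges_def by auto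
  then show ?thesis by (rule finite_subset) simp
qed

lemma card_dimers_impurity:
  assumes v: "v \<in> V1" and w: "w \<in> V0" and vw: "v - w \<in> diag_steps"
  shows "card {M \<in> dimers. {v, w} \<in> M} = card (Cov v w)"
proof -
  define \<Phi> where "\<Phi> s = insert {v, w} ((\<lambda>x. {x, x + s x}) ` (Wh - {v, w}))" for s :: "pt \<Rightarrow> pt"
  have notE: "v \<notin> E" "w \<notin> E" using v w Wh_E_disj by blast+
  have dim: "dimer_covering G (\<Phi> s)" if s: "s \<in> Cov v w" for s
    unfolding dimer_covering_def
  proof
    have bE: "x + s x \<in> E" "s x \<in> axis_steps" if "x \<in> Wh - {v, w}" for x
      using Cov_D[OF s, of x] that by auto
    show "\<Phi> s \<subseteq> induced_edges G"
    proof
      fix e assume "e \<in> \<Phi> s"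
      then consider "e = {v, w}" | x where "x \<in> Wh - {v, w}" "e = {x, x + s x}" by (auto simp: \<Phi>_def)
      then show "e \<in> induced_edges G"
      proof cases
        case 1
        have "white v" "white w" using v w V0_W0 V1_W1 W01_white by blast+
        then have "Gamma_adj v w" using vw by (simp add: Gamma_adj_def pdiff_eq_minus)
        then show ?thesis using 1 v w G_split unfolding induced_edges_def by blast
      next
        case 2
        have "Gamma_adj (x + s x) x" using bE[OF 2(1)] by (simp add: Gamma_adj_def pdiff_eq_minus)
        then show ?thesis using 2 bE[OF 2(1)] G_split Gamma_adj_sym unfolding induced_edges_def by blast
      qed
    qed
    show "\<forall>z\<in>G. \<exists>!e. e \<in> \<Phi> s \<and> z \<in> e"
    proof
      fix z assume "z \<in> G"
      then consider "z = v \<or> z = w" | "z \<in> Wh - {v, w}" | "z \<in> E" using G_split by blast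
      then show "\<exists>!e. e \<in> \<Phi> s \<and> z \<in> e"
      proof cases
        case 1
        have zE: "z \<notin> E" using 1 notE by blast
        show ?thesis
        proof (rule ex1I[of _ "{v, w}"])
          fix e assume e: "e \<in> \<Phi> s \<and> z \<in> e"
          show "e = {v, w}"
          proof (rule ccontr)
            assume "e \<noteq> {v, w}"
            then obtain x where x: "x \<in> Wh - {v, w}" "e = {x, x + s x}" using e by (auto simp: \<Phi>_def)
            then show False using e 1 zE bE[OF x(1)] by auto
          qed
        qed (use 1 in \<open>auto simp: \<Phi>_def\<close>)
      next
        case 2
        show ?thesis
        proof (rule ex1I[of _ "{z, z + s z}"])
          fix e assume e: "e \<in> \<Phi> s \<and> z \<in> e"
          then obtain x where x: "x \<in> Wh - {v, w}" "e = {x, x + s x}" using 2 by (auto simp: \<Phi>_def)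
          moreover have "z \<noteq> x + s x" using bE[OF x(1)] 2 Wh_E_disj by blast
          ultimately show "e = {z, z + s z}" using e by auto
        qed (use 2 in \<open>auto simp: \<Phi>_def\<close>)
      next
        case 3
        from Cov_surj[OF s 3] obtain x where x: "x \<in> V0 \<union> V1" "x \<noteq> v" "x \<noteq> w" "z = x + s x" "s x \<in> axis_steps" .
        show ?thesis
        proof (rule ex1I[of _ "{x, x + s x}"])
          fix e assume e: "e \<in> \<Phi> s \<and> z \<in> e"
          have "e \<noteq> {v, w}" using e 3 notE by auto
          then obtain y where y: "y \<in> Wh - {v, w}" "e = {y, y + s y}" using e by (auto simp: \<Phi>_def)
          have "z = y + s y" using e y 3 Wh_E_disj by blast
          then have "x = y" using Cov_inj[OF s, of x y] x y by auto
          then show "e = {x, x + s x}" using y by simp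
        qed (use x in \<open>auto simp: \<Phi>_def\<close>)
      qed
    qed
  qed
  have "bij_betw \<Phi> (Cov v w) {M \<in> dimers. {v, w} \<in> M}"
    unfolding bij_betw_def
  proof
    show "inj_on \<Phi> (Cov v w)"
    proof (rule inj_onI)
      fix s s' assume s: "s \<in> Cov v w" and s': "s' \<in> Cov v w" and eq: "\<Phi> s = \<Phi> s'"
      have "s x = s' x" if x: "x \<in> Wh - {v, w}" for x
      proof -
        have "{x, x + t x} \<in> \<Phi> t" for t using x unfolding \<Phi>_def by blast
        from this[of s] this[of s'] have "{x, x + s x} \<in> \<Phi> s" "{x, x + s' x} \<in> \<Phi> s" unfolding eq .
        moreover have "x \<in> G" using x G_split by blast
        ultimately have "{x, x + s x} = {x, x + s' x}" using dim[OF s] unfolding dimer_covering_def by blast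
        then show ?thesis by (metis add_left_cancel doubleton_eq_iff)
      qed
      moreover have "s \<in> Pi\<^sub>E (Wh - {v, w}) (\<lambda>_. axis_steps)" "s' \<in> Pi\<^sub>E (Wh - {v, w}) (\<lambda>_. axis_steps)"
        using s s' unfolding Cov_def by blast+
      ultimately show "s = s'" by (intro PiE_ext)
    qed
    show "\<Phi> ` Cov v w = {M \<in> dimers. {v, w} \<in> M}"
    proof
      show "\<Phi> ` Cov v w \<subseteq> {M \<in> dimers. {v, w} \<in> M}"
        using dim by (auto simp: dimers_def \<Phi>_def)
      show "{M \<in> dimers. {v, w} \<in> M} \<subseteq> \<Phi> ` Cov v w"
      proof
        fix M assume "M \<in> {M \<in> dimers. {v, w} \<in> M}"
        then have M: "dimer_covering G M" "{v, w} \<in> M" by (auto simp: dimers_def)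
        obtain m where m: "\<And>z. z \<in> G \<Longrightarrow> {z, m z} \<in> M \<and> m z \<in> G \<and> Gamma_adj z (m z) \<and> m (m z) = z"
            "\<And>e. e \<in> M \<Longrightarrow> \<exists>z\<in>G. e = {z, m z}"
          using dimer_partner[OF M(1)] by blast
        have m': "\<And>z. z \<in> G \<Longrightarrow> m z \<in> G \<and> Gamma_adj z (m z) \<and> m (m z) = z" using m(1) by blast
        let ?Q = "{x \<in> Wh. m x \<in> Wh}"
        have ne: "v \<noteq> w" using v w V01_disj by blast
        obtain z where z: "z \<in> G" "{v, w} = {z, m z}" using m(2)[OF M(2)] by blast
        then have mvw: "m v = w \<and> m w = v" using m(1)[OF z(1)] by (metis doubleton_eq_iff)
        then have sub: "{v, w} \<subseteq> ?Q" using v w by auto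
        \<comment> \<open>The impurity already accounts for both white vertices matched to white
          ones, so all others are matched to midpoints and \<open>m x - x\<close> is an axis
          step.\<close>
        have Q: "?Q = {v, w}"
        proof (rule card_subset_eq[symmetric, OF _ sub])
          show "finite ?Q" using finC by simp
          show "card {v, w} = card ?Q" using unpaired_whites(1)[OF m'] ne by simp
        qed
        have bij: "bij_betw m (Wh - {v, w}) E" using unpaired_whites(2)[OF m'] unfolding Q .
        define s where "s = restrict (\<lambda>x. m x - x) (Wh - {v, w})"
        have sm: "x + s x = m x" if "x \<in> Wh - {v, w}" for x using that by (simp add: s_def)
        have "s x \<in> axis_steps" if x: "x \<in> Wh - {v, w}" for x
        proof -
          have xG: "x \<in> G" using x G_split by blast
          have "m x \<in> E" using bij x by (auto simp: bij_betw_def)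
          from adj_black[OF this xG] show ?thesis using m(1)[OF xG] x by (simp add: s_def)
        qed
        then have "s \<in> Pi\<^sub>E (Wh - {v, w}) (\<lambda>_. axis_steps)" unfolding s_def by (auto intro!: PiE_I)
        moreover have "bij_betw (\<lambda>x. x + s x) (Wh - {v, w}) E"
          using bij by (subst bij_betw_cong[OF sm])
        ultimately have s: "s \<in> Cov v w" by (simp add: Cov_def)
        have "M = \<Phi> s"
        proof
          show "M \<subseteq> \<Phi> s"
          proof
            fix e assume "e \<in> M"
            then obtain z where z: "z \<in> G" "e = {z, m z}" using m(2) by blast
            then consider "z = v \<or> z = w" | "z \<in> Wh - {v, w}" | "z \<in> E" using G_split by blast
            then show "e \<in> \<Phi> s"
            proof cases
              case 1
              then have "e = {v, w}" using z mvw by auto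
              then show ?thesis by (simp add: \<Phi>_def)
            next
              case 2
              then have "e = {z, z + s z}" using z(2) sm by simp
              then show ?thesis using 2 unfolding \<Phi>_def by blast
            next
              case 3
              then obtain x where x: "x \<in> Wh - {v, w}" "z = m x" using bij unfolding bij_betw_def by blast
              have "m z = x" using x m(1)[of x] G_split by blast
              then have "e = {x, x + s x}" using z x sm[OF x(1)] by auto
              then show ?thesis using x(1) unfolding \<Phi>_def by blast
            qed
          qed
          show "\<Phi> s \<subseteq> M"
            using M(2) m(1) G_split sm unfolding \<Phi>_def by auto
        qed
        then show "M \<in> \<Phi> ` Cov v w" using s by blast
      qed
    qed
  qed
  then show ?thesis by (rule bij_betw_same_card[symmetric])
qed

lemma dimers_split: "dimers = (\<Union>(v, w)\<in>impurities. {M \<in> dimers. {v, w} \<in> M})"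
proof
  show "dimers \<subseteq> (\<Union>(v, w)\<in>impurities. {M \<in> dimers. {v, w} \<in> M})"
  proof
    fix M assume M: "M \<in> dimers"
    then have D: "dimer_covering G M" by (simp add: dimers_def)
    then obtain m where m: "\<And>z. z \<in> G \<Longrightarrow> {z, m z} \<in> M \<and> m z \<in> G \<and> Gamma_adj z (m z) \<and> m (m z) = z"
      using dimer_partner[OF D] by blast
    then have m': "\<And>z. z \<in> G \<Longrightarrow> m z \<in> G \<and> Gamma_adj z (m z) \<and> m (m z) = z" by blast
    have "{x \<in> Wh. m x \<in> Wh} \<noteq> {}" using unpaired_whites(1)[OF m'] by (metis card.empty zero_neq_numeral)
    then obtain x where x: "x \<in> Wh" "m x \<in> Wh" by blast
    have xG: "x \<in> G" using x G_split by blast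
    from adj_white[OF x] m[OF xG] have "(x, m x) \<in> impurities \<or> (m x, x) \<in> impurities"
      by (auto simp: impurities_def)
    moreover have "{x, m x} \<in> M" "{m x, x} \<in> M" using m[OF xG] by (auto simp: insert_commute)
    ultimately show "M \<in> (\<Union>(v, w)\<in>impurities. {M \<in> dimers. {v, w} \<in> M})" using M by blast
  qed
qed auto

lemma impurity_unique:
  assumes M: "M \<in> dimers" and vw: "(v, w) \<in> impurities" "{v, w} \<in> M"
    and vw': "(v', w') \<in> impurities" "{v', w'} \<in> M"
  shows "(v, w) = (v', w')"
proof -
  have D: "dimer_covering G M" using M by (simp add: dimers_def)
  obtain m where m: "\<And>z. z \<in> G \<Longrightarrow> {z, m z} \<in> M \<and> m z \<in> G \<and> Gamma_adj z (m z) \<and> m (m z) = z"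
      "\<And>e. e \<in> M \<Longrightarrow> \<exists>z\<in>G. e = {z, m z}"
    using dimer_partner[OF D] by blast
  have m': "\<And>z. z \<in> G \<Longrightarrow> m z \<in> G \<and> Gamma_adj z (m z) \<and> m (m z) = z" using m(1) by blast
  have mvw: "{v, w} = {x \<in> Wh. m x \<in> Wh}" if h: "(v, w) \<in> impurities" "{v, w} \<in> M" for v w
  proof (rule card_subset_eq)
    have v: "v \<in> V1" "w \<in> V0" using h by (auto simp: impurities_def)
    then have "v \<noteq> w" using V01_disj by blast
    then show "card {v, w} = card {x \<in> Wh. m x \<in> Wh}" using unpaired_whites(1)[OF m'] by simp
    show "finite {x \<in> Wh. m x \<in> Wh}" using finC by simp
    obtain z where z: "z \<in> G" "{v, w} = {z, m z}" using m(2)[OF h(2)] by blast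
    then have "m v = w \<and> m w = v" using m(1)[OF z(1)] by (metis doubleton_eq_iff)
    then show "{v, w} \<subseteq> {x \<in> Wh. m x \<in> Wh}" using v by auto
  qed
  have "{v, w} = {v', w'}" using mvw[OF vw] mvw[OF vw'] by simp
  moreover have "v \<in> V1" "w \<in> V0" "v' \<in> V1" "w' \<in> V0" using vw vw' by (auto simp: impurities_def)
  ultimately show ?thesis using V01_disj by (metis IntI doubleton_eq_iff empty_iff)
qed

lemma corners_in_H: "u \<in> C \<Longrightarrow> card {w \<in> V0. u - w \<in> diag_steps} = 4"
proof -
  assume u: "u \<in> C"
  have "{w \<in> V0. u - w \<in> diag_steps} = (\<lambda>t. u + t) ` diag_steps"
  proof
    show "{w \<in> V0. u - w \<in> diag_steps} \<subseteq> (\<lambda>t. u + t) ` diag_steps"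
    proof
      fix w assume "w \<in> {w \<in> V0. u - w \<in> diag_steps}"
      then have "w - u \<in> diag_steps" by (cases w; cases u) (auto simp: diag_steps_def)
      then show "w \<in> (\<lambda>t. u + t) ` diag_steps" by (intro image_eqI[of _ _ "w - u"]) auto
    qed
    show "(\<lambda>t. u + t) ` diag_steps \<subseteq> {w \<in> V0. u - w \<in> diag_steps}"
    proof
      fix w assume "w \<in> (\<lambda>t. u + t) ` diag_steps"
      then obtain t where t: "t \<in> diag_steps" "w = u + t" by blast
      have "- t \<in> diag_steps" using t(1) by (auto simp: diag_steps_def)
      moreover have "w + (- t) \<in> C" using t u by simp
      ultimately have "w \<in> V0" unfolding V0_iff by blast
      then show "w \<in> {w \<in> V0. u - w \<in> diag_steps}" using t \<open>- t \<in> diag_steps\<close> by simp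
    qed
  qed
  then show ?thesis by (simp add: card_image diag_steps_def)
qed

text \<open>Each covering has one impurity, and \<open>trees v\<close> is counted once for every
  corner of \<open>v\<close> in \<open>H\<close>.\<close>

lemma card_dimers:
  "card dimers = 4 * (\<Sum>u\<in>C. card (trees u)) + card {w \<in> V0. f - w \<in> diag_steps} * card (trees f)"
proof -
  have imp: "impurities = (SIGMA v:V1. {w \<in> V0. v - w \<in> diag_steps})" by (auto simp: impurities_def)
  have fin: "finite impurities" unfolding imp using finC by (intro finite_SigmaI) auto
  let ?D = "\<lambda>i. {M \<in> dimers. {fst i, snd i} \<in> M}"
  have "dimers = (\<Union>i\<in>impurities. ?D i)" using dimers_split by (simp add: case_prod_beta)
  then have "card dimers = card (\<Union>i\<in>impurities. ?D i)" by simp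
  also have "\<dots> = (\<Sum>i\<in>impurities. card (?D i))"
  proof (rule card_UN_disjoint[OF fin])
    show "\<forall>i\<in>impurities. finite (?D i)" by simp
    show "\<forall>i\<in>impurities. \<forall>j\<in>impurities. i \<noteq> j \<longrightarrow> ?D i \<inter> ?D j = {}"
    proof (intro ballI impI, rule ccontr)
      fix i j assume ij: "i \<in> impurities" "j \<in> impurities" "i \<noteq> j" "?D i \<inter> ?D j \<noteq> {}"
      then obtain M where "M \<in> dimers" "{fst i, snd i} \<in> M" "{fst j, snd j} \<in> M" by blast
      then show False using impurity_unique[of M "fst i" "snd i" "fst j" "snd j"] ij by simp
    qed
  qed
  also have "\<dots> = (\<Sum>(v, w)\<in>impurities. card (trees v))"
  proof (rule sum.cong[OF refl])
    fix i assume "i \<in> impurities"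
    then have "fst i \<in> V1" "snd i \<in> V0" "fst i - snd i \<in> diag_steps" by (auto simp: impurities_def)
    then show "card (?D i) = (case i of (v, w) \<Rightarrow> card (trees v))"
      using card_dimers_impurity card_Cov by (simp add: case_prod_beta)
  qed
  also have "\<dots> = (\<Sum>v\<in>V1. \<Sum>w\<in>{w \<in> V0. v - w \<in> diag_steps}. card (trees v))"
    unfolding imp using finC by (subst sum.Sigma) auto
  also have "\<dots> = (\<Sum>v\<in>V1. card {w \<in> V0. v - w \<in> diag_steps} * card (trees v))" by simp
  also have "\<dots> = card {w \<in> V0. f - w \<in> diag_steps} * card (trees f) +
      (\<Sum>u\<in>C. card {w \<in> V0. u - w \<in> diag_steps} * card (trees u))"
    using finC fC by simp
  also have "(\<Sum>u\<in>C. card {w \<in> V0. u - w \<in> diag_steps} * card (trees u)) = 4 * (\<Sum>u\<in>C. card (trees u))"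
    unfolding sum_distrib_left by (intro sum.cong) (simp_all add: corners_in_H)
  finally show ?thesis by simp
qed

end

section \<open>The corners of the outer vertex\<close>

text \<open>The \<open>e\<close> variables stand for the right, top, left and bottom sides of
  \<open>f\<close>, and \<open>c0\<close>, ..., \<open>c3\<close> for the corners following them
  counterclockwise. The hypotheses force the sides and corners present to form an arc, which has one
  vertex more than edges.\<close>

lemma cyclic_count:
  assumes "\<not> (e0 \<and> e1 \<and> e2 \<and> e3)" "c0 \<or> c1 \<or> c2 \<or> c3"
    and "e0 \<longrightarrow> c0 \<and> c3" "e1 \<longrightarrow> c1 \<and> c0" "e2 \<longrightarrow> c2 \<and> c1" "e3 \<longrightarrow> c3 \<and> c2"
    and "c3 \<and> c0 \<longrightarrow> e0 \<or> e1 \<and> e2 \<and> e3" "c0 \<and> c1 \<longrightarrow> e1 \<or> e0 \<and> e2 \<and> e3"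
    and "c1 \<and> c2 \<longrightarrow> e2 \<or> e0 \<and> e1 \<and> e3" "c2 \<and> c3 \<longrightarrow> e3 \<or> e0 \<and> e1 \<and> e2"
    and "c3 \<and> c1 \<longrightarrow> (e0 \<and> e1) \<or> (e2 \<and> e3)" "c0 \<and> c2 \<longrightarrow> (e1 \<and> e2) \<or> (e0 \<and> e3)"
  shows "of_bool c0 + of_bool c2 + of_bool c1 + of_bool c3 =
    of_bool e0 + of_bool e2 + of_bool e1 + of_bool e3 + (1 :: nat)"
  using assms unfolding of_bool_def by (simp split: if_splits) argo

context temperley
begin

lemma mid_split:
  assumes "odd (fst z + snd z)"
  shows "\<exists>t\<in>axis_steps. z + t \<in> W1 \<and> z - t \<in> W1 \<and> z + rot t \<in> W0 \<and> z - rot t \<in> W0"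
proof (cases "even (fst z)")
  case True
  then show ?thesis using assms
    by (intro bexI[of _ "(1,0)"]; cases z) (auto simp: axis_steps_def W0_def W1_def rot_def)
next
  case False
  then show ?thesis using assms
    by (intro bexI[of _ "(0,1)"]; cases z) (auto simp: axis_steps_def W0_def W1_def rot_def)
qed

text \<open>Every point of \<open>\<int>\<^sup>2\<close> outside \<open>G\<close> lies on the boundary of some face outside \<open>C\<close> other than
  \<open>f\<close>, and the faces of this kind around it are connected to one another.\<close>
lemma outer_faces_edge_connected:
  assumes conn: "induced_connected (- G)"
  shows "edge_connected (W1 - V1)"
  unfolding edge_connected_def
proof (intro allI impI subsetI)
  fix D b assume D: "edge_closed (W1 - V1) D" "D \<noteq> {}" and b: "b \<in> W1 - V1"
  obtain a where a: "a \<in> D" using D(2) by blast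
  have aW: "a \<in> W1 - V1" using a D(1) unfolding edge_closed_def by blast
  have Dstep: "u + t + t \<in> D" if "u \<in> D" "t \<in> axis_steps" "u + t + t \<in> W1 - V1" for u t
  proof -
    have "t + t \<in> lattice2_steps" using that(2) by (auto simp: axis_steps_def lattice2_steps_def)
    then show ?thesis using that D(1) unfolding edge_closed_def by (metis add.assoc)
  qed
  \<comment> \<open>The admissible squares touching \<open>z\<close>; they transfer connectedness
    from points outside \<open>G\<close> to squares.\<close>
  define nr where "nr z = {u \<in> W1 - V1. \<bar>fst u - fst z\<bar> \<le> 1 \<and> \<bar>snd u - snd z\<bar> \<le> 1}" for z :: pt
  have outG: "z \<notin> G \<Longrightarrow> z \<notin> V0 \<and> z \<notin> E \<and> z \<notin> V1" for z using G_split by blast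
  have nr_face: "nr u = {u}" if "u \<in> W1 - V1" for u
  proof
    show "nr u \<subseteq> {u}"
    proof
      fix z assume "z \<in> nr u"
      then have "z \<in> W1" "\<bar>fst z - fst u\<bar> \<le> 1" "\<bar>snd z - snd u\<bar> \<le> 1" by (auto simp: nr_def)
      moreover have "odd (fst u)" "odd (snd u)" using that by (auto simp: W1_def)
      moreover have "odd (fst z)" "odd (snd z)" using \<open>z \<in> W1\<close> by (auto simp: W1_def)
      ultimately have "fst z = fst u" "snd z = snd u" by presburger+
      then show "z \<in> {u}" by (simp add: prod_eq_iff)
    qed
    show "{u} \<subseteq> nr u" using that by (simp add: nr_def)
  qed
  have closed: "nr z \<subseteq> D" if z: "z \<notin> G" and zD: "nr z \<inter> D \<noteq> {}" for z
  proof -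
    obtain x y where xy: "z = (x, y)" by force
    consider "odd (x + y)" | "z \<in> W0" | "z \<in> W1" by (auto simp: xy W0_def W1_def)
    then show ?thesis
    proof cases
      case 1
      then obtain t where t: "t \<in> axis_steps" "z + t \<in> W1" "z - t \<in> W1" "z + rot t \<in> W0" "z - rot t \<in> W0"
        using mid_split[of z] by (auto simp: xy)
      have sub: "nr z \<subseteq> {z + t, z - t}"
      proof
        fix u assume "u \<in> nr z"
        then have u: "u \<in> W1" "\<bar>fst u - fst z\<bar> \<le> 1" "\<bar>snd u - snd z\<bar> \<le> 1" by (auto simp: nr_def)
        show "u \<in> {z + t, z - t}"
        proof (cases "even x")
          case True
          then have "odd y" using 1 by simp
          then have "snd u = y" "fst u = x + 1 \<or> fst u = x - 1" using u True unfolding xy W1_def by (simp; presburger)+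
          moreover have "t = (1,0) \<or> t = (-1,0)" using t \<open>odd y\<close> True by (auto simp: xy axis_steps_def W1_def)
          ultimately show ?thesis by (auto simp: xy prod_eq_iff)
        next
          case False
          then have "even y" using 1 by simp
          then have "fst u = x" "snd u = y + 1 \<or> snd u = y - 1" using u False unfolding xy W1_def by (simp; presburger)+
          moreover have "t = (0,1) \<or> t = (0,-1)" using t \<open>even y\<close> False by (auto simp: xy axis_steps_def W1_def)
          ultimately show ?thesis by (auto simp: xy prod_eq_iff)
        qed
      qed
      have "z - t + t + t = z + t" "z + t + - t + - t = z - t" by simp_all
      then have "z + t \<in> D \<Longrightarrow> z - t \<in> nr z \<Longrightarrow> z - t \<in> D" "z - t \<in> D \<Longrightarrow> z + t \<in> nr z \<Longrightarrow> z + t \<in> D"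
        using Dstep[of "z + t" "- t"] Dstep[of "z - t" t] t(1) unfolding nr_def by auto
      then show ?thesis using sub zD by blast
    next
      case 2
      then have ev: "even x" "even y" by (auto simp: xy W0_def)
      have C4: "z + s \<notin> C" if "s \<in> diag_steps" for s using outG[OF z] that V0_iff by blast
      have nC: "(x+1,y+1) \<notin> C" "(x-1,y+1) \<notin> C" "(x-1,y-1) \<notin> C" "(x+1,y-1) \<notin> C"
        using C4[of "(1,1)"] C4[of "(-1,1)"] C4[of "(-1,-1)"] C4[of "(1,-1)"] by (auto simp: xy diag_steps_def)
      have lx: "(a', b) \<in> D" if "(a, b) \<in> D" "(a', b) \<in> W1" "(a', b) \<notin> C" "(a', b) \<noteq> f" "a' = a + 2 \<or> a' = a - 2" for a a' b
        using that(5)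
      proof
        assume "a' = a + 2"
        then show ?thesis using Dstep[of "(a, b)" "(1,0)"] that(1-4) by (simp add: axis_steps_def add.commute)
      next
        assume "a' = a - 2"
        then show ?thesis using Dstep[of "(a, b)" "(-1,0)"] that(1-4) by (simp add: axis_steps_def add.commute)
      qed
      have ly: "(a, b') \<in> D" if "(a, b) \<in> D" "(a, b') \<in> W1" "(a, b') \<notin> C" "(a, b') \<noteq> f" "b' = b + 2 \<or> b' = b - 2" for a b b'
        using that(5)
      proof
        assume "b' = b + 2"
        then show ?thesis using Dstep[of "(a, b)" "(0,1)"] that(1-4) by (simp add: axis_steps_def add.commute)
      next
        assume "b' = b - 2"
        then show ?thesis using Dstep[of "(a, b)" "(0,-1)"] that(1-4) by (simp add: axis_steps_def add.commute)
      qed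
      have W: "(x+1,y+1) \<in> W1" "(x-1,y+1) \<in> W1" "(x-1,y-1) \<in> W1" "(x+1,y-1) \<in> W1"
        using ev by (auto simp: W1_def)
      have L: "(x+1,y+1) \<in> D \<Longrightarrow> (x-1,y+1) \<noteq> f \<Longrightarrow> (x-1,y+1) \<in> D"
        "(x+1,y+1) \<in> D \<Longrightarrow> (x+1,y-1) \<noteq> f \<Longrightarrow> (x+1,y-1) \<in> D"
        "(x-1,y+1) \<in> D \<Longrightarrow> (x+1,y+1) \<noteq> f \<Longrightarrow> (x+1,y+1) \<in> D"
        "(x-1,y+1) \<in> D \<Longrightarrow> (x-1,y-1) \<noteq> f \<Longrightarrow> (x-1,y-1) \<in> D"
        "(x-1,y-1) \<in> D \<Longrightarrow> (x+1,y-1) \<noteq> f \<Longrightarrow> (x+1,y-1) \<in> D"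
        "(x-1,y-1) \<in> D \<Longrightarrow> (x-1,y+1) \<noteq> f \<Longrightarrow> (x-1,y+1) \<in> D"
        "(x+1,y-1) \<in> D \<Longrightarrow> (x-1,y-1) \<noteq> f \<Longrightarrow> (x-1,y-1) \<in> D"
        "(x+1,y-1) \<in> D \<Longrightarrow> (x+1,y+1) \<noteq> f \<Longrightarrow> (x+1,y+1) \<in> D"
        subgoal by (rule lx[OF _ W(2) nC(2)], assumption, assumption, arith)
        subgoal by (rule ly[OF _ W(4) nC(4)], assumption, assumption, arith)
        subgoal by (rule lx[OF _ W(1) nC(1)], assumption, assumption, arith)
        subgoal by (rule ly[OF _ W(3) nC(3)], assumption, assumption, arith)
        subgoal by (rule lx[OF _ W(4) nC(4)], assumption, assumption, arith)
        subgoal by (rule ly[OF _ W(2) nC(2)], assumption, assumption, arith)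
        subgoal by (rule lx[OF _ W(3) nC(3)], assumption, assumption, arith)
        subgoal by (rule ly[OF _ W(1) nC(1)], assumption, assumption, arith)
        done
      have sub: "u = (x+1,y+1) \<or> u = (x-1,y+1) \<or> u = (x-1,y-1) \<or> u = (x+1,y-1)" if "u \<in> nr z" for u
      proof -
        have u: "odd (fst u)" "odd (snd u)" "\<bar>fst u - x\<bar> \<le> 1" "\<bar>snd u - y\<bar> \<le> 1" using that by (auto simp: nr_def W1_def xy)
        then have "fst u = x + 1 \<or> fst u = x - 1" "snd u = y + 1 \<or> snd u = y - 1" using ev by presburger+
        then show ?thesis by (auto simp: prod_eq_iff)
      qed
      obtain u0 where u0: "u0 \<in> nr z" "u0 \<in> D" using zD by blast
      \<comment> \<open>At most one of the four squares around \<open>z\<close> is \<open>f\<close>,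
        and the remaining ones still form a chain across sides.\<close>
      have "(x+1,y+1) \<noteq> f \<or> (x-1,y-1) \<noteq> f" "(x+1,y-1) \<noteq> f \<or> (x-1,y+1) \<noteq> f" by auto
      moreover have "(x+1,y+1) \<in> D \<or> (x-1,y+1) \<in> D \<or> (x-1,y-1) \<in> D \<or> (x+1,y-1) \<in> D"
        using sub[OF u0(1)] u0(2) by metis
      ultimately have all: "((x+1,y+1) \<noteq> f \<longrightarrow> (x+1,y+1) \<in> D) \<and> ((x-1,y+1) \<noteq> f \<longrightarrow> (x-1,y+1) \<in> D)
          \<and> ((x-1,y-1) \<noteq> f \<longrightarrow> (x-1,y-1) \<in> D) \<and> ((x+1,y-1) \<noteq> f \<longrightarrow> (x+1,y-1) \<in> D)"
        using L by argo
      show ?thesis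
      proof
        fix u assume u: "u \<in> nr z"
        then have "u \<noteq> f" by (auto simp: nr_def)
        with sub[OF u] all show "u \<in> D" by (elim disjE) simp_all
      qed
    next
      case 3
      then show ?thesis using nr_face[of z] outG[OF z] zD by auto
    qed
  qed
  have meet: "nr z \<inter> nr z' \<noteq> {}" if z: "z \<notin> G" "z' \<notin> G" and adj: "Gamma_adj z z'" for z z'
  proof -
    have close: "\<bar>fst z - fst z'\<bar> \<le> 1" "\<bar>snd z - snd z'\<bar> \<le> 1"
      using adj by (auto simp: Gamma_adj_def pdiff_def axis_steps_def diag_steps_def)
    \<comment> \<open>The squares on both sides of \<open>y + r\<close> lie outside
      \<open>C\<close>, and at most one of them is \<open>f\<close>; the other touches both
      \<open>y\<close> and \<open>y + r\<close>.\<close>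
    have key: "nr y \<inter> nr (y + r) \<noteq> {}" if y: "y \<in> W0" and r: "r \<in> axis_steps" and yr: "y + r \<notin> G" for y r
    proof -
      have W: "y + r + rot r \<in> W1" "y + r - rot r \<in> W1"
        using y r by (cases y; auto simp: axis_steps_def W0_def W1_def rot_def)+
      have "y + r \<notin> E" using outG[OF yr] by blast
      then have nC: "y + r + rot r \<notin> C" "y + r - rot r \<notin> C" using E_at_W0[OF y r] by blast+
      have near: "\<bar>fst r\<bar> \<le> 1 \<and> \<bar>snd r\<bar> \<le> 1 \<and> \<bar>fst (rot r)\<bar> \<le> 1 \<and> \<bar>snd (rot r)\<bar> \<le> 1
          \<and> \<bar>fst r + fst (rot r)\<bar> \<le> 1 \<and> \<bar>snd r + snd (rot r)\<bar> \<le> 1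
          \<and> \<bar>fst r - fst (rot r)\<bar> \<le> 1 \<and> \<bar>snd r - snd (rot r)\<bar> \<le> 1"
        using r by (auto simp: axis_steps_def rot_def)
      have "y + r + rot r \<noteq> f \<or> y + r - rot r \<noteq> f"
        using r by (cases y; cases f) (auto simp: axis_steps_def rot_def)
      then show ?thesis
      proof
        assume "y + r + rot r \<noteq> f"
        then have "y + r + rot r \<in> nr y \<inter> nr (y + r)" using W nC near by (simp add: nr_def)
        then show ?thesis by blast
      next
        assume "y + r - rot r \<noteq> f"
        then have "y + r - rot r \<in> nr y \<inter> nr (y + r)" using W nC near by (simp add: nr_def)
        then show ?thesis by blast
      qed
    qed
    consider "z \<in> W1" | "z' \<in> W1" | "z \<notin> W1" "z' \<notin> W1" by blast
    then show ?thesis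
    proof cases
      case 1
      then have "z \<in> nr z \<inter> nr z'" using outG[OF z(1)] close by (auto simp: nr_def)
      then show ?thesis by blast
    next
      case 2
      then have "z' \<in> nr z \<inter> nr z'" using outG[OF z(2)] close by (auto simp: nr_def)
      then show ?thesis by blast
    next
      case 3
      have "z - z' \<in> axis_steps"
      proof (rule ccontr)
        assume "z - z' \<notin> axis_steps"
        then have d: "white z" "z - z' \<in> diag_steps" using adj by (auto simp: Gamma_adj_def pdiff_eq_minus)
        then have "z \<in> W0" using 3(1) by (auto simp: white_def W0_def W1_def)
        then have "z' \<in> W1" using W0_diag[OF d(2), of z'] by simp
        then show False using 3(2) by blast
      qed
      then have ax: "z - z' \<in> axis_steps" "z' - z \<in> axis_steps" using uminus_axis[of "z - z'"] by simp_all
      have "z \<in> W0 \<or> z' \<in> W0"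
      proof (cases "even (fst z + snd z)")
        case True
        then show ?thesis using 3(1) by (auto simp: W0_def W1_def)
      next
        case False
        define r where "r = z' - z"
        have "odd (fst r + snd r)" using ax(2) unfolding r_def[symmetric] by (auto simp: axis_steps_def)
        moreover have "fst z' = fst z + fst r" "snd z' = snd z + snd r" by (simp_all add: r_def)
        ultimately have "even (fst z' + snd z')" using False by presburger
        then show ?thesis using 3(2) by (auto simp: W0_def W1_def)
      qed
      then show ?thesis using key[OF _ ax(2), of z] key[OF _ ax(1), of z'] z by auto
    qed
  qed
  have "(a, b) \<in> {(x, y). x \<in> - G \<and> y \<in> - G \<and> Gamma_adj x y}\<^sup>*"
  proof -
    have "a \<in> - G" "b \<in> - G" using aW b V0_W0 E_not W0_W1_disjoint unfolding G_split by blast+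
    then show ?thesis using conn unfolding induced_connected_def by blast
  qed
  then have "nr b \<subseteq> D"
  proof (induction rule: rtrancl_induct)
    case base
    show ?case using nr_face[OF aW] a by simp
  next
    case (step y z)
    then have "y \<notin> G" "z \<notin> G" "Gamma_adj y z" by auto
    from meet[OF this] step.IH have "nr z \<inter> D \<noteq> {}" by blast
    then show ?case using closed[OF \<open>z \<notin> G\<close>] by blast
  qed
  then show "b \<in> D" using nr_face[OF b] by blast
qed

lemma single_edge_degree:
  assumes "u \<in> W1" "t \<in> axis_steps" "z \<in> W0"
  shows "odd (card {t' \<in> axis_steps. z + t' = u + t}) \<longleftrightarrow> z = u + t - rot t \<or> z = u + t + rot t"
proof -
  have rt: "rot t \<in> axis_steps" using assms(2) by simp
  have rW: "u + t + rot t \<in> W0" "u + t - rot t \<in> W0"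
    using assms(1,2) by (cases u; auto simp: axis_steps_def W0_def W1_def rot_def)+
  have ne: "rot t \<noteq> - rot t" using axis_uminus_ne[OF rt] by metis
  have "{t' \<in> axis_steps. z + t' = u + t} =
      (if z = u + t - rot t then {rot t} else if z = u + t + rot t then {- rot t} else {})" (is "?L = ?R")
  proof
    show "?L \<subseteq> ?R"
    proof
      fix t' assume "t' \<in> ?L"
      then have t': "t' \<in> axis_steps" "(u + t - rot t) + rot t = z + t'" by auto
      from same_edge[OF t'(2) rt t'(1)] rW(2) assms(3)
      have "u + t - rot t = z \<and> rot t = t' \<or> z = u + t - rot t + rot t + rot t \<and> t' = - rot t" by blast
      then show "t' \<in> ?R" using ne by auto
    qed
    show "?R \<subseteq> ?L" using rt by (auto split: if_splits)
  qed
  then show ?thesis by auto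
qed

text \<open>Close an \<open>H\<close>-path between two corners of \<open>f\<close> by a path \<open>Q\<close> along the boundary of \<open>f\<close>. The sides
  of \<open>f\<close> not belonging to \<open>H\<close> lie all in \<open>Q\<close> or all outside \<open>Q\<close>, as the faces across them are
  outside the closed curve.\<close>
lemma sides_in_same_arc:
  assumes conn: "induced_connected (- G)"
    and Q: "Q \<subseteq> axis_steps" and ab: "a \<in> V0" "b \<in> V0"
    and deg: "\<And>z. z \<in> W0 \<Longrightarrow> odd (card {t \<in> axis_steps. z + t \<in> (\<lambda>t. f + t) ` Q}) \<longleftrightarrow> (z = a) \<noteq> (z = b)"
    and k: "k \<in> axis_steps" "f + k + k \<notin> C" and l: "l \<in> axis_steps" "f + l + l \<notin> C"
  shows "k \<in> Q \<longleftrightarrow> l \<in> Q"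
proof -
  \<comment> \<open>Any covering provides a spanning tree of \<open>H\<close>. Its paths from
    \<open>a\<close> and from \<open>b\<close> to \<open>w\<close> add up modulo 2 to a connection
    of \<open>a\<close> with \<open>b\<close>.\<close>
  obtain w s where w: "w \<in> V0" "f - w \<in> diag_steps" "s \<in> Cov f w" using impurity_pair_exists by blast
  have flow: "reaches (nx0 s) w x" if "x \<in> V0" for x using Cov_flows[OF w(3) _ w(1,2)] that by blast
  have s: "s y \<in> axis_steps \<and> y + s y \<in> E" if "y \<in> V0 - {w}" for y
    using Cov_D[OF w(3), of y] that fC V01_disj by blast
  let ?F = "(\<lambda>y. y + s y) ` (V0 - {w})"
  let ?deg = "\<lambda>P z. card {t \<in> axis_steps. z + t \<in> P}"
  obtain P where P: "P \<subseteq> ?F" "\<And>z. z \<in> W0 \<Longrightarrow> odd (?deg P z) \<longleftrightarrow> (z = a) \<noteq> (z = w)"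
    using primal_path_parity[OF ab(1) flow[OF ab(1)] s subset_refl] by blast
  obtain P' where P': "P' \<subseteq> ?F" "\<And>z. z \<in> W0 \<Longrightarrow> odd (?deg P' z) \<longleftrightarrow> (z = b) \<noteq> (z = w)"
    using primal_path_parity[OF ab(2) flow[OF ab(2)] s subset_refl] by blast
  let ?Q = "(\<lambda>t. f + t) ` Q"
  define \<Gamma> where "\<Gamma> = sym_diff (sym_diff P P') ?Q"
  have FE: "?F \<subseteq> E" using s by blast
  have "finite \<Gamma>"
  proof (rule finite_subset)
    show "\<Gamma> \<subseteq> E \<union> (\<lambda>t. f + t) ` axis_steps" unfolding \<Gamma>_def using P(1) P'(1) FE Q by blast
  qed simp
  moreover have "even (?deg \<Gamma> z)" if z: "z \<in> W0" for z
  proof -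
    have "{t \<in> axis_steps. z + t \<in> \<Gamma>} = sym_diff (sym_diff {t \<in> axis_steps. z + t \<in> P} {t \<in> axis_steps. z + t \<in> P'})
        {t \<in> axis_steps. z + t \<in> ?Q}" unfolding \<Gamma>_def by blast
    then have "odd (?deg \<Gamma> z) \<longleftrightarrow> (odd (?deg P z) \<noteq> odd (?deg P' z)) \<noteq> odd (?deg ?Q z)"
      by (simp add: odd_card_sym_diff)
    then show ?thesis using P(2)[OF z] P'(2)[OF z] deg[OF z] by blast
  qed
  moreover have "u + t \<notin> \<Gamma>" if u: "u \<in> W1 - V1" and t: "t \<in> axis_steps" and ut: "u + t + t \<in> W1 - V1" for u t
  proof -
    have "u + t \<notin> E" using E_at_W1[of u t] u ut t by blast
    moreover have "u + t \<notin> ?Q"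
    proof
      assume "u + t \<in> ?Q"
      then obtain q where q: "q \<in> axis_steps" "u + t = f + q" using Q by blast
      from same_edge[OF q(2) t q(1)] u fW1 have "u = f \<or> f = u + t + t" by blast
      then show False using u ut by blast
    qed
    ultimately show ?thesis using P(1) P'(1) FE unfolding \<Gamma>_def by blast
  qed
  \<comment> \<open>\<open>even_edges_bound\<close> is applied with \<open>insert f C\<close> in
    place of \<open>C\<close>, since \<open>\<Gamma>\<close> may contain sides of \<open>f\<close>
    that are not edges of \<open>H\<close>.\<close>
  ultimately have "\<exists>X\<subseteq>V1. \<forall>u\<in>W1. \<forall>t\<in>axis_steps. u + t \<in> \<Gamma> \<longleftrightarrow> (u \<in> X) \<noteq> (u + t + t \<in> X)"
    by (intro even_edges_bound outer_faces_edge_connected[OF conn]) (simp_all add: finC)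
  then obtain X where X: "X \<subseteq> V1" "\<And>u t. u \<in> W1 \<Longrightarrow> t \<in> axis_steps \<Longrightarrow> u + t \<in> \<Gamma> \<longleftrightarrow> (u \<in> X) \<noteq> (u + t + t \<in> X)"
    by blast
  have "t \<in> Q \<longleftrightarrow> f \<in> X" if t: "t \<in> axis_steps" "f + t + t \<notin> C" for t
  proof -
    have "f + t \<notin> E" using E_at_W1[OF fW1 t(1)] t(2) fC by blast
    then have "f + t \<in> \<Gamma> \<longleftrightarrow> f + t \<in> ?Q" using P(1) P'(1) FE unfolding \<Gamma>_def by blast
    moreover have "f + t + t \<notin> X" using X(1) t axis_two_ne[OF t(1), of f] by blast
    moreover have "f + t \<in> ?Q \<longleftrightarrow> t \<in> Q" by auto
    ultimately show ?thesis using X(2)[OF fW1 t(1)] by blast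
  qed
  then show ?thesis using k l by blast
qed

lemma card_corners_f:
  assumes conn: "induced_connected (- G)"
  shows "card {w \<in> V0. f - w \<in> diag_steps} = d_star C f + 1"
proof -
  \<comment> \<open>\<open>c t\<close> concerns the counterclockwise end of the side
    \<open>f + t\<close>, and \<open>e t\<close> says that this side belongs to
    \<open>H\<close>.\<close>
  define c where "c t \<longleftrightarrow> f + t + rot t \<in> V0" for t
  define e where "e t \<longleftrightarrow> f + t + t \<in> C" for t
  have r4: "rot (rot t) = - t" for t by (simp add: rot_def prod_eq_iff)
  have ec: "e t \<Longrightarrow> c t \<and> f + t - rot t \<in> V0" if t: "t \<in> axis_steps" for t
  proof -
    assume "e t"
    then have "f + t \<in> E" using E_at_W1[OF fW1 t] by (simp add: e_def)
    moreover have "f + t + rot t \<in> W0" "f + t + (- rot t) \<in> W0"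
      using fW1 t by (cases f; auto simp: axis_steps_def W0_def W1_def rot_def)+
    ultimately show "c t \<and> f + t - rot t \<in> V0"
      using E_ends[of "f + t" "rot t"] E_ends[of "f + t" "- rot t"] t by (simp add: c_def)
  qed
  \<comment> \<open>Consecutive corners are joined by the side \<open>t\<close> alone. If this side
    is missing from \<open>H\<close>, no other side is.\<close>
  have arc1: "k = t \<longleftrightarrow> l = t"
    if t: "t \<in> axis_steps" and ab: "f + t - rot t \<in> V0" "c t" and kl: "k \<in> axis_steps" "\<not> e k" "l \<in> axis_steps" "\<not> e l" for t k l
  proof -
    have "k \<in> {t} \<longleftrightarrow> l \<in> {t}"
    proof (rule sides_in_same_arc[OF conn])
      show "odd (card {t' \<in> axis_steps. z + t' \<in> (\<lambda>t. f + t) ` {t}}) \<longleftrightarrow> (z = f + t - rot t) \<noteq> (z = f + t + rot t)"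
        if "z \<in> W0" for z
      proof -
        have "f + t - rot t \<noteq> f + t + rot t" using axis_uminus_ne[of "rot t"] t by simp
        then show ?thesis using single_edge_degree[OF fW1 t that] by auto
      qed
    qed (use that in \<open>auto simp: c_def e_def\<close>)
    then show ?thesis by simp
  qed
  \<comment> \<open>Opposite corners are joined by \<open>t\<close> and \<open>rot t\<close>.
    Missing sides cannot occur in both halves of the boundary of \<open>f\<close>, so one half lies
    in \<open>H\<close>.\<close>
  have arc2: "(k = t \<or> k = rot t) \<longleftrightarrow> (l = t \<or> l = rot t)"
    if t: "t \<in> axis_steps" and ab: "f + t - rot t \<in> V0" "f + rot t - t \<in> V0"
      and kl: "k \<in> axis_steps" "\<not> e k" "l \<in> axis_steps" "\<not> e l" for t k l
  proof -
    have rt: "rot t \<in> axis_steps" using t by simp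
    have "k \<in> {t, rot t} \<longleftrightarrow> l \<in> {t, rot t}"
    proof (rule sides_in_same_arc[OF conn])
      fix z assume z: "z \<in> W0"
      have ne: "t \<noteq> rot t" using t by (auto simp: axis_steps_def rot_def)
      have "{t' \<in> axis_steps. z + t' \<in> (\<lambda>t. f + t) ` {t, rot t}} =
          sym_diff {t' \<in> axis_steps. z + t' = f + t} {t' \<in> axis_steps. z + t' = f + rot t}"
        using ne by auto
      then have "odd (card {t' \<in> axis_steps. z + t' \<in> (\<lambda>t. f + t) ` {t, rot t}}) \<longleftrightarrow>
          odd (card {t' \<in> axis_steps. z + t' = f + t}) \<noteq> odd (card {t' \<in> axis_steps. z + t' = f + rot t})"
        using odd_card_sym_diff[of "{t' \<in> axis_steps. z + t' = f + t}" "{t' \<in> axis_steps. z + t' = f + rot t}"] by simp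
      also have "\<dots> \<longleftrightarrow> (z = f + t - rot t \<or> z = f + t + rot t) \<noteq> (z = f + rot t + t \<or> z = f + rot t - t)"
        unfolding single_edge_degree[OF fW1 t z] single_edge_degree[OF fW1 rt z] r4 by simp
      also have "\<dots> \<longleftrightarrow> (z = f + t - rot t) \<noteq> (z = f + rot t - t)"
        using t by (cases z; cases f) (auto simp: axis_steps_def rot_def)
      finally show "odd (card {t' \<in> axis_steps. z + t' \<in> (\<lambda>t. f + t) ` {t, rot t}}) \<longleftrightarrow> (z = f + t - rot t) \<noteq> (z = f + rot t - t)" .
    qed (use that in \<open>auto simp: e_def\<close>)
    then show ?thesis by simp
  qed
  obtain p q where f: "f = (p, q)" by force
  let ?e0 = "(p + 2, q) \<in> C" and ?e1 = "(p, q + 2) \<in> C" and ?e2 = "(p - 2, q) \<in> C" and ?e3 = "(p, q - 2) \<in> C"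
  let ?c0 = "(p + 1, q + 1) \<in> V0" and ?c1 = "(p - 1, q + 1) \<in> V0" and ?c2 = "(p - 1, q - 1) \<in> V0" and ?c3 = "(p + 1, q - 1) \<in> V0"
  have dstar: "d_star C f = of_bool ?e0 + of_bool ?e2 + of_bool ?e1 + of_bool ?e3"
  proof -
    have "bij_betw (\<lambda>t. f + t + t) {t \<in> axis_steps. f + t + t \<in> C} {u \<in> C. pdiff f u \<in> lattice2_steps}"
      unfolding bij_betw_def
    proof
      show "inj_on (\<lambda>t. f + t + t) {t \<in> axis_steps. f + t + t \<in> C}"
        by (auto simp: inj_on_def axis_steps_def)
      show "(\<lambda>t. f + t + t) ` {t \<in> axis_steps. f + t + t \<in> C} = {u \<in> C. pdiff f u \<in> lattice2_steps}"
      proof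
        have "f - (f + t + t) \<in> lattice2_steps" if "t \<in> axis_steps" for t
          using that by (cases f) (auto simp: axis_steps_def lattice2_steps_def)
        then show "(\<lambda>t. f + t + t) ` {t \<in> axis_steps. f + t + t \<in> C} \<subseteq> {u \<in> C. pdiff f u \<in> lattice2_steps}"
          unfolding pdiff_eq_minus by blast
        show "{u \<in> C. pdiff f u \<in> lattice2_steps} \<subseteq> (\<lambda>t. f + t + t) ` {t \<in> axis_steps. f + t + t \<in> C}"
        proof
          fix u assume u: "u \<in> {u \<in> C. pdiff f u \<in> lattice2_steps}"
          then have "f - u \<in> lattice2_steps" by (simp add: pdiff_eq_minus)
          then have "\<exists>t\<in>axis_steps. f - u = - t - t" by (auto simp: lattice2_steps_def axis_steps_def)
          then obtain t where t: "t \<in> axis_steps" "f - u = - t - t" by blast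
          have "u = f - (f - u)" by simp
          also have "\<dots> = f + t + t" unfolding t(2) by simp
          finally show "u \<in> (\<lambda>t. f + t + t) ` {t \<in> axis_steps. f + t + t \<in> C}" using t(1) u by blast
        qed
      qed
    qed
    then have "d_star C f = card {t \<in> axis_steps. f + t + t \<in> C}"
      unfolding d_star_def by (simp add: bij_betw_same_card)
    then show ?thesis unfolding card_axis_eq by (simp add: f add.commute)
  qed
  have corners: "card {w \<in> V0. f - w \<in> diag_steps} = of_bool ?c0 + of_bool ?c2 + of_bool ?c1 + of_bool ?c3"
  proof -
    have "{w \<in> V0. f - w \<in> diag_steps} = (\<lambda>t. f - t) ` {t \<in> diag_steps. f - t \<in> V0}"
    proof
      show "{w \<in> V0. f - w \<in> diag_steps} \<subseteq> (\<lambda>t. f - t) ` {t \<in> diag_steps. f - t \<in> V0}"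
      proof
        fix w assume "w \<in> {w \<in> V0. f - w \<in> diag_steps}"
        then show "w \<in> (\<lambda>t. f - t) ` {t \<in> diag_steps. f - t \<in> V0}" by (intro image_eqI[of _ _ "f - w"]) auto
      qed
    qed auto
    then have "card {w \<in> V0. f - w \<in> diag_steps} = card {t \<in> diag_steps. f - t \<in> V0}"
      by (simp add: card_image inj_on_def)
    also have "\<dots> = (\<Sum>t\<in>diag_steps. of_bool (f - t \<in> V0))"
      by (subst sum_of_bool_eq) (auto simp: Collect_conj_eq)
    also have "\<dots> = of_bool ?c0 + of_bool ?c2 + of_bool ?c1 + of_bool ?c3"
      by (simp add: diag_steps_def f)
    finally show ?thesis .
  qed
  have ax: "(1,0) \<in> axis_steps" "(-1,0) \<in> axis_steps" "(0,1) \<in> axis_steps" "(0,-1) \<in> axis_steps"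
    by (auto simp: axis_steps_def)
  \<comment> \<open>Otherwise \<open>{f}\<close> would be a component of the squares outside
    \<open>C\<close>, which are connected and extend arbitrarily far to the right.\<close>
  have n4: "\<not> (?e0 \<and> ?e1 \<and> ?e2 \<and> ?e3)"
  proof
    assume all: "?e0 \<and> ?e1 \<and> ?e2 \<and> ?e3"
    have "edge_closed (W1 - C) {f}"
      using all fW1 fC by (auto simp: edge_closed_def lattice2_steps_def f)
    then have "W1 - C \<subseteq> {f}"
      using complement_faces_edge_connected[OF conn_compl CW1] unfolding edge_connected_def by blast
    moreover obtain u where "u \<in> W1" "\<forall>e\<in>V1. fst e < fst u" using far_face[OF finite_V1] by blast
    ultimately show False by blast
  qed
  have some: "?c0 \<or> ?c1 \<or> ?c2 \<or> ?c3"
  proof -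
    obtain w where w: "w \<in> V0" "f - w \<in> diag_steps" using corner_f by blast
    then have "{w \<in> V0. f - w \<in> diag_steps} \<noteq> {}" by blast
    then have "card {w \<in> V0. f - w \<in> diag_steps} \<noteq> 0" by simp
    then show ?thesis unfolding corners by auto
  qed
  have E0: "e (1,0) = ?e0" "e (0,1) = ?e1" "e (-1,0) = ?e2" "e (0,-1) = ?e3" by (simp_all add: e_def f add.commute)
  have C0: "c (1,0) = ?c0" "c (0,1) = ?c1" "c (-1,0) = ?c2" "c (0,-1) = ?c3" by (simp_all add: c_def f rot_def)
  have adj: "?e0 \<Longrightarrow> ?c0 \<and> ?c3" "?e1 \<Longrightarrow> ?c1 \<and> ?c0" "?e2 \<Longrightarrow> ?c2 \<and> ?c1" "?e3 \<Longrightarrow> ?c3 \<and> ?c2"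
    using ec[OF ax(1)] ec[OF ax(2)] ec[OF ax(3)] ec[OF ax(4)] unfolding E0 C0 by (simp_all add: f rot_def)
  have A1: "?c3 \<Longrightarrow> ?c0 \<Longrightarrow> \<not> ?e0 \<Longrightarrow> ?e1 \<and> ?e2 \<and> ?e3"
    using arc1[OF ax(1), of "(1,0)" "(0,1)"] arc1[OF ax(1), of "(1,0)" "(-1,0)"] arc1[OF ax(1), of "(1,0)" "(0,-1)"] ax
    unfolding E0 C0 by (simp add: f rot_def) blast
  have A2: "?c0 \<Longrightarrow> ?c1 \<Longrightarrow> \<not> ?e1 \<Longrightarrow> ?e0 \<and> ?e2 \<and> ?e3"
    using arc1[OF ax(3), of "(0,1)" "(1,0)"] arc1[OF ax(3), of "(0,1)" "(-1,0)"] arc1[OF ax(3), of "(0,1)" "(0,-1)"] ax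
    unfolding E0 C0 by (simp add: f rot_def) blast
  have A3: "?c1 \<Longrightarrow> ?c2 \<Longrightarrow> \<not> ?e2 \<Longrightarrow> ?e0 \<and> ?e1 \<and> ?e3"
    using arc1[OF ax(2), of "(-1,0)" "(1,0)"] arc1[OF ax(2), of "(-1,0)" "(0,1)"] arc1[OF ax(2), of "(-1,0)" "(0,-1)"] ax
    unfolding E0 C0 by (simp add: f rot_def) blast
  have A4: "?c2 \<Longrightarrow> ?c3 \<Longrightarrow> \<not> ?e3 \<Longrightarrow> ?e0 \<and> ?e1 \<and> ?e2"
    using arc1[OF ax(4), of "(0,-1)" "(1,0)"] arc1[OF ax(4), of "(0,-1)" "(0,1)"] arc1[OF ax(4), of "(0,-1)" "(-1,0)"] ax
    unfolding E0 C0 by (simp add: f rot_def) blast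
  have B1: "?c3 \<Longrightarrow> ?c1 \<Longrightarrow> (?e0 \<and> ?e1) \<or> (?e2 \<and> ?e3)"
    using arc2[OF ax(1), of "(1,0)" "(-1,0)"] arc2[OF ax(1), of "(1,0)" "(0,-1)"]
      arc2[OF ax(1), of "(0,1)" "(-1,0)"] arc2[OF ax(1), of "(0,1)" "(0,-1)"] ax
    unfolding E0 by (simp add: f rot_def) blast
  have B2: "?c0 \<Longrightarrow> ?c2 \<Longrightarrow> (?e1 \<and> ?e2) \<or> (?e0 \<and> ?e3)"
    using arc2[OF ax(3), of "(0,1)" "(1,0)"] arc2[OF ax(3), of "(0,1)" "(0,-1)"]
      arc2[OF ax(3), of "(-1,0)" "(1,0)"] arc2[OF ax(3), of "(-1,0)" "(0,-1)"] ax
    unfolding E0 by (simp add: f rot_def) blast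
  show ?thesis
    unfolding corners dstar
  proof (rule cyclic_count[OF n4 some])
    show "?e0 \<longrightarrow> ?c0 \<and> ?c3" "?e1 \<longrightarrow> ?c1 \<and> ?c0" "?e2 \<longrightarrow> ?c2 \<and> ?c1" "?e3 \<longrightarrow> ?c3 \<and> ?c2"
      using adj by iprover+
    show "?c3 \<and> ?c0 \<longrightarrow> ?e0 \<or> ?e1 \<and> ?e2 \<and> ?e3" using A1 by blast
    show "?c0 \<and> ?c1 \<longrightarrow> ?e1 \<or> ?e0 \<and> ?e2 \<and> ?e3" using A2 by blast
    show "?c1 \<and> ?c2 \<longrightarrow> ?e2 \<or> ?e0 \<and> ?e1 \<and> ?e3" using A3 by blast
    show "?c2 \<and> ?c3 \<longrightarrow> ?e3 \<or> ?e0 \<and> ?e1 \<and> ?e2" using A4 by blast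
    show "?c3 \<and> ?c1 \<longrightarrow> (?e0 \<and> ?e1) \<or> (?e2 \<and> ?e3)" using B1 by blast
    show "?c0 \<and> ?c2 \<longrightarrow> (?e1 \<and> ?e2) \<or> (?e0 \<and> ?e3)" using B2 by blast
  qed
qed

end

theorem mainTheorem10:
  fixes C :: "pt set" and f :: pt and p :: "pt \<Rightarrow> real" and v w :: pt
  assumes finC: "finite C" and CW1: "C \<subseteq> W1"
    and sc_faces: "simply_connected (\<Union>c\<in>C. face_square c)"
    and fW1: "f \<in> W1" and fnotC: "f \<notin> C"
    and sc_perp: "simply_connected (perp_complex (insert f C))"
    and vstar: "\<exists>vs. on_outer_boundary C vs \<and> pdiff vs f \<in> diag_steps"
    and normalG: "normal (VG C f)"
    and p_sol: "\<forall>u\<in>C. (\<Sum>u'\<in>C. A_entry u u' * p u') = b_entry f u"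
    and p_f: "p f = 1"
    and vH: "v \<in> insert f C"
    and e_edge: "{v, w} \<in> induced_edges (VG C f)"
    and e_diag: "diagonal_edge {v, w}"
  shows "real (card {M. dimer_covering (VG C f) M \<and> {v, w} \<in> M})
           / real (card {M. dimer_covering (VG C f) M})
         = p v / (4 * (\<Sum>u\<in>insert f C. p u) + real (d_star C f) - 3)"
proof -
  interpret temperley C f
  proof
    show "connected (\<Union>c\<in>C. face_square c)"
      using sc_faces by (rule simply_connected_imp_connected)
    show "connected (- (\<Union>c\<in>C. face_square c))"
      using finC sc_faces by (rule compl_face_union_connected)
    obtain vs where vs: "vs \<in> VH C" "vs - f \<in> diag_steps"
      using vstar by (auto simp: on_outer_boundary_def pdiff_eq_minus)
    moreover have "f - vs \<in> diag_steps" using uminus_diag[of "vs - f"] vs(2) by simp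
    ultimately show "\<exists>w\<in>VH C. f - w \<in> diag_steps" by blast
  qed (use finC CW1 fW1 fnotC in auto)
  have vW: "v \<in> W1" using vH V1_W1 by blast
  obtain x y where xy: "{v, w} = {x, y}" "x - y \<in> diag_steps"
    using e_diag by (auto simp: diagonal_edge_def pdiff_eq_minus)
  then have "v - w \<in> diag_steps" using uminus_diag[of "x - y"] by (auto simp: doubleton_eq_iff)
  then have vw: "v - w \<in> diag_steps" "w - v \<in> diag_steps" using uminus_diag[of "v - w"] by simp_all
  have "w \<in> W0" using W0_diag[OF vw(2), of v] vW by simp
  moreover have "w \<in> VG C f" using e_edge by (auto simp: induced_edges_def doubleton_eq_iff)
  ultimately have w: "w \<in> V0" using G_split E_not V1_W1 W0_W1_disjoint by blast
  let ?\<tau> = "real (card (trees f))"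
  have trees: "real (card (trees u)) = p u * ?\<tau>" if "u \<in> V1" for u
    using p_eq_trees[OF p_sol p_f that] .
  have "{M. dimer_covering G M \<and> {v, w} \<in> M} = {M \<in> dimers. {v, w} \<in> M}" by (auto simp: dimers_def)
  then have num: "real (card {M. dimer_covering G M \<and> {v, w} \<in> M}) = p v * ?\<tau>"
    using card_dimers_impurity[OF vH w vw(1)] card_Cov[OF vH w vw(1)] trees[OF vH] by simp
  have "real (card dimers) = 4 * (\<Sum>u\<in>C. real (card (trees u))) + real (d_star C f + 1) * ?\<tau>"
    using card_corners_f normalG unfolding card_dimers normal_def by (simp add: algebra_simps)
  also have "(\<Sum>u\<in>C. real (card (trees u))) = (\<Sum>u\<in>C. p u) * ?\<tau>"
    unfolding sum_distrib_right by (rule sum.cong[OF refl], rule trees) blast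
  \<comment> \<open>Including \<open>f\<close> in the sum adds \<open>4 * p f = 4\<close>, so the
    coefficient \<open>d_star C f + 1\<close> becomes \<open>d_star C f - 3\<close>.\<close>
  also have "4 * ((\<Sum>u\<in>C. p u) * ?\<tau>) + real (d_star C f + 1) * ?\<tau> =
      (4 * (\<Sum>u\<in>insert f C. p u) + real (d_star C f) - 3) * ?\<tau>"
    using finC fnotC p_f by (simp add: algebra_simps)
  finally have den: "real (card {M. dimer_covering G M}) = \<dots>" by (simp add: dimers_def)
  have "?\<tau> \<noteq> 0" using card_trees_f_pos by linarith
  then show ?thesis unfolding num den by (rule mult_divide_mult_cancel_right)
qed

end
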